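(* Let $\omega$ be a radial weight and $1<p<2$ such that either $$\omega_{2x}\lesssim\left(\omega_{(p+\varepsilon)x}\right)^{\frac1p}\left(\omega_{p'x}\right)^{\frac1{p'}},\quad 0\le x<\infty,$$ for some $\varepsilon=\varepsilon(\omega)>0$, or for each $0\le y<\infty$ there exists $x=x(y)\in[0,\infty)$ such that $$-L_\omega''(y)\,y^2\le Cx\int_{\frac{2+p}{2}x}^{2x}\left(-L_\omega''(t)\right)dt$$ for some constant $C=C(\omega,p)>0$ (independent of $y$). Then $P_\omega:L^p_\omega\to L^p_\omega$ is bounded if and only if $\omega\in\widehat{\mathcal{D}}$.
   Context: $\mathbb{D}$ is the open unit disc of $\mathbb{C}$ and $dA(z)=\frac{dx\,dy}{\pi}$. A radial weight is a nonnegative function $\omega\in L^1([0,1))$ extended to $\mathbb{D}$ by $\omega(z)=\omega(|z|)$; it is assumed throughout that $\widehat{\omega}(z)=\int_{|z|}^1\omega(s)\,ds>0$ for all $z\in\mathbb{D}$. Write $\omega_x=\int_0^1r^x\omega(r)\,dr$ and $L_\omega(x)=-\log\omega_x$ for all $0\le x<\infty$, and $p'$ for the conjugate exponent, $\frac1p+\frac1{p'}=1$. $a(x)\lesssim b(x)$ means $a(x)\le Cb(x)$ for some constant $C>0$ independent of $x$. $L^p_\omega$ is the space of measurable $f$ on $\mathbb{D}$ with $\|f\|_{L^p_\omega}^p=\int_{\mathbb{D}}|f(z)|^p\omega(z)\,dA(z)<\infty$. The Bergman projection is $P_\omega(f)(z)=\int_{\mathbb{D}}f(\zeta)\overline{B^\omega_z(\zeta)}\,\omega(\zeta)\,dA(\zeta)$,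 where $B^\omega_z(\zeta)=\sum_{n=0}^\infty\frac{(\overline{z}\zeta)^n}{2\omega_{2n+1}}$. $\omega\in\widehat{\mathcal{D}}$ if there is $C\ge1$ with $\widehat{\omega}(r)\le C\widehat{\omega}\left(\frac{1+r}{2}\right)$ for all $0\le r<1$. *)

theory Defs
  imports "HOL-Analysis.Analysis"
begin

text \<open>
  A radial weight is represented by its profile \<open>\<omega> :: real \<Rightarrow> real\<close> on \<open>[0,1)\<close>;
  its extension to the unit disc is \<open>\<lambda>z. \<omega> (cmod z)\<close>. Values of \<open>\<omega>\<close> outside \<open>[0,1)\<close>,
  and of functions on the disc outside \<open>ball 0 1\<close>, play no role.
\<close>

definition tail_integral :: "(real \<Rightarrow> real) \<Rightarrow> real \<Rightarrow> real" where
  "tail_integral \<omega> r = (LINT s:{r..<1}|lebesgue. \<omega> s)"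

definition radial_weight :: "(real \<Rightarrow> real) \<Rightarrow> bool" where
  "radial_weight \<omega> \<longleftrightarrow>
     (\<forall>r\<in>{0..<1}. 0 \<le> \<omega> r) \<and>
     set_integrable lebesgue {0..<1} \<omega> \<and>
     (\<forall>z\<in>ball (0::complex) 1. 0 < tail_integral \<omega> (cmod z))"

definition moment :: "(real \<Rightarrow> real) \<Rightarrow> real \<Rightarrow> real" where
  "moment \<omega> x = (LINT r:{0..<1}|lebesgue. r powr x * \<omega> r)"

definition log_moment :: "(real \<Rightarrow> real) \<Rightarrow> real \<Rightarrow> real" where
  "log_moment \<omega> x = - ln (moment \<omega> x)"

text \<open>The doubling class \<open>\<D>\<close>-hat.\<close>

definition D_hat :: "(real \<Rightarrow> real) set" where
  "D_hat = {\<omega>. radial_weight \<omega> \<and>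
     (\<exists>C\<ge>1. \<forall>r\<in>{0..<1}. tail_integral \<omega> r \<le> C * tail_integral \<omega> ((1 + r) / 2))}"

definition dA :: "complex measure" where
  "dA = density (lebesgue_on (ball 0 1)) (\<lambda>_. ennreal (1 / pi))"

definition Lp_space :: "real \<Rightarrow> (real \<Rightarrow> real) \<Rightarrow> (complex \<Rightarrow> complex) set" where
  "Lp_space p \<omega> = {f. f \<in> borel_measurable dA \<and>
     integrable dA (\<lambda>z. cmod (f z) powr p * \<omega> (cmod z))}"

definition Lp_norm :: "real \<Rightarrow> (real \<Rightarrow> real) \<Rightarrow> (complex \<Rightarrow> complex) \<Rightarrow> real" where
  "Lp_norm p \<omega> f = (LINT z|dA. cmod (f z) powr p * \<omega> (cmod z)) powr (1 / p)"

definition bergman_kernel :: "(real \<Rightarrow> real) \<Rightarrow> complex \<Rightarrow> complex \<Rightarrow> complex" where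
  "bergman_kernel \<omega> z \<zeta> =
     (\<Sum>n. (cnj z * \<zeta>) ^ n / of_real (2 * moment \<omega> (2 * real n + 1)))"

definition bergman_projection ::
  "(real \<Rightarrow> real) \<Rightarrow> (complex \<Rightarrow> complex) \<Rightarrow> complex \<Rightarrow> complex" where
  "bergman_projection \<omega> f z =
     (LINT \<zeta>|dA. f \<zeta> * cnj (bergman_kernel \<omega> z \<zeta>) * of_real (\<omega> (cmod \<zeta>)))"

text \<open>
  Boundedness on the weighted \<open>L\<^sup>p\<close> space. Here linearity is not part of the predicate: it is used only
  for the integral operator above, where the integrand is integrable for every
  \<open>f\<close> in the space and every \<open>z\<close> in the disc when \<open>1 < p\<close>.
\<close>

definition bounded_on_Lp ::
  "real \<Rightarrow> (real \<Rightarrow> real) \<Rightarrow> ((complex \<Rightarrow> complex) \<Rightarrow> complex \<Rightarrow> complex) \<Rightarrow> bool" where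
  "bounded_on_Lp p \<omega> T \<longleftrightarrow>
     (\<exists>C. \<forall>f\<in>Lp_space p \<omega>. T f \<in> Lp_space p \<omega> \<and> Lp_norm p \<omega> (T f) \<le> C * Lp_norm p \<omega> f)"

definition moment_condition :: "real \<Rightarrow> real \<Rightarrow> (real \<Rightarrow> real) \<Rightarrow> bool" where
  "moment_condition p p' \<omega> \<longleftrightarrow>
     (\<exists>\<epsilon>>0. \<exists>C>0. \<forall>x\<ge>0.
        moment \<omega> (2 * x) \<le>
          C * (moment \<omega> ((p + \<epsilon>) * x) powr (1 / p) * moment \<omega> (p' * x) powr (1 / p')))"

text \<open>
  For \<open>y > 0\<close> the function \<open>log_moment \<omega>\<close> is smooth near \<open>y\<close>, so \<open>deriv\<close> is the genuine derivative.
  At \<open>y = 0\<close> the second derivative need not exist; there the left-hand side is \<open>0\<close> because of the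
  factor \<open>y\<^sup>2\<close>, and the inequality holds with \<open>x = 0\<close>.
\<close>

definition convexity_condition :: "real \<Rightarrow> (real \<Rightarrow> real) \<Rightarrow> bool" where
  "convexity_condition p \<omega> \<longleftrightarrow>
     (\<exists>C>0. \<forall>y\<ge>0. \<exists>x\<ge>0.
        - (deriv ^^ 2) (log_moment \<omega>) y * y\<^sup>2 \<le>
          C * x * (LINT t:{(2 + p) / 2 * x..2 * x}|lebesgue. - (deriv ^^ 2) (log_moment \<omega>) t))"

end

(*
  Sufficiency. The coefficients a_n = 1/(2 omega_(2n+1)) increase, so the kernel
  K(w) = sum a_n w^n equals sum b_N w^N / (1-w) with b_N = a_N - a_(N-1) >= 0. On a circle, convolution
  with K(w e^(i t)) is thus a positive combination of modulated Cauchy transforms, and M. Riesz' theorem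
  bounds its L^p norm by a multiple of (1-|w|) K(|w|), which for omega in D-hat is at most a constant
  times 1/tail(|w|). After averaging over rotations, boundedness of the projection reduces to a Schur
  test for the kernel 1/max(tail|z|, tail|zeta|), with test function tail^(-1/2).

  Necessity. The functions zeta^n |zeta|^(n(p'-2)) give
  omega_(px)^(1/p) omega_(p'x)^(1/p') <= C omega_(2x). Either hypothesis turns this into
  omega_x <= C omega_(2x): the moment condition by comparison, the convexity condition because the
  concavity of L bounds x times the integral of -L'' over [(2+p)x/2, 2x], hence -L''(y) y^2. Doubling
  of the moments implies doubling of the tail integral.
*)
theory Submission
  imports Defs "HOL-Complex_Analysis.Complex_Analysis"
begin

text \<open>The inequality extracted from the test functions is a reverse Hoelder inequality. The
  opposite bound, of \<open>mom (2 * x)\<close> by the geometric mean of the moments at px and p'x,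
  always holds, since px/p + p'x/p' = 2x. For L the reverse inequality says that the Jensen gap at
  2x between the points px and p'x stays bounded in x. This is not yet doubling, and each of the two
  hypotheses supplies the passage.

  For sufficiency, the obstacle is that absolute values of the Cauchy factors 1/(1-w) have circle
  means that grow like a logarithm. Cancellation on circles must therefore be used before any
  absolute value is taken; only afterwards does the kernel become positive and radial. The Schur
  test then works for every such weight, because the set where \<open>tail\<close> is at most u has
  mass at most 2u, as for twice Lebesgue measure on the half-line, where 1/max(u,v) is a homogeneous
  kernel of degree -1.

  A single Hoelder inequality with a free weight and a non-optimal constant serves the Poisson
  averages, the sum over N and the Schur test.\<close>

text \<open>If \<open>y\<close> is not integrable, its Bochner integral on the left-hand side is \<open>0\<close>.\<close>
lemma crude_hoelder:
  fixes y :: "'a \<Rightarrow> complex" and k :: "'a \<Rightarrow> real"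
  assumes [measurable]: "y \<in> borel_measurable M" "k \<in> borel_measurable M"
    and k0: "AE x in M. 0 < k x \<or> (0 \<le> k x \<and> y x = 0)"
    and K: "(\<integral>\<^sup>+x. ennreal (k x) \<partial>M) \<le> ennreal K" "0 < K" and p: "1 < p"
  shows "ennreal (cmod (\<integral>x. y x \<partial>M) powr p)
    \<le> ennreal (2 powr p * K powr (p - 1)) * (\<integral>\<^sup>+x. ennreal (cmod (y x) powr p * k x powr (1 - p)) \<partial>M)" (is "_ \<le> _ * ?X")
proof (cases "?X = \<infinity> \<or> \<not> integrable M y")
  case True
  then show ?thesis
  proof
    assume "?X = \<infinity>"
    then show ?thesis using K by (simp add: ennreal_mult_top)
  next
    assume "\<not> integrable M y"
    then show ?thesis by (simp add: not_integrable_integral_eq)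
  qed
next
  case False
  then obtain x where x: "0 \<le> x" "?X = ennreal x"
    by (cases "?X") auto
  define a where "a = cmod (\<integral>x. y x \<partial>M)"
  have a0: "0 \<le> a" by (simp add: a_def)
  \<comment> \<open>Pointwise, either |y| \<le> l k, or |y| > l k and then |y| = |y|^p |y|^(1-p)
    \<le> |y|^p (l k)^(1-p), because 1 - p < 0. This replaces Young's inequality, and the price is
    the factor 2^p.\<close>
  have bd: "a \<le> l * K + l powr (1 - p) * x" if l: "0 < l" for l
  proof -
    have "ennreal a \<le> (\<integral>\<^sup>+x. ennreal (cmod (y x)) \<partial>M)"
      unfolding a_def using False by (intro integral_norm_bound_ennreal) auto
    also have "\<dots> \<le> (\<integral>\<^sup>+x. ennreal l * ennreal (k x) + ennreal (l powr (1 - p)) * ennreal (cmod (y x) powr p * k x powr (1 - p)) \<partial>M)"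
    proof (rule nn_integral_mono_AE, use k0 in eventually_elim)
      fix z assume k: "0 < k z \<or> (0 \<le> k z \<and> y z = 0)"
      have kz: "0 \<le> k z" using k by auto
      then have lk: "0 \<le> l * k z" using l by simp
      have "cmod (y z) \<le> l * k z + l powr (1 - p) * (cmod (y z) powr p * k z powr (1 - p))"
      proof (cases "cmod (y z) \<le> l * k z")
        case True
        moreover have "0 \<le> l powr (1 - p) * (cmod (y z) powr p * k z powr (1 - p))" by simp
        ultimately show ?thesis using lk by linarith
      next
        case F: False
        then have kz: "0 < k z" using k lk by auto
        define b where "b = cmod (y z)"
        have b: "0 < b" "l * k z < b" using F mult_pos_pos[OF l kz] by (auto simp: b_def)
        have "b = b powr p * b powr (1 - p)" using b by (simp flip: powr_add)
        also have "\<dots> \<le> b powr p * (l * k z) powr (1 - p)"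
          using b l kz p by (intro mult_left_mono powr_mono2') auto
        also have "\<dots> = l powr (1 - p) * (b powr p * k z powr (1 - p))"
          using l kz by (simp add: powr_mult mult_ac)
        finally show ?thesis using lk unfolding b_def by linarith
      qed
      then have "ennreal (cmod (y z)) \<le> ennreal (l * k z + l powr (1 - p) * (cmod (y z) powr p * k z powr (1 - p)))"
        by (rule ennreal_leI)
      also have "\<dots> = ennreal l * ennreal (k z) + ennreal (l powr (1 - p)) * ennreal (cmod (y z) powr p * k z powr (1 - p))"
        using l kz by (simp add: ennreal_mult ennreal_plus)
      finally show "ennreal (cmod (y z)) \<le> ennreal l * ennreal (k z) + ennreal (l powr (1 - p)) * ennreal (cmod (y z) powr p * k z powr (1 - p))" .
    qed
    also have "\<dots> = ennreal l * (\<integral>\<^sup>+x. ennreal (k x) \<partial>M) + ennreal (l powr (1 - p)) * ennreal x"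
      by (simp add: nn_integral_add nn_integral_cmult x)
    also have "\<dots> \<le> ennreal l * ennreal K + ennreal (l powr (1 - p)) * ennreal x"
      by (intro add_mono mult_left_mono K) auto
    also have "\<dots> = ennreal (l * K + l powr (1 - p) * x)"
      using l K x by (simp add: ennreal_mult ennreal_plus)
    finally show ?thesis using l K x by (subst (asm) ennreal_le_iff) auto
  qed
  have "a powr p \<le> 2 powr p * K powr (p - 1) * x"
  proof (cases "x = 0")
    case True
    have "a \<le> 0"
    proof (rule field_le_epsilon)
      fix d :: real assume "0 < d"
      then show "a \<le> 0 + d" using bd[of "d / K"] K True by simp
    qed
    then show ?thesis using a0 True by simp
  next
    case False
    then have x0: "0 < x" using x by simp
    \<comment> \<open>This l makes the two terms of \<open>bd\<close> equal.\<close>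
    define l where "l = x powr (1 / p) * K powr (- 1 / p)"
    have l: "0 < l" using x0 K by (simp add: l_def)
    have 1: "l * K = x powr (1 / p) * K powr (1 - 1 / p)"
    proof -
      have "K powr (- 1 / p) * K = K powr (- 1 / p) * K powr 1" using K by simp
      also have "\<dots> = K powr (1 - 1 / p)" unfolding powr_add[symmetric] by simp
      finally show ?thesis by (simp add: l_def)
    qed
    have 2: "l powr (1 - p) * x = x powr (1 / p) * K powr (1 - 1 / p)"
    proof -
      have "l powr (1 - p) * x = (x powr ((1 / p) * (1 - p)) * x powr 1) * K powr ((- 1 / p) * (1 - p))"
        using x0 K by (simp add: l_def powr_mult powr_powr)
      also have "\<dots> = x powr ((1 / p) * (1 - p) + 1) * K powr ((- 1 / p) * (1 - p))"
        by (simp add: powr_add)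
      also have "(1 / p) * (1 - p) + 1 = 1 / p" using p by (simp add: field_simps)
      also have "(- 1 / p) * (1 - p) = 1 - 1 / p" using p by (simp add: field_simps)
      finally show ?thesis .
    qed
    have "a powr p \<le> (2 * (x powr (1 / p) * K powr (1 - 1 / p))) powr p"
      using bd[OF l] 1 2 a0 p by (intro powr_mono2) auto
    also have "\<dots> = 2 powr p * (x powr ((1 / p) * p) * K powr ((1 - 1 / p) * p))"
      using x0 K by (simp add: powr_mult powr_powr)
    also have "(1 / p) * p = 1" using p by simp
    also have "(1 - 1 / p) * p = p - 1" using p by (simp add: field_simps)
    finally show ?thesis using x0 by (simp add: mult_ac)
  qed
  then have "ennreal (a powr p) \<le> ennreal (2 powr p * K powr (p - 1) * x)" by (rule ennreal_leI)
  also have "\<dots> = ennreal (2 powr p * K powr (p - 1)) * ennreal x"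
    using x by (intro ennreal_mult) auto
  finally show ?thesis by (simp add: x a_def)
qed

section \<open>Riesz projection on circles\<close>

definition circ :: "real \<Rightarrow> complex" where "circ t = cis (2 * pi * t)"

text \<open>A probability measure, written as a density so that its space and measurable sets remain
  those of \<open>lborel\<close>.\<close>

abbreviation unif :: "real measure" where "unif \<equiv> density lborel (indicator {0..1})"

lemma norm_circ [simp]: "cmod (circ t) = 1"
  by (simp add: circ_def)

lemma circ_nonzero [simp]: "circ t \<noteq> 0"
  using norm_circ[of t] by (metis norm_zero zero_neq_one)

lemma continuous_circ [continuous_intros]: "continuous_on S circ"
  unfolding circ_def by (intro continuous_intros)

lemma measurable_circ [measurable]: "circ \<in> borel_measurable borel"
  by (intro borel_measurable_continuous_onI continuous_intros)

lemma measurable_cnj_circ [measurable]: "(\<lambda>t. cnj (circ t)) \<in> borel_measurable borel"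
  by (intro borel_measurable_continuous_onI continuous_intros)

lemma emeasure_unif_UNIV [simp]: "emeasure unif UNIV = 1"
  by (simp add: emeasure_density)

lemma finite_measure_unif: "finite_measure unif"
  by (rule finite_measureI) simp

lemma integral_unif:
  fixes f :: "real \<Rightarrow> 'b :: {banach, second_countable_topology}"
  assumes [measurable]: "f \<in> borel_measurable borel"
  shows "(\<integral>t. f t \<partial>unif) = (LINT t:{0..1}|lborel. f t)"
proof -
  have "unif = density lborel (\<lambda>t. ennreal (indicator {0..1} t))"
    by (simp add: ennreal_indicator)
  then show ?thesis
    by (simp add: integral_density set_lebesgue_integral_def)
qed

lemma continuous_integrable_unif:
  fixes f :: "real \<Rightarrow> 'b :: {banach, second_countable_topology}"
  assumes "continuous_on UNIV f"
  shows "integrable unif f"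
proof -
  have [measurable]: "f \<in> borel_measurable borel" by (intro borel_measurable_continuous_onI assms)
  have "set_integrable lborel {0..1} f"
    by (intro borel_integrable_atLeastAtMost' continuous_on_subset[OF assms]) auto
  moreover have "unif = density lborel (\<lambda>t. ennreal (indicator {0..1} t))"
    by (simp add: ennreal_indicator)
  ultimately show ?thesis
    by (simp add: integrable_density set_integrable_def)
qed

text \<open>Cauchy's formula is applied to x |-> G (w x) on the closed unit disc, so that the path
  is the unit circle for every w.\<close>

lemma mean_value_circle:
  assumes G: "G holomorphic_on ball 0 1" and w: "cmod w < 1"
  shows "(\<integral>t. G (w * circ t) \<partial>unif) = G 0" and "continuous_on UNIV (\<lambda>t. G (w * circ t))"
proof -
  have sub: "w * x \<in> ball 0 1" if "x \<in> cball 0 1" for x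
  proof -
    have "cmod w * cmod x \<le> cmod w * 1" using that by (intro mult_left_mono) auto
    then show ?thesis using w by (simp add: norm_mult)
  qed
  show c: "continuous_on UNIV (\<lambda>t. G (w * circ t))"
    by (rule continuous_on_compose2[OF holomorphic_on_imp_continuous_on[OF G]])
      (use sub in \<open>auto intro!: continuous_intros\<close>)
  have "(\<lambda>x. G (w * x)) holomorphic_on cball 0 1"
    by (rule holomorphic_on_compose_gen[of "\<lambda>x. w * x" _ G "ball 0 1", unfolded o_def])
      (use G sub in \<open>auto intro!: holomorphic_intros\<close>)
  from Cauchy_integral_circlepath_simple[OF this, of 0]
  have "((\<lambda>u. G (w * u) / u) has_contour_integral 2 * of_real pi * \<i> * G 0) (circlepath 0 1)"
    by simp
  then have "((\<lambda>t. 2 * of_real pi * \<i> * G (w * circ t)) has_integral 2 * of_real pi * \<i> * G 0) {0..1}"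
    unfolding has_contour_integral_def
  proof (rule has_integral_eq[rotated])
    fix t :: real assume t: "t \<in> {0..1}"
    have e: "exp (2 * of_real pi * \<i> * of_real t) = circ t"
      by (simp add: circ_def cis_conv_exp mult_ac)
    have v: "vector_derivative (circlepath 0 1) (at t within {0..1}) = 2 * of_real pi * \<i> * circ t"
      using t by (simp add: vector_derivative_circlepath01 e)
    have c: "circlepath 0 1 t = circ t" by (simp add: circlepath e)
    show "G (w * circlepath 0 1 t) / circlepath 0 1 t * vector_derivative (circlepath 0 1) (at t within {0..1})
        = 2 * of_real pi * \<i> * G (w * circ t)"
      unfolding v c by simp
  qed
  from has_integral_mult_right[OF this, of "1 / (2 * of_real pi * \<i>)"]
  have "((\<lambda>t. G (w * circ t)) has_integral G 0) {0..1}" by (simp add: field_simps)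
  moreover have "set_integrable lborel {0..1} (\<lambda>t. G (w * circ t))"
    by (intro borel_integrable_atLeastAtMost' continuous_on_subset[OF c]) auto
  ultimately have "(LINT t:{0..1}|lborel. G (w * circ t)) = G 0"
    by (simp add: set_borel_integral_eq_integral integral_unique)
  then show "(\<integral>t. G (w * circ t) \<partial>unif) = G 0"
    by (subst integral_unif) (auto intro!: borel_measurable_continuous_onI c)
qed

text \<open>Calderon's inequality: where the argument is close to \<open>\<pi>/2\<close> the term \<open>Re (z powr p)\<close> is negative
  because \<open>\<pi>/2 < p \<pi>/2 < \<pi>\<close>.\<close>
lemma calderon_inequality:
  fixes p :: real
  assumes p: "1 < p" "p < 2"
  shows "\<exists>A>0. \<exists>B>0. \<forall>z. 0 < Re z \<longrightarrow>
    cmod z powr p + B * Re (z powr of_real p) \<le> A * Re z powr p"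
proof -
  \<comment> \<open>The midpoint of pi/(2p) and pi/2. For arguments x with g < |x| < pi/2 the angle
    p|x| lies between p g > pi/2 and pi, so cos (p x) is at most the negative number cos (p
    g).\<close>
  define g where "g = (pi / 2 + pi / (2 * p)) / 2"
  have "pi / (2 * p) < pi / 2" using p by (simp add: field_simps)
  then have g: "0 < g" "g < pi / 2" "pi / (2 * p) < g"
    using p unfolding g_def by (auto simp: add_pos_pos)
  then have pg: "pi / 2 < p * g" using p by (simp add: field_simps)
  have pg2: "p * g < pi" using mult_strict_mono[of p 2 g "pi / 2"] g p by simp
  define c where "c = - cos (p * g)"
  have c: "0 < c" using cos_lt_zero_pi[of "p * g"] cos_monotone_0_pi[of "pi/2" "p * g"] pg pg2 by (simp add: c_def)
  \<comment> \<open>With this B the left-hand side of \<open>key\<close> is at most 0 for |x| > g.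
    For |x| \<le> g, where cos x \<ge> cos g, the constant A takes over.\<close>
  define B where "B = 1 / c"
  have B: "0 < B" using c by (simp add: B_def)
  have cg: "0 < cos g" using g by (intro cos_gt_zero) auto
  define A where "A = (1 + B) / cos g powr p"
  have A: "0 < A" using B cg by (simp add: A_def)
  have key: "1 + B * cos (p * x) \<le> A * cos x powr p" if x: "\<bar>x\<bar> < pi / 2" for x
  proof (cases "\<bar>x\<bar> \<le> g")
    case True
    have "cos g \<le> cos \<bar>x\<bar>" using True g by (intro cos_monotone_0_pi_le) auto
    then have "cos g powr p \<le> cos x powr p" using cg p by (intro powr_mono2) auto
    then have "A * cos g powr p \<le> A * cos x powr p" using A by simp
    moreover have "A * cos g powr p = 1 + B" using cg by (simp add: A_def)
    moreover have "B * cos (p * x) \<le> B * 1" using B by (intro mult_left_mono) auto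
    ultimately show ?thesis by simp
  next
    case False
    have "p * \<bar>x\<bar> \<le> p * (pi / 2)" using x p by (intro mult_left_mono) auto
    also have "\<dots> \<le> pi" using p by (simp add: field_simps)
    finally have "cos (p * \<bar>x\<bar>) \<le> cos (p * g)"
      using False g p by (intro cos_monotone_0_pi_le) auto
    then have "B * cos (p * x) \<le> B * (- c)" using B p
      by (intro mult_left_mono) (auto simp: c_def abs_real_def split: if_splits)
    also have "\<dots> = -1" using c by (simp add: B_def)
    finally show ?thesis using A by (smt (verit) mult_nonneg_nonneg powr_ge_zero)
  qed
  show ?thesis
  proof (rule exI[of _ A], intro conjI A exI[of _ B] B allI impI)
    fix z :: complex assume z: "0 < Re z"
    define x where "x = Im (Ln z)"
    have z0: "z \<noteq> 0" using z by auto
    have x: "\<bar>x\<bar> < pi / 2" using z Re_Ln_pos_lt[OF z0] unfolding x_def by blast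
    have "exp (Ln z) = z" using z0 by simp
    then have "Re z = exp (Re (Ln z)) * cos x" by (metis Re_exp x_def)
    then have rez: "Re z = cmod z * cos x" using z0 by simp
    have "Re (z powr of_real p) = exp (p * ln (cmod z)) * cos (p * x)"
      using z0 by (simp add: powr_def Re_exp x_def)
    also have "exp (p * ln (cmod z)) = cmod z powr p" using z0 by (simp add: powr_def)
    finally have 1: "Re (z powr of_real p) = cmod z powr p * cos (p * x)" .
    have c: "0 < cos x" using x by (intro cos_gt_zero_pi) auto
    have 2: "Re z powr p = cmod z powr p * cos x powr p" using rez c by (simp add: powr_mult)
    show "cmod z powr p + B * Re (z powr of_real p) \<le> A * Re z powr p"
      using mult_left_mono[OF key[OF x], of "cmod z powr p"] by (simp add: 1 2 algebra_simps)
  qed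
qed

lemma circ_geometric_norm:
  assumes "cmod w < 1"
  shows "1 - cmod w \<le> cmod (1 - w * cnj (circ s))" "1 - w * cnj (circ s) \<noteq> 0"
proof -
  have "cmod (w * cnj (circ s)) = cmod w" by (simp add: norm_mult)
  then show *: "1 - cmod w \<le> cmod (1 - w * cnj (circ s))"
    using norm_triangle_ineq2[of 1 "w * cnj (circ s)"] by simp
  show "1 - w * cnj (circ s) \<noteq> 0" using * assms by auto
qed

text \<open>The Cauchy integral of a function on the circle: by \<open>cauchy_sums\<close> its
  Taylor coefficients are the Fourier coefficients of \<open>f\<close> with nonnegative
  index.\<close>

definition cauchy :: "(real \<Rightarrow> complex) \<Rightarrow> complex \<Rightarrow> complex" where
  "cauchy f w = (\<integral>s. f s / (1 - w * cnj (circ s)) \<partial>unif)"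

lemma integrable_cauchy_kernel:
  fixes f :: "real \<Rightarrow> complex"
  assumes f: "integrable unif f" and w: "cmod w < 1"
  shows "integrable unif (\<lambda>s. f s / (1 - w * cnj (circ s)))"
proof (rule Bochner_Integration.integrable_bound)
  show "integrable unif (\<lambda>s. f s / of_real (1 - cmod w))" using f by simp
  show "(\<lambda>s. f s / (1 - w * cnj (circ s))) \<in> borel_measurable unif"
    using borel_measurable_integrable[OF f] by measurable
  have "cmod (f s / (1 - w * cnj (circ s))) \<le> cmod (f s / of_real (1 - cmod w))" for s
  proof -
    have "cmod (f s) / cmod (1 - w * cnj (circ s)) \<le> cmod (f s) / (1 - cmod w)"
      using circ_geometric_norm[OF w, of s] w by (intro divide_left_mono) auto
    moreover have "cmod (of_real (1 - cmod w)) = 1 - cmod w"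
      unfolding norm_of_real using w by simp
    ultimately show ?thesis unfolding norm_divide by simp
  qed
  then show "AE s in unif. cmod (f s / (1 - w * cnj (circ s))) \<le> cmod (f s / of_real (1 - cmod w))" by simp
qed

lemma cauchy_sums:
  assumes f: "integrable unif f" and w: "cmod w < 1"
  shows "(\<lambda>n. (\<integral>s. f s * cnj (circ s) ^ n \<partial>unif) * w ^ n) sums cauchy f w"
proof -
  have [measurable]: "f \<in> borel_measurable borel" using borel_measurable_integrable[OF f] by simp
  have i: "integrable unif (\<lambda>s. f s * (w * cnj (circ s)) ^ n)" for n
  proof (rule Bochner_Integration.integrable_bound[OF f])
    have "cmod (f s) * cmod w ^ n \<le> cmod (f s) * 1" for s
      using w by (intro mult_left_mono power_le_one) auto
    then show "AE s in unif. cmod (f s * (w * cnj (circ s)) ^ n) \<le> cmod (f s)"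
      by (simp add: norm_mult norm_power)
  qed measurable
  have n: "norm (f s * (w * cnj (circ s)) ^ n) = norm (f s) * cmod w ^ n" for s n
    by (simp add: norm_mult norm_power)
  have "(\<lambda>n. \<integral>s. f s * (w * cnj (circ s)) ^ n \<partial>unif) sums (\<integral>s. (\<Sum>n. f s * (w * cnj (circ s)) ^ n) \<partial>unif)"
  proof (rule sums_integral[OF i])
    show "AE s in unif. summable (\<lambda>n. norm (f s * (w * cnj (circ s)) ^ n))"
      unfolding n using w by (intro AE_I2 summable_mult summable_geometric) simp
    show "summable (\<lambda>n. \<integral>s. norm (f s * (w * cnj (circ s)) ^ n) \<partial>unif)"
      unfolding n using w by (simp add: summable_mult summable_geometric)
  qed
  moreover have "(\<Sum>n. f s * (w * cnj (circ s)) ^ n) = f s / (1 - w * cnj (circ s))" for s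
    using w by (subst suminf_mult) (auto simp: norm_mult suminf_geometric summable_geometric)
  moreover have "(\<integral>s. f s * (w * cnj (circ s)) ^ n \<partial>unif) = (\<integral>s. f s * cnj (circ s) ^ n \<partial>unif) * w ^ n" for n
  proof -
    have "f s * (w * cnj (circ s)) ^ n = f s * cnj (circ s) ^ n * w ^ n" for s
      by (simp add: power_mult_distrib)
    then show ?thesis by (simp only: integral_mult_left_zero)
  qed
  ultimately show ?thesis by (simp add: cauchy_def)
qed

lemma holomorphic_cauchy:
  assumes "integrable unif f"
  shows "cauchy f holomorphic_on ball 0 1"
  by (rule power_series_holomorphic[where a = "\<lambda>n. \<integral>s. f s * cnj (circ s) ^ n \<partial>unif"])
     (use cauchy_sums[OF assms] in auto)

text \<open>At \<open>w * cnj (circ s)\<close> this is the Poisson kernel, written as the real part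
  of the Herglotz kernel.\<close>

definition poisson :: "complex \<Rightarrow> real" where "poisson x = Re ((1 + x) / (1 - x))"

lemma poisson_pos: "cmod x < 1 \<Longrightarrow> 0 < poisson x"
proof -
  assume x: "cmod x < 1"
  then have x1: "1 - x \<noteq> 0" by auto
  have "poisson x = Re ((1 + x) * cnj (1 - x)) / (cmod (1 - x))\<^sup>2"
    unfolding poisson_def by (simp add: complex_div_cnj[of "1 + x"] Re_divide_of_real flip: of_real_power)
  also have "Re ((1 + x) * cnj (1 - x)) = 1 - (cmod x)\<^sup>2"
    unfolding cmod_power2 by (simp add: algebra_simps power2_eq_square)
  finally show ?thesis using x x1 by (simp add: power_less_one_iff abs_square_less_1)
qed

lemma measurable_poisson [measurable]: "poisson \<in> borel_measurable borel"
  unfolding poisson_def by measurable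

lemma poisson_cnj: "poisson (cnj x) = poisson x"
proof -
  have "(1 + cnj x) / (1 - cnj x) = cnj ((1 + x) / (1 - x))" by simp
  then show ?thesis unfolding poisson_def by (simp only: cnj.simps)
qed

text \<open>The function (1+x)/(1-x) is holomorphic in the disc with value 1 at 0. The form with
  \<open>cnj\<close> normalises the Poisson integral in its integration variable, the other one
  evaluates the average over the circle after an interchange of integrals.\<close>

lemma poisson_mean:
  assumes w: "cmod w < 1"
  shows "(\<integral>\<^sup>+t. ennreal (poisson (w * circ t)) \<partial>unif) = 1"
    and "(\<integral>\<^sup>+t. ennreal (poisson (w * cnj (circ t))) \<partial>unif) = 1"
proof -
  have *: "(\<integral>\<^sup>+t. ennreal (poisson (w * circ t)) \<partial>unif) = 1" if w: "cmod w < 1" for w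
  proof -
    define G where "G x = (1 + x) / (1 - x)" for x :: complex
    have G: "G holomorphic_on ball 0 1" unfolding G_def by (auto intro!: holomorphic_intros)
    note m = mean_value_circle[OF G w]
    have i: "integrable unif (\<lambda>t. G (w * circ t))" by (rule continuous_integrable_unif[OF m(2)])
    have "(\<integral>t. poisson (w * circ t) \<partial>unif) = Re (\<integral>t. G (w * circ t) \<partial>unif)"
      using i by (simp add: poisson_def G_def[symmetric])
    also have "\<dots> = 1" by (simp add: m(1)) (simp add: G_def)
    finally have "(\<integral>t. poisson (w * circ t) \<partial>unif) = 1" .
    moreover have "integrable unif (\<lambda>t. poisson (w * circ t))"
      using i by (simp add: poisson_def G_def[symmetric])
    moreover have "0 \<le> poisson (w * circ t)" for t
      using w by (intro less_imp_le[OF poisson_pos]) (simp add: norm_mult)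
    ultimately show ?thesis by (subst nn_integral_eq_integral) auto
  qed
  show "(\<integral>\<^sup>+t. ennreal (poisson (w * circ t)) \<partial>unif) = 1" by (rule *[OF w])
  have "poisson (w * cnj (circ t)) = poisson (cnj w * circ t)" for t
    by (subst poisson_cnj[symmetric]) simp
  then show "(\<integral>\<^sup>+t. ennreal (poisson (w * cnj (circ t))) \<partial>unif) = 1" using *[of "cnj w"] w by simp
qed

lemma powr_add_le:
  fixes a b p :: real
  assumes "0 \<le> a" "0 \<le> b" "1 < p"
  shows "(a + b) powr p \<le> 2 powr p * (a powr p + b powr p)"
proof -
  have "(a + b) powr p \<le> (2 * max a b) powr p" using assms by (intro powr_mono2) auto
  also have "\<dots> = 2 powr p * max a b powr p" using assms by (simp add: powr_mult)
  also have "\<dots> \<le> 2 powr p * (a powr p + b powr p)"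
    by (intro mult_left_mono) (auto simp: max_def)
  finally show ?thesis .
qed

text \<open>The p-th power of a norm as an extended nonnegative integral, so that estimates can be
  chained before integrability is known.\<close>

abbreviation pow_int :: "'a measure \<Rightarrow> real \<Rightarrow> ('a \<Rightarrow> complex) \<Rightarrow> ennreal" where
  "pow_int M p f \<equiv> \<integral>\<^sup>+x. ennreal (cmod (f x) powr p) \<partial>M"

lemma (in finite_measure) integrable_of_pow_int:
  assumes p: "1 < p" and [measurable]: "f \<in> borel_measurable M" and fin: "pow_int M p f \<noteq> \<infinity>"
  shows "integrable M f"
proof (rule integrableI_bounded)
  have "(\<integral>\<^sup>+s. ennreal (norm (f s)) \<partial>M) \<le> (\<integral>\<^sup>+s. 1 + ennreal (cmod (f s) powr p) \<partial>M)"
  proof (rule nn_integral_mono)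
    fix s
    have "cmod (f s) \<le> 1 + cmod (f s) powr p"
    proof (cases "cmod (f s) \<le> 1")
      case False
      then have "cmod (f s) powr 1 \<le> cmod (f s) powr p" using p by (intro powr_mono) auto
      then show ?thesis using False by simp
    qed (simp add: add_increasing2)
    then have "ennreal (cmod (f s)) \<le> ennreal (1 + cmod (f s) powr p)" by (rule ennreal_leI)
    then show "ennreal (norm (f s)) \<le> 1 + ennreal (cmod (f s) powr p)" by (simp add: ennreal_plus)
  qed
  also have "\<dots> = emeasure M (space M) + pow_int M p f" by (simp add: nn_integral_add nn_integral_const)
  also have "\<dots> < \<infinity>" using fin by (simp add: less_top emeasure_eq_measure)
  finally show "(\<integral>\<^sup>+s. ennreal (norm (f s)) \<partial>M) < \<infinity>" .
qed simp

text \<open>For f \<ge> 0 the Herglotz transform F has positive real part, the Poisson integral of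
  f. Calderon's inequality bounds the mean of |F|^p by that of (Re F)^p, since the mean of F^p is
  F(0)^p \<ge> 0, and Poisson integrals do not increase the p-norm by more than a constant factor.
  As the Cauchy integral is (F + c0)/2, it remains to bound c0.\<close>

lemma riesz_nonneg:
  assumes p: "1 < p" "p < 2"
  shows "\<exists>C>0. \<forall>f w. f \<in> borel_measurable borel \<longrightarrow> (\<forall>s. 0 \<le> f s) \<longrightarrow> integrable unif f \<longrightarrow> cmod w < 1 \<longrightarrow>
    (pow_int unif p (\<lambda>t. cauchy (\<lambda>s. of_real (f s)) (w * circ t)))
      \<le> ennreal C * (\<integral>\<^sup>+s. ennreal (f s powr p) \<partial>unif)"
proof -
  obtain A B where A: "0 < A" and B: "0 < B"
    and AB: "\<And>z. 0 < Re z \<Longrightarrow> cmod z powr p + B * Re (z powr of_real p) \<le> A * Re z powr p"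
    using calderon_inequality[OF p] by blast
  define C where "C = 2 powr p * (A * 2 powr p + 2 powr p)"
  have C: "0 < C" using A by (auto simp: C_def intro!: mult_pos_pos add_pos_pos)
  show ?thesis
  proof (rule exI[of _ C], intro conjI C allI impI)
    fix f :: "real \<Rightarrow> real" and w :: complex
    assume [measurable]: "f \<in> borel_measurable borel" and f0: "\<forall>s. 0 \<le> f s"
      and fi: "integrable unif f" and w: "cmod w < 1"
    let ?P = "\<lambda>t s. poisson (w * circ t * cnj (circ s))"
    interpret U: finite_measure unif by (rule finite_measure_unif)
    let ?X = "\<integral>\<^sup>+s. ennreal (f s powr p) \<partial>unif"
    define g where "g s = complex_of_real (f s)" for s
    have [measurable]: "g \<in> borel_measurable borel" unfolding g_def by measurable
    have gi: "integrable unif g" unfolding g_def using fi by simp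
    let ?k = "\<lambda>z s. g s * ((1 + z * cnj (circ s)) / (1 - z * cnj (circ s)))"
    define c0 where "c0 = (\<integral>s. f s \<partial>unif)"
    have gc0: "(\<integral>s. g s \<partial>unif) = of_real c0" unfolding c0_def g_def by simp
    define F where "F z = 2 * cauchy g z - of_real c0" for z
    have wc: "cmod (w * circ t) < 1" for t using w by (simp add: norm_mult)
    let ?N = "pow_int unif p (\<lambda>t. F (w * circ t))"
    show "(pow_int unif p (\<lambda>t. cauchy (\<lambda>s. of_real (f s)) (w * circ t))) \<le> ennreal C * ?X"
    \<comment> \<open>The complex power of F needs Re F > 0 strictly, which fails exactly when f
      vanishes almost everywhere.\<close>
    proof (cases "AE s in unif. f s = 0")
      case True
      then have "AE s in unif. of_real (f s) / (1 - z * cnj (circ s)) = (0 :: complex)" for z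
        by eventually_elim simp
      then have "cauchy (\<lambda>s. of_real (f s)) z = 0" for z
        unfolding cauchy_def by (rule integral_eq_zero_AE)
      then show ?thesis by simp
    next
      case False
      then have c0: "0 < c0"
        using integral_nonneg_eq_0_iff_AE[OF fi] f0 integral_nonneg_AE[of f unif] by (auto simp: c0_def less_le)
      have FI: "F z = (\<integral>s. ?k z s \<partial>unif)"
        and FI2: "integrable unif (\<lambda>s. ?k z s)"
        if z: "cmod z < 1" for z
      proof -
        note ik = integrable_cauchy_kernel[OF gi z]
        have eq: "?k z s = 2 * (g s / (1 - z * cnj (circ s))) - g s" for s
          using circ_geometric_norm(2)[OF z, of s] by (simp add: field_simps)
        have i2: "integrable unif (\<lambda>s. 2 * (g s / (1 - z * cnj (circ s))))"
          by (rule integrable_mult_right) (rule ik)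
        show "integrable unif (\<lambda>s. ?k z s)"
          unfolding eq by (rule Bochner_Integration.integrable_diff[OF i2 gi])
        show "F z = (\<integral>s. ?k z s \<partial>unif)"
          unfolding eq Bochner_Integration.integral_diff[OF i2 gi] integral_mult_right_zero
          by (simp only: F_def cauchy_def gc0)
      qed
      have ReF: "Re (F z) = (\<integral>s. f s * poisson (z * cnj (circ s)) \<partial>unif)"
        and ReFi: "integrable unif (\<lambda>s. f s * poisson (z * cnj (circ s)))" if z: "cmod z < 1" for z
      proof -
        have "Re (?k z s) = f s * poisson (z * cnj (circ s))" for s
          unfolding g_def poisson_def by (simp only: Re_complex_of_real Im_complex_of_real times_complex.sel mult_zero_left diff_zero)
        with integral_Re[OF FI2[OF z]] integrable_Re[OF FI2[OF z]]
        show "Re (F z) = (\<integral>s. f s * poisson (z * cnj (circ s)) \<partial>unif)"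
          "integrable unif (\<lambda>s. f s * poisson (z * cnj (circ s)))"
          unfolding FI[OF z] by simp_all
      qed
      have pp: "0 < poisson (z * cnj (circ s))" if "cmod z < 1" for z s
        using that by (intro poisson_pos) (simp add: norm_mult)
      have Fpos: "0 < Re (F z)" if z: "cmod z < 1" for z
      proof -
        have nn: "AE s in unif. 0 \<le> f s * poisson (z * cnj (circ s))"
          using f0 pp[OF z] by (intro AE_I2) (simp add: less_imp_le)
        have "\<not> (AE s in unif. f s * poisson (z * cnj (circ s)) = 0)"
        proof
          assume "AE s in unif. f s * poisson (z * cnj (circ s)) = 0"
          then have "AE s in unif. f s = 0" by eventually_elim (use pp[OF z] in \<open>auto simp: less_le\<close>)
          with False show False by simp
        qed
        then have "Re (F z) \<noteq> 0" unfolding ReF[OF z] using integral_nonneg_eq_0_iff_AE[OF ReFi[OF z] nn] by blast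
        moreover have "0 \<le> Re (F z)" unfolding ReF[OF z] by (rule integral_nonneg_AE[OF nn])
        ultimately show ?thesis by simp
      qed
      have holF: "F holomorphic_on ball 0 1"
        unfolding F_def by (intro holomorphic_intros holomorphic_cauchy gi)
      have nonpos: "F z \<notin> \<real>\<^sub>\<le>\<^sub>0" if "cmod z < 1" for z
        using Fpos[OF that] by (auto simp: complex_nonpos_Reals_iff)
      have holFp: "(\<lambda>z. F z powr of_real p) holomorphic_on ball 0 1"
        by (rule holomorphic_on_powr[OF holF holomorphic_on_const]) (use nonpos in auto)
      note m = mean_value_circle[OF holFp w]
      note mF = mean_value_circle(2)[OF holF w]
      have cRe: "continuous_on UNIV (\<lambda>t. Re (F (w * circ t)) powr p)"
        using Fpos[OF wc] by (intro continuous_intros mF) (auto simp: less_le)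
      have cN: "continuous_on UNIV (\<lambda>t. cmod (F (w * circ t)) powr p)"
        using Fpos[OF wc] by (intro continuous_intros mF) (auto, metis less_irrefl zero_complex.sel(1))
      have F0: "F 0 = of_real c0" by (simp add: F_def cauchy_def gc0)
      have iP: "integrable unif (\<lambda>t. F (w * circ t) powr of_real p)" by (rule continuous_integrable_unif[OF m(2)])
      \<comment> \<open>Calderon's inequality is integrated over the circle; \<open>m(1)\<close>
        identifies the mean of the complex powers with the value at the centre.\<close>
      have "(\<integral>t. cmod (F (w * circ t)) powr p \<partial>unif) + B * Re (F 0 powr of_real p)
        = (\<integral>t. cmod (F (w * circ t)) powr p + B * Re (F (w * circ t) powr of_real p) \<partial>unif)"
        using continuous_integrable_unif[OF cN] iP m(1) integral_Re[OF iP] by simp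
      also have "\<dots> \<le> (\<integral>t. A * Re (F (w * circ t)) powr p \<partial>unif)"
        using AB[OF Fpos[OF wc]] continuous_integrable_unif[OF cN] continuous_integrable_unif[OF cRe] iP
        by (intro integral_mono) auto
      finally have main: "(\<integral>t. cmod (F (w * circ t)) powr p \<partial>unif) + B * Re (F 0 powr of_real p)
          \<le> A * (\<integral>t. Re (F (w * circ t)) powr p \<partial>unif)" by simp
      have "Re (F 0 powr of_real p) = c0 powr p"
        using c0 by (simp add: F0 powr_of_real)
      then have "0 \<le> B * Re (F 0 powr of_real p)" using B by simp
      with main have main: "(\<integral>t. cmod (F (w * circ t)) powr p \<partial>unif)
          \<le> A * (\<integral>t. Re (F (w * circ t)) powr p \<partial>unif)" by linarith
      have [measurable]: "(\<lambda>t. cmod (F (w * circ t)) powr p) \<in> borel_measurable borel"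
        "(\<lambda>t. Re (F (w * circ t)) powr p) \<in> borel_measurable borel"
        by (intro borel_measurable_continuous_onI cN cRe)+
      have "(?N) \<le> ennreal A * (\<integral>\<^sup>+t. ennreal (Re (F (w * circ t)) powr p) \<partial>unif)"
        using main A continuous_integrable_unif[OF cN] continuous_integrable_unif[OF cRe]
        by (simp add: nn_integral_eq_integral ennreal_leI flip: ennreal_mult')
      also have "(\<integral>\<^sup>+t. ennreal (Re (F (w * circ t)) powr p) \<partial>unif)
        \<le> (\<integral>\<^sup>+t. ennreal (2 powr p) * (\<integral>\<^sup>+s. ennreal (f s powr p * ?P t s) \<partial>unif) \<partial>unif)"
      proof (rule nn_integral_mono)
        fix t
        \<comment> \<open>Hoelder with the Poisson kernel as weight: its mass is 1, and the powers p
          and 1 - p of the kernel combine to a single factor.\<close>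
        have "ennreal (cmod (\<integral>s. of_real (f s * ?P t s) \<partial>unif) powr p)
          \<le> ennreal (2 powr p * 1 powr (p - 1)) * (\<integral>\<^sup>+s. ennreal (cmod (of_real (f s * ?P t s)) powr p
              * ?P t s powr (1 - p)) \<partial>unif)"
          using p pp[OF wc] poisson_mean(2)[OF wc]
          by (intro crude_hoelder) auto
        also have "(\<integral>s. complex_of_real (f s * ?P t s) \<partial>unif) = of_real (Re (F (w * circ t)))"
          by (simp only: ReF[OF wc] integral_complex_of_real)
        also have "(\<lambda>s. cmod (of_real (f s * ?P t s)) powr p * ?P t s powr (1 - p))
          = (\<lambda>s. f s powr p * ?P t s)"
        proof
          fix s
          have P: "0 < ?P t s" using pp[OF wc] .
          then have "?P t s powr p * ?P t s powr (1 - p) = ?P t s"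
            by (simp flip: powr_add)
          then show "cmod (of_real (f s * ?P t s)) powr p * ?P t s powr (1 - p)
            = f s powr p * ?P t s"
            using P f0 by (simp add: powr_mult abs_mult mult.assoc del: of_real_mult)
        qed
        finally show "ennreal (Re (F (w * circ t)) powr p)
          \<le> ennreal (2 powr p) * (\<integral>\<^sup>+s. ennreal (f s powr p * ?P t s) \<partial>unif)"
          using Fpos[OF wc, of t] by simp
      qed
      also have "\<dots> = ennreal (2 powr p) * (\<integral>\<^sup>+t. (\<integral>\<^sup>+s. ennreal (f s powr p * ?P t s) \<partial>unif) \<partial>unif)"
        by (rule nn_integral_cmult) measurable
      also have "(\<integral>\<^sup>+t. (\<integral>\<^sup>+s. ennreal (f s powr p * ?P t s) \<partial>unif) \<partial>unif)
        = (\<integral>\<^sup>+s. (\<integral>\<^sup>+t. ennreal (f s powr p * ?P t s) \<partial>unif) \<partial>unif)"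
      proof -
        interpret pair_sigma_finite unif unif ..
        show ?thesis by (rule Fubini') measurable
      qed
      also have "\<dots> = (\<integral>\<^sup>+s. ennreal (f s powr p) * 1 \<partial>unif)"
      proof (rule nn_integral_cong)
        fix s
        have *: "w * circ t * cnj (circ s) = (w * cnj (circ s)) * circ t" for t by simp
        have "cmod (w * cnj (circ s)) < 1" using w by (simp add: norm_mult)
        from poisson_mean(1)[OF this]
        show "(\<integral>\<^sup>+t. ennreal (f s powr p * ?P t s) \<partial>unif) = ennreal (f s powr p) * 1"
          unfolding * by (subst ennreal_mult'') (auto simp: nn_integral_cmult intro!: less_imp_le[OF poisson_pos] simp: norm_mult w)
      qed
      finally have Fest: "(?N) \<le> ennreal A * (ennreal (2 powr p) * ?X)"
        by (simp add: mult_left_mono)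
      have c0est: "ennreal (c0 powr p) \<le> ennreal (2 powr p) * ?X"
      proof -
        have "ennreal (cmod (\<integral>s. g s \<partial>unif) powr p) \<le> ennreal (2 powr p * 1 powr (p - 1)) * (\<integral>\<^sup>+s. ennreal (cmod (g s) powr p * 1 powr (1 - p)) \<partial>unif)"
          using p by (intro crude_hoelder) (auto simp: nn_integral_const)
        then show ?thesis using c0 f0 unfolding c0_def by (simp add: g_def)
      qed
      have "(pow_int unif p (\<lambda>t. cauchy g (w * circ t)))
        \<le> (\<integral>\<^sup>+t. ennreal (2 powr p) * (ennreal (cmod (F (w * circ t)) powr p) + ennreal (c0 powr p)) \<partial>unif)"
      proof (rule nn_integral_mono)
        fix t
        have e: "cauchy g (w * circ t) = (F (w * circ t) + of_real c0) / 2" by (simp add: F_def)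
        have "cmod (cauchy g (w * circ t)) \<le> cmod (F (w * circ t)) + c0"
          unfolding e using norm_triangle_ineq[of "F (w * circ t)" "of_real c0"] c0 norm_ge_zero[of "F (w * circ t)"]
          by (simp add: norm_divide del: norm_ge_zero)
        then have "cmod (cauchy g (w * circ t)) powr p \<le> (cmod (F (w * circ t)) + c0) powr p"
          using p by (intro powr_mono2) auto
        also have "\<dots> \<le> 2 powr p * (cmod (F (w * circ t)) powr p + c0 powr p)"
          using c0 p by (intro powr_add_le) auto
        finally show "ennreal (cmod (cauchy g (w * circ t)) powr p) \<le> ennreal (2 powr p) * (ennreal (cmod (F (w * circ t)) powr p) + ennreal (c0 powr p))"
          by (simp add: ennreal_leI flip: ennreal_mult ennreal_plus)
      qed
      also have "\<dots> = ennreal (2 powr p) * ((?N) + ennreal (c0 powr p))"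
        by (simp add: nn_integral_cmult nn_integral_add nn_integral_const)
      also have "\<dots> \<le> ennreal (2 powr p) * (ennreal A * (ennreal (2 powr p) * ?X) + ennreal (2 powr p) * ?X)"
        by (intro mult_left_mono add_mono Fest c0est) auto
      also have "\<dots> = ennreal C * ?X"
        using A by (simp add: C_def ennreal_mult ennreal_plus distrib_left distrib_right mult_ac)
      finally have "(pow_int unif p (\<lambda>t. cauchy g (w * circ t))) \<le> ennreal C * ?X" .
      moreover have "g = (\<lambda>s. of_real (f s))" by (simp add: g_def fun_eq_iff)
      ultimately show ?thesis by simp
    qed
  qed
qed

text \<open>The positive and negative parts of the real and imaginary parts are nonnegative and
  bounded by |f|, so each of the four pieces falls under \<open>riesz_nonneg\<close> with the norm
  of f on the right.\<close>

lemma riesz_cauchy: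
  assumes p: "1 < p" "p < 2"
  shows "\<exists>C>0. \<forall>f w. f \<in> borel_measurable borel \<longrightarrow> integrable unif f \<longrightarrow> cmod w < 1 \<longrightarrow>
    (pow_int unif p (\<lambda>t. cauchy f (w * circ t)))
      \<le> ennreal C * (pow_int unif p f)"
proof -
  obtain C where C: "0 < C" and R: "\<And>f w. f \<in> borel_measurable borel \<Longrightarrow> (\<And>s. 0 \<le> f s) \<Longrightarrow> integrable unif f \<Longrightarrow> cmod w < 1 \<Longrightarrow>
    (pow_int unif p (\<lambda>t. cauchy (\<lambda>s. of_real (f s)) (w * circ t)))
      \<le> ennreal C * (\<integral>\<^sup>+s. ennreal (f s powr p) \<partial>unif)"
    using riesz_nonneg[OF p] by metis
  \<comment> \<open>The two factors 2^p come from splitting the sum of four terms by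
    \<open>powr_add_le\<close> twice, the 4 from the number of pieces.\<close>
  define D where "D = 2 powr p * (2 powr p * (4 * C))"
  have D: "0 < D" using C by (auto simp: D_def intro!: mult_pos_pos add_pos_pos)
  show ?thesis
  proof (rule exI[of _ D], intro conjI D allI impI)
    fix f :: "real \<Rightarrow> complex" and w :: complex
    assume [measurable]: "f \<in> borel_measurable borel" and fi: "integrable unif f" and w: "cmod w < 1"
    let ?X = "pow_int unif p f"
    have wc: "cmod (w * circ t) < 1" for t using w by (simp add: norm_mult)
    define h :: "nat \<Rightarrow> real \<Rightarrow> real" where
      "h j s = (if j = 0 then max 0 (Re (f s)) else if j = 1 then max 0 (- Re (f s))
        else if j = 2 then max 0 (Im (f s)) else max 0 (- Im (f s)))" for j s
    have hm[measurable]: "h j \<in> borel_measurable borel" for j unfolding h_def by measurable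
    have h0: "0 \<le> h j s" and hle: "h j s \<le> cmod (f s)" for j s
      using abs_Re_le_cmod[of "f s"] abs_Im_le_cmod[of "f s"] by (auto simp: h_def)
    have hi: "integrable unif (h j)" for j
      by (rule Bochner_Integration.integrable_bound[OF fi]) (use h0 hle in auto)
    have split: "f s = of_real (h 0 s) - of_real (h 1 s) + (\<i> * of_real (h 2 s) - \<i> * of_real (h 3 s))" for s
      by (simp add: h_def complex_eq_iff max_def)
    define T where "T j z = cauchy (\<lambda>s. of_real (h j s)) z" for j z
    have hci: "integrable unif (\<lambda>s. complex_of_real (h j s))" for j using hi by simp
    have Tsplit: "cauchy f z = T 0 z - T 1 z + (\<i> * T 2 z - \<i> * T 3 z)" if z: "cmod z < 1" for z
    proof -
      let ?k = "\<lambda>j s. complex_of_real (h j s) / (1 - z * cnj (circ s))"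
      have i: "integrable unif (?k j)" for j by (rule integrable_cauchy_kernel[OF hci z])
      have "f s / (1 - z * cnj (circ s)) = ?k 0 s - ?k 1 s + (\<i> * ?k 2 s - \<i> * ?k 3 s)" for s
        by (subst split) (simp add: add_divide_distrib diff_divide_distrib)
      moreover have "integrable unif (\<lambda>s. \<i> * ?k j s)" for j by (rule integrable_mult_right) (rule i)
      ultimately show ?thesis unfolding T_def cauchy_def using i
        by (simp only: Bochner_Integration.integral_add Bochner_Integration.integral_diff
          Bochner_Integration.integrable_add Bochner_Integration.integrable_diff integral_mult_right_zero)
    qed
    let ?N = "\<lambda>j. pow_int unif p (\<lambda>t. T j (w * circ t))" and ?a = "\<lambda>j t. ennreal (cmod (T j (w * circ t)) powr p)"
    have Test: "(?N j) \<le> ennreal C * ?X" for j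
    proof -
      have "(?N j) \<le> ennreal C * (\<integral>\<^sup>+s. ennreal (h j s powr p) \<partial>unif)"
        unfolding T_def by (rule R[OF hm h0 hi w])
      also have "\<dots> \<le> ennreal C * ?X"
        using p h0 hle by (intro mult_left_mono nn_integral_mono ennreal_leI powr_mono2) auto
      finally show ?thesis .
    qed
    have [measurable]: "(\<lambda>t. T j (w * circ t)) \<in> borel_measurable borel" for j
      unfolding T_def
      by (intro borel_measurable_continuous_onI mean_value_circle(2)[OF holomorphic_cauchy[OF hci] w])
    have "(pow_int unif p (\<lambda>t. cauchy f (w * circ t)))
      \<le> (\<integral>\<^sup>+t. ennreal (2 powr p) * (ennreal (2 powr p) * (?a 0 t + ?a 1 t)
          + ennreal (2 powr p) * (?a 2 t + ?a 3 t)) \<partial>unif)"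
    proof (rule nn_integral_mono)
      fix t
      define a where "a j = cmod (T j (w * circ t))" for j
      have a: "0 \<le> a j" for j by (simp add: a_def)
      have "cmod (cauchy f (w * circ t)) \<le> cmod (T 0 (w * circ t) - T 1 (w * circ t)) + cmod (\<i> * T 2 (w * circ t) - \<i> * T 3 (w * circ t))"
        unfolding Tsplit[OF wc] by (rule norm_triangle_ineq)
      also have "\<dots> \<le> (a 0 + a 1) + (a 2 + a 3)"
        using norm_triangle_ineq4[of "T 0 (w * circ t)" "T 1 (w * circ t)"]
          norm_triangle_ineq4[of "\<i> * T 2 (w * circ t)" "\<i> * T 3 (w * circ t)"]
        by (simp add: a_def norm_mult)
      finally have "cmod (cauchy f (w * circ t)) powr p \<le> ((a 0 + a 1) + (a 2 + a 3)) powr p"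
        using p by (intro powr_mono2) auto
      also have "\<dots> \<le> 2 powr p * ((a 0 + a 1) powr p + (a 2 + a 3) powr p)"
        using a p by (intro powr_add_le) auto
      also have "\<dots> \<le> 2 powr p * (2 powr p * (a 0 powr p + a 1 powr p) + 2 powr p * (a 2 powr p + a 3 powr p))"
        using a p by (intro mult_left_mono add_mono powr_add_le) auto
      finally show "ennreal (cmod (cauchy f (w * circ t)) powr p) \<le> ennreal (2 powr p) * (ennreal (2 powr p) * (?a 0 t + ?a 1 t)
          + ennreal (2 powr p) * (?a 2 t + ?a 3 t))"
        by (simp add: a_def ennreal_leI flip: ennreal_mult ennreal_plus)
    qed
    also have "\<dots> = ennreal (2 powr p) * (ennreal (2 powr p) * ((?N 0) + (?N 1))
          + ennreal (2 powr p) * ((?N 2) + (?N 3)))"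
      by (simp add: nn_integral_cmult nn_integral_add)
    also have "\<dots> \<le> ennreal (2 powr p) * (ennreal (2 powr p) * (ennreal C * ?X + ennreal C * ?X) + ennreal (2 powr p) * (ennreal C * ?X + ennreal C * ?X))"
      by (intro mult_left_mono add_mono Test) auto
    also have "\<dots> = ennreal D * ?X"
    proof -
      have four: "x + x + (x + x) = 4 * x" for x :: ennreal
      proof -
        have "4 * x = (2 + 2) * x" by simp
        then show ?thesis by (simp only: distrib_right mult_2)
      qed
      show ?thesis unfolding distrib_left four using C by (simp add: D_def ennreal_mult mult_ac)
    qed
    finally show "(pow_int unif p (\<lambda>t. cauchy f (w * circ t))) \<le> ennreal D * ?X" .
  qed
qed

section \<open>Radial measures on the disc\<close>

text \<open>Haar uniqueness: for translation invariant measures \<open>M\<close>, \<open>N\<close> and a symmetric set \<open>B\<close>, integrating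
  \<open>1\<^sub>A(x) 1\<^sub>B(x - y)\<close> in both orders gives \<open>M(A) N(B) = N(A) M(B)\<close>; \<open>B\<close> is the unit disc.\<close>
lemma lborel_rotate:
  fixes u :: complex
  assumes u: "cmod u = 1"
  shows "distr lborel borel (\<lambda>z. u * z) = lborel"
proof (rule measure_eqI)
  fix A :: "complex set"
  assume "A \<in> sets (distr lborel borel (\<lambda>z. u * z))"
  then have [measurable]: "A \<in> sets borel" by simp
  have u0: "u \<noteq> 0" using u by auto
  let ?B = "ball 0 1 :: complex set"
  have [measurable]: "?B \<in> sets borel" by simp
  have ballx: "(\<integral>\<^sup>+y. indicator ?B (x - y) \<partial>lborel) = ennreal pi" for x :: complex
  proof -
    have "(\<lambda>y. indicator ?B (x - y)) = (indicator (ball x 1) :: complex \<Rightarrow> ennreal)"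
      by (auto simp: fun_eq_iff indicator_def dist_norm norm_minus_commute)
    then show ?thesis using emeasure_ball[of 1 x] by (simp add: unit_ball_vol_2)
  qed
  have shift: "(\<integral>\<^sup>+x. g (c + x) \<partial>lborel) = (\<integral>\<^sup>+x. g x \<partial>lborel)" if [measurable]: "g \<in> borel_measurable borel"
    for g :: "complex \<Rightarrow> ennreal" and c
    using nn_integral_distr[of "(+) c" lborel borel g] by (simp add: lborel_distr_plus)
  have "emeasure (distr lborel borel (\<lambda>z. u * z)) A = (\<integral>\<^sup>+x. indicator A (u * x) \<partial>lborel)"
    by (subst nn_integral_indicator[symmetric]) (simp_all add: nn_integral_distr del: nn_integral_indicator)
  also have "\<dots> * ennreal pi = (\<integral>\<^sup>+x. indicator A (u * x) * (\<integral>\<^sup>+y. indicator ?B (u * x - y) \<partial>lborel) \<partial>lborel)"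
    unfolding ballx by (simp add: nn_integral_multc)
  also have "\<dots> = (\<integral>\<^sup>+x. \<integral>\<^sup>+y. indicator A (u * x) * indicator ?B (u * x - y) \<partial>lborel \<partial>lborel)"
    by (rule nn_integral_cong, rule nn_integral_cmult[symmetric]) measurable
  also have "\<dots> = (\<integral>\<^sup>+y. \<integral>\<^sup>+x. indicator A (u * x) * indicator ?B (u * x - y) \<partial>lborel \<partial>lborel)"
    by (rule lborel_pair.Fubini') measurable
  also have "\<dots> = (\<integral>\<^sup>+y. \<integral>\<^sup>+x. indicator A (u * x + y) * indicator ?B (u * x) \<partial>lborel \<partial>lborel)"
  proof (rule nn_integral_cong)
    \<comment> \<open>The translation of x by y/u moves y from the indicator of the ball to that of
      A.\<close>
    fix y :: complex
    have "(\<integral>\<^sup>+x. indicator A (u * (y / u + x)) * indicator ?B (u * (y / u + x) - y) \<partial>lborel)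
        = (\<integral>\<^sup>+x. indicator A (u * x) * indicator ?B (u * x - y) \<partial>(lborel :: complex measure))"
      by (rule shift) measurable
    moreover have "u * (y / u + x) = u * x + y" for x using u0 by (simp add: field_simps)
    ultimately show "(\<integral>\<^sup>+x. indicator A (u * x) * indicator ?B (u * x - y) \<partial>lborel)
      = (\<integral>\<^sup>+x. indicator A (u * x + y) * indicator ?B (u * x) \<partial>(lborel :: complex measure))" by simp
  qed
  also have "\<dots> = (\<integral>\<^sup>+x. \<integral>\<^sup>+y. indicator A (u * x + y) * indicator ?B (u * x) \<partial>lborel \<partial>lborel)"
    by (rule lborel_pair.Fubini') measurable
  also have "\<dots> = (\<integral>\<^sup>+x. emeasure lborel A * indicator ?B (u * x) \<partial>lborel)"
  proof (rule nn_integral_cong)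
    fix x :: complex
    have "(\<integral>\<^sup>+y. indicator A (u * x + y) \<partial>lborel) = emeasure lborel A"
      using shift[of "indicator A" "u * x"] by simp
    then show "(\<integral>\<^sup>+y. indicator A (u * x + y) * indicator ?B (u * x) \<partial>lborel) = emeasure lborel A * indicator ?B (u * x)"
      by (subst nn_integral_multc) auto
  qed
  \<comment> \<open>Here the choice of the ball pays off: it is invariant under multiplication by u
    and under x |-> -x, so u disappears.\<close>
  also have "\<dots> = emeasure lborel A * (\<integral>\<^sup>+x. indicator ?B (0 - x) \<partial>lborel)"
    by (subst nn_integral_cmult) (auto simp: indicator_def norm_mult u)
  also have "\<dots> = emeasure lborel A * ennreal pi" unfolding ballx ..
  finally show "emeasure (distr lborel borel (\<lambda>z. u * z)) A = emeasure lborel A"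
    by (simp add: mult.commute ennreal_mult_cancel_left)
qed simp

lemma measurable_ball [measurable]: "ball (c :: complex) r \<in> sets borel"
  by simp

lemma emeasure_distr_density:
  assumes [measurable]: "h \<in> borel_measurable M" "f \<in> measurable M N" "A \<in> sets N"
  shows "emeasure (distr (density M h) N f) A = (\<integral>\<^sup>+x. h x * indicator A (f x) \<partial>M)"
proof -
  have "emeasure (distr (density M h) N f) A = (\<integral>\<^sup>+x. indicator A x \<partial>distr (density M h) N f)" by simp
  also have "\<dots> = (\<integral>\<^sup>+x. indicator A (f x) \<partial>density M h)" by (subst nn_integral_distr) auto
  also have "\<dots> = (\<integral>\<^sup>+x. h x * indicator A (f x) \<partial>M)" by (subst nn_integral_density) auto
  finally show ?thesis .
qed

text \<open>Polar coordinates for radial functions. It suffices to compare the masses of the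
  half-lines \<open>{x<..}\<close>, and for 0 \<le> x < 1 both are 1 - x^2: the area of an annulus
  divided by pi, and the integral of 2r over [x,1].\<close>

lemma distr_cmod_disc:
  "distr (density lborel (\<lambda>z. ennreal (indicator (ball 0 1) z / pi))) borel cmod
    = density lborel (\<lambda>r. ennreal (2 * r * indicator {0..1} r))"
proof (rule measure_eqI_lessThan)
  let ?M = "distr (density lborel (\<lambda>z. ennreal (indicator (ball 0 1) z / pi))) borel cmod"
  let ?N = "density lborel (\<lambda>r::real. ennreal (2 * r * indicator {0..1} r))"
  let ?n = "\<lambda>x. \<integral>\<^sup>+r. ennreal (2 * r) * indicator {max x 0..1} r \<partial>lborel"
  let ?e = "\<lambda>x. emeasure lborel (ball 0 1 - cball 0 x :: complex set)"
  have ep: "ennreal (indicator S z / pi) = ennreal (1 / pi) * indicator S z" for S and z :: complex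
    by (simp add: indicator_def)
  have M: "emeasure ?M {x<..} = ennreal (1 / pi) * ?e x" for x
  proof -
    have "emeasure ?M {x<..} = (\<integral>\<^sup>+z. ennreal (indicator (ball 0 1) z / pi) * indicator {x<..} (cmod z) \<partial>lborel)"
      by (rule emeasure_distr_density) measurable
    also have "\<dots> = (\<integral>\<^sup>+z. ennreal (1 / pi) * indicator (ball 0 1 - cball 0 x) z \<partial>(lborel :: complex measure))"
    proof (rule nn_integral_cong)
      fix z :: complex
      have "indicator (ball 0 1) z * indicator {x<..} (cmod z) = (indicator (ball 0 1 - cball 0 x) z :: ennreal)"
        by (auto split: split_indicator)
      then show "ennreal (indicator (ball 0 1) z / pi) * indicator {x<..} (cmod z) = ennreal (1 / pi) * indicator (ball 0 1 - cball 0 x) z"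
        unfolding ep by (simp only: mult.assoc)
    qed
    finally have "emeasure ?M {x<..} = (\<integral>\<^sup>+z. ennreal (1 / pi) * indicator (ball 0 1 - cball 0 x) z \<partial>(lborel :: complex measure))" .
    then show ?thesis by (subst (asm) nn_integral_cmult_indicator) auto
  qed
  have N: "emeasure ?N {x<..} = ?n x" for x
  proof -
    have "emeasure ?N {x<..} = (\<integral>\<^sup>+r. ennreal (2 * r * indicator {0..1} r) * indicator {x<..} r \<partial>lborel)"
      by (simp add: emeasure_density)
    also have "\<dots> = ?n x"
      using AE_lborel_singleton[of x] by (intro nn_integral_cong_AE) (auto simp: indicator_def)
    finally show ?thesis .
  qed
  fix x :: real
  have "?e x < \<infinity>"
    by (rule emeasure_bounded_finite) (rule bounded_subset[OF bounded_ball[of 0 1]], auto)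
  then show "emeasure ?M {x<..} < \<infinity>"
    unfolding M by (simp add: ennreal_mult_less_top)
  consider "x < 0" | "0 \<le> x" "x < 1" | "1 \<le> x" by linarith
  then show "emeasure ?M {x<..} = emeasure ?N {x<..}"
  proof cases
    case 1
    then have "?e x = ennreal pi"
      using emeasure_ball[of 1 "0 :: complex"] by (simp add: unit_ball_vol_2)
    moreover have "(\<integral>\<^sup>+r. ennreal (2 * r) * indicator {0..1} r \<partial>lborel) = ennreal (1\<^sup>2 - 0\<^sup>2)"
      by (rule nn_integral_FTC_Icc) (auto intro!: derivative_eq_intros)
    ultimately show ?thesis unfolding M N using 1 by (simp flip: ennreal_mult)
  next
    case 2
    have "?e x = emeasure lborel (ball 0 1 :: complex set) - emeasure lborel (cball 0 x :: complex set)"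
      using 2 by (intro emeasure_Diff) (auto simp: emeasure_cball)
    also have "\<dots> = ennreal (pi * (1 - x\<^sup>2))"
      using 2 by (simp add: emeasure_ball emeasure_cball unit_ball_vol_2 right_diff_distrib flip: ennreal_minus)
    finally have 1: "emeasure ?M {x<..} = ennreal (1 - x\<^sup>2)" unfolding M
      using 2 by (simp add: power_le_one flip: ennreal_mult)
    have "(\<integral>\<^sup>+r. ennreal (2 * r) * indicator {x..1} r \<partial>lborel) = ennreal (1\<^sup>2 - x\<^sup>2)"
      using 2 by (intro nn_integral_FTC_Icc) (auto intro!: derivative_eq_intros)
    then show ?thesis unfolding 1 N using 2 by simp
  next
    case 3
    then have e: "ball 0 1 - cball 0 x = ({} :: complex set)" by auto
    have "?n x = (\<integral>\<^sup>+(r::real). 0 \<partial>lborel)"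
      using 3 AE_lborel_singleton[of 1] by (intro nn_integral_cong_AE) (auto simp: indicator_def)
    then show ?thesis unfolding M N e by simp
  qed
qed auto

text \<open>A normalised weight: Borel measurable on the whole line and zero off [0,1), so that
  moments and disc integrals run over the whole line and the whole plane without cut-offs.
  \<open>borel_version_exists\<close> reduces every radial weight to this case.\<close>

locale radial_profile =
  fixes w :: "real \<Rightarrow> real"
  assumes w_measurable [measurable]: "w \<in> borel_measurable borel"
    and w_nonneg: "0 \<le> w r"
    and w_support: "r \<notin> {0..<1} \<Longrightarrow> w r = 0"
    and w_integrable: "integrable lborel w"
    and tail_pos': "0 \<le> r \<Longrightarrow> r < 1 \<Longrightarrow> 0 < (LINT s:{r..<1}|lborel. w s)"
begin

definition tail :: "real \<Rightarrow> real" where "tail r = (LINT s:{r..<1}|lborel. w s)"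

definition mom :: "real \<Rightarrow> real" where "mom x = (\<integral>r. r powr x * w r \<partial>lborel)"

text \<open>The measure \<omega> dA as a Borel measure on the plane. It is concentrated on the disc
  because \<open>w\<close> vanishes from radius 1 on; \<open>AE_mu_ball\<close> recovers the
  restriction.\<close>

definition mu :: "complex measure" where "mu = density lborel (\<lambda>z. ennreal (w (cmod z) / pi))"

lemma sets_mu [measurable_cong, simp]: "sets mu = sets borel" and space_mu [simp]: "space mu = UNIV"
  by (simp_all add: mu_def)

lemma distr_mu_cmod: "distr mu borel cmod = density lborel (\<lambda>r. ennreal (2 * r * w r))"
proof (rule measure_eqI)
  fix A assume "A \<in> sets (distr mu borel cmod)"
  then have [measurable]: "A \<in> sets borel" by simp
  let ?D = "density lborel (\<lambda>z::complex. ennreal (indicator (ball 0 1) z / pi))"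
  have "emeasure (distr mu borel cmod) A = (\<integral>\<^sup>+z. ennreal (w (cmod z) / pi) * indicator A (cmod z) \<partial>lborel)"
    unfolding mu_def by (rule emeasure_distr_density) auto
  also have "\<dots> = (\<integral>\<^sup>+z. ennreal (indicator (ball 0 1) z / pi) * (ennreal (w (cmod z)) * indicator A (cmod z)) \<partial>lborel)"
  proof (intro nn_integral_cong)
    fix z :: complex
    show "ennreal (w (cmod z) / pi) * indicator A (cmod z) = ennreal (indicator (ball 0 1) z / pi) * (ennreal (w (cmod z)) * indicator A (cmod z))"
    proof (cases "z \<in> ball 0 1")
      case True
      have "ennreal (w (cmod z) / pi) = ennreal (1 / pi) * ennreal (w (cmod z))"
        using w_nonneg by (simp flip: ennreal_mult)
      then show ?thesis using True by (simp add: mult.assoc)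
    next
      case False
      then have "w (cmod z) = 0" using w_support[of "cmod z"] by auto
      then show ?thesis by simp
    qed
  qed
  also have "\<dots> = (\<integral>\<^sup>+z. ennreal (w (cmod z)) * indicator A (cmod z) \<partial>?D)"
    by (subst nn_integral_density) auto
  also have "\<dots> = (\<integral>\<^sup>+r. ennreal (w r) * indicator A r \<partial>distr ?D borel cmod)"
    by (subst nn_integral_distr) auto
  also have "\<dots> = (\<integral>\<^sup>+r. ennreal (2 * r * indicator {0..1} r) * (ennreal (w r) * indicator A r) \<partial>lborel)"
    unfolding distr_cmod_disc by (subst nn_integral_density) auto
  also have "\<dots> = (\<integral>\<^sup>+r. ennreal (2 * r * w r) * indicator A r \<partial>lborel)"
  proof (intro nn_integral_cong)
    fix r :: real
    have "ennreal (2 * r * indicator {0..1} r) * ennreal (w r) = ennreal (2 * r * w r)"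
      using w_support[of r] w_nonneg[of r] by (cases "r \<in> {0..<1}") (auto simp: indicator_def simp flip: ennreal_mult')
    then show "ennreal (2 * r * indicator {0..1} r) * (ennreal (w r) * indicator A r) = ennreal (2 * r * w r) * indicator A r"
      by (simp add: mult.assoc[symmetric])
  qed
  also have "\<dots> = emeasure (density lborel (\<lambda>r. ennreal (2 * r * w r))) A"
    by (simp add: emeasure_density)
  finally show "emeasure (distr mu borel cmod) A = emeasure (density lborel (\<lambda>r. ennreal (2 * r * w r))) A" .
qed simp

lemma nn_integral_mu_cmod:
  assumes [measurable]: "g \<in> borel_measurable borel"
  shows "(\<integral>\<^sup>+z. g (cmod z) \<partial>mu) = (\<integral>\<^sup>+r. ennreal (2 * r * w r) * g r \<partial>lborel)"
proof -
  have "(\<integral>\<^sup>+z. g (cmod z) \<partial>mu) = (\<integral>\<^sup>+r. g r \<partial>distr mu borel cmod)"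
    by (subst nn_integral_distr) auto
  then show ?thesis unfolding distr_mu_cmod by (simp add: nn_integral_density)
qed

lemma integral_mu_cmod:
  fixes g :: "real \<Rightarrow> real"
  assumes [measurable]: "g \<in> borel_measurable borel"
  shows "(\<integral>z. g (cmod z) \<partial>mu) = (\<integral>r. 2 * r * w r * g r \<partial>lborel)"
proof -
  have nn: "0 \<le> 2 * r * w r" for r using w_support[of r] w_nonneg[of r] by (cases "r < 0") auto
  have "(\<integral>z. g (cmod z) \<partial>mu) = (\<integral>r. g r \<partial>distr mu borel cmod)"
    by (subst integral_distr) auto
  then show ?thesis unfolding distr_mu_cmod using nn by (simp add: integral_density)
qed

lemma AE_mu_ball: "AE z in mu. z \<in> ball 0 1"
  unfolding mu_def by (subst AE_density) (use w_support in \<open>auto intro!: AE_I2\<close>, force)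

lemma nn_integral_mu_rotate:
  assumes u: "cmod u = 1" and [measurable]: "g \<in> borel_measurable borel"
  shows "(\<integral>\<^sup>+z. g (u * z) \<partial>mu) = (\<integral>\<^sup>+z. g z \<partial>mu)"
proof -
  have "(\<integral>\<^sup>+z. g (u * z) \<partial>mu) = (\<integral>\<^sup>+z. ennreal (w (cmod (u * z)) / pi) * g (u * z) \<partial>lborel)"
    unfolding mu_def by (subst nn_integral_density) (auto simp: norm_mult u)
  also have "\<dots> = (\<integral>\<^sup>+z. ennreal (w (cmod z) / pi) * g z \<partial>distr lborel borel (\<lambda>z. u * z))"
    by (subst nn_integral_distr) auto
  also have "\<dots> = (\<integral>\<^sup>+z. g z \<partial>mu)"
    unfolding mu_def lborel_rotate[OF u] by (subst nn_integral_density) auto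
  finally show ?thesis .
qed

lemma distr_mu_rotate:
  assumes u: "cmod u = 1"
  shows "distr mu borel (\<lambda>z. u * z) = mu"
proof (rule measure_eqI)
  fix A assume "A \<in> sets (distr mu borel (\<lambda>z. u * z))"
  then have [measurable]: "A \<in> sets borel" by simp
  have "emeasure (distr mu borel (\<lambda>z. u * z)) A = (\<integral>\<^sup>+z. indicator A (u * z) \<partial>mu)"
    by (subst nn_integral_indicator[symmetric]) (simp_all add: nn_integral_distr del: nn_integral_indicator)
  also have "\<dots> = (\<integral>\<^sup>+z. indicator A z \<partial>mu)" by (rule nn_integral_mu_rotate[OF u]) measurable
  finally show "emeasure (distr mu borel (\<lambda>z. u * z)) A = emeasure mu A" by simp
qed simp

lemma integral_mu_rotate:
  fixes g :: "complex \<Rightarrow> 'b :: {banach, second_countable_topology}"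
  assumes u: "cmod u = 1" and [measurable]: "g \<in> borel_measurable borel"
  shows "(\<integral>z. g (u * z) \<partial>mu) = (\<integral>z. g z \<partial>mu)"
proof -
  have "(\<integral>z. g (u * z) \<partial>mu) = (\<integral>z. g z \<partial>distr mu borel (\<lambda>z. u * z))"
    by (subst integral_distr) auto
  then show ?thesis by (simp add: distr_mu_rotate[OF u])
qed

lemma tail_indicator: "tail r = (\<integral>s. indicator {r..<1} s * w s \<partial>lborel)"
  by (simp add: tail_def set_lebesgue_integral_def)

lemma tail_integrable: "integrable lborel (\<lambda>s. indicator {r..<1} s * w s)"
  by (rule Bochner_Integration.integrable_bound[OF w_integrable]) (auto simp: indicator_def)

lemma tail_pos: "0 \<le> r \<Longrightarrow> r < 1 \<Longrightarrow> 0 < tail r"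
  using tail_pos' by (simp add: tail_def)

lemma tail_antimono: "r \<le> s \<Longrightarrow> tail s \<le> tail r"
  unfolding tail_indicator
  by (intro integral_mono tail_integrable) (auto simp: indicator_def w_nonneg)

lemma powr_w_le: "0 \<le> x \<Longrightarrow> r powr x * w r \<le> w r"
  using w_support[of r] w_nonneg[of r] powr_le1[of x r]
  by (cases "r \<in> {0..<1}") (auto intro!: mult_left_le_one_le)

lemma mom_integrable: "0 \<le> x \<Longrightarrow> integrable lborel (\<lambda>r. r powr x * w r)"
  by (rule Bochner_Integration.integrable_bound[OF w_integrable])
    (auto simp: w_nonneg powr_w_le abs_mult)

lemma mom_ge_tail:
  assumes "0 \<le> x" "0 \<le> r"
  shows "r powr x * tail r \<le> mom x"
proof -
  have "(\<integral>s. r powr x * (indicator {r..<1} s * w s) \<partial>lborel) \<le> mom x"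
    unfolding mom_def using assms
    by (intro integral_mono integrable_mult_right tail_integrable mom_integrable)
      (auto simp: indicator_def w_nonneg intro!: mult_right_mono powr_mono2)
  then show ?thesis by (simp add: tail_indicator)
qed

lemma mom_pos:
  assumes "0 \<le> x"
  shows "0 < mom x"
proof -
  have "0 < (1/2) powr x * tail (1/2)" using tail_pos[of "1/2"] by simp
  also have "\<dots> \<le> mom x" using assms by (rule mom_ge_tail) simp
  finally show ?thesis .
qed

lemma mom_antimono:
  assumes "0 \<le> x" "x \<le> y"
  shows "mom y \<le> mom x"
  unfolding mom_def
proof (intro integral_mono mom_integrable)
  fix r
  show "r powr y * w r \<le> r powr x * w r"
    using assms w_support[of r] w_nonneg[of r] powr_mono'[of x y r]
    by (cases "r \<in> {0..<1}") (auto intro!: mult_right_mono)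
qed (use assms in auto)

text \<open>The part of the moment over \<open>r < 1/2\<close> is dominated by the part over \<open>r \<ge> 1/2\<close>, uniformly in \<open>u\<close>.\<close>
lemma mom_shift: "\<exists>C>0. \<forall>u\<ge>0. mom u \<le> C * mom (u + c)" if "0 \<le> c"
proof -
  \<comment> \<open>For r \<ge> 1/2 one has r^u \<le> 2^c r^(u+c). For r < 1/2 the weight
    contributes at most (1/2)^u \<open>tail 0\<close>, and \<open>mom_ge_tail\<close> at 1/2 bounds
    (1/2)^u by 2^c \<open>mom (u + c) / tail (1/2)\<close>.\<close>
  define C where "C = 2 powr c * (1 + tail 0 / tail (1/2))"
  have t: "0 < tail (1/2)" "0 < tail 0" by (auto intro: tail_pos)
  have "mom u \<le> C * mom (u + c)" if u: "0 \<le> u" for u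
  proof -
    have uc: "0 \<le> u + c" using u \<open>0 \<le> c\<close> by simp
    have "mom u \<le> (\<integral>r. 2 powr c * (r powr (u + c) * w r) + (1/2) powr u * (indicator {0..<1} r * w r) \<partial>lborel)"
      unfolding mom_def
    proof (intro integral_mono mom_integrable u Bochner_Integration.integrable_add integrable_mult_right uc tail_integrable)
      fix r
      show "r powr u * w r \<le> 2 powr c * (r powr (u + c) * w r) + (1/2) powr u * (indicator {0..<1} r * w r)"
      proof (cases "r \<in> {0..<1}")
        case True
        show ?thesis
        proof (cases "1/2 \<le> r")
          case h: True
          have "1 \<le> (2 * r) powr c" using h \<open>0 \<le> c\<close> by (intro ge_one_powr_ge_zero) auto
          also have "\<dots> = 2 powr c * r powr c" using h by (simp add: powr_mult)
          finally have "r powr u * 1 \<le> r powr u * (2 powr c * r powr c)" by (intro mult_left_mono) auto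
          then have "r powr u \<le> 2 powr c * r powr (u + c)" by (simp add: powr_add mult_ac)
          then have "r powr u * w r \<le> 2 powr c * r powr (u + c) * w r" using w_nonneg by (intro mult_right_mono)
          moreover have "0 \<le> (1/2) powr u * (indicator {0..<1} r * w r)" using w_nonneg by simp
          ultimately show ?thesis by (simp add: mult.assoc)
        next
          case False
          then have "r powr u \<le> (1/2) powr u" using True u by (intro powr_mono2) auto
          then have "r powr u * w r \<le> (1/2) powr u * w r" using w_nonneg by (intro mult_right_mono)
          moreover have "0 \<le> 2 powr c * (r powr (u + c) * w r)" using w_nonneg by simp
          ultimately show ?thesis using True by simp
        qed
      qed (use w_support[of r] in simp)
    qed
    also have "\<dots> = 2 powr c * mom (u + c) + (1/2) powr u * tail 0"
      using mom_integrable[OF uc] tail_integrable[of 0]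
      by (simp add: mom_def tail_indicator)
    also have "(1/2) powr u \<le> 2 powr c * mom (u + c) / tail (1/2)"
    proof -
      have "(1/2) powr (u + c) * tail (1/2) \<le> mom (u + c)" by (rule mom_ge_tail) (use uc in auto)
      then have "2 powr c * ((1/2) powr (u + c) * tail (1/2)) \<le> 2 powr c * mom (u + c)" by simp
      moreover have "2 powr c * (1/2) powr (u + c) = (1/2 :: real) powr u"
      proof -
        have "(2 :: real) powr c * (1/2) powr c = 1" by (simp flip: powr_mult)
        then show ?thesis by (simp add: powr_add mult.left_commute)
      qed
      ultimately have "(1/2) powr u * tail (1/2) \<le> 2 powr c * mom (u + c)" by (simp only: mult.assoc[symmetric])
      then show ?thesis using t by (simp add: pos_le_divide_eq)
    qed
    then have "2 powr c * mom (u + c) + (1/2) powr u * tail 0 \<le> 2 powr c * mom (u + c) + 2 powr c * mom (u + c) / tail (1/2) * tail 0"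
      using t by (intro add_left_mono mult_right_mono) auto
    finally show ?thesis by (simp add: C_def algebra_simps)
  qed
  moreover have "0 < C" using t by (auto simp: C_def intro!: mult_pos_pos add_pos_pos)
  ultimately show ?thesis by blast
qed

text \<open>The shift of the exponent by 1 is the Jacobian r; it is the reason for the odd moments
  in the kernel and in the test function estimates.\<close>

lemma mom_int: "(\<integral>z. cmod z powr x \<partial>mu) = 2 * mom (x + 1)"
proof -
  have "2 * r * w r * r powr x = 2 * (r powr (x + 1) * w r)" for r
    using w_support[of r] by (cases "r \<le> 0") (auto simp: powr_add)
  then show ?thesis by (subst integral_mu_cmod, simp) (simp only: mom_def integral_mult_right_zero)
qed

lemma finite_measure_mu: "finite_measure mu"
proof (rule finite_measureI)
  have "emeasure mu UNIV = (\<integral>\<^sup>+z. 1 \<partial>mu)" by simp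
  also have "\<dots> = (\<integral>\<^sup>+r. ennreal (2 * r * w r) * 1 \<partial>lborel)" by (rule nn_integral_mu_cmod) simp
  also have "\<dots> \<le> (\<integral>\<^sup>+r. ennreal (2 * w r) \<partial>lborel)"
  proof (intro nn_integral_mono)
    fix r
    have "r * w r \<le> w r" using w_support[of r] w_nonneg[of r] by (cases "r \<in> {0..<1}") (auto intro!: mult_left_le_one_le)
    then show "ennreal (2 * r * w r) * 1 \<le> ennreal (2 * w r)" by (simp add: ennreal_leI)
  qed
  also have "\<dots> < \<infinity>" using w_integrable w_nonneg by (subst nn_integral_eq_integral) auto
  finally show "emeasure mu (space mu) \<noteq> \<infinity>" by simp
qed

sublocale mu: finite_measure mu by (rule finite_measure_mu)

section \<open>Doubling of the moments\<close>

lemma mom_iterate: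
  assumes "0 \<le> C" "1 \<le> l" and d: "\<And>x. 0 < x \<Longrightarrow> mom x \<le> C * mom (l * x)" and "0 < x"
  shows "mom x \<le> C ^ k * mom (l ^ k * x)"
proof (induction k)
  case (Suc k)
  have "mom (l ^ k * x) \<le> C * mom (l * (l ^ k * x))" using assms by (intro d) auto
  then have "C ^ k * mom (l ^ k * x) \<le> C ^ k * (C * mom (l * (l ^ k * x)))"
    using assms by (intro mult_left_mono) auto
  with Suc show ?case by (simp add: mult_ac)
qed simp

text \<open>At x = 1/(1-r) the moment of order x is at least a fixed multiple of
  \<open>tail r\<close>, because r^x is bounded below. For a large fixed N the part of the moment of
  order N x that comes from radii below s = (1+r)/2 is so small that it can be absorbed, so this
  moment is at most 2 \<open>tail s\<close>. Iterated doubling connects the orders x and N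
  x.\<close>

lemma tail_doubling_of_mom_doubling:
  assumes d: "\<And>x. 0 < x \<Longrightarrow> mom x \<le> C * mom (2 * x)"
  shows "\<exists>D\<ge>1. \<forall>r\<in>{0..<1}. tail r \<le> D * tail ((1 + r) / 2)"
proof -
  have C0: "0 < C"
    using d[of 1] mom_pos[of 1] mom_pos[of 2] zero_less_mult_pos2[of C "mom 2"] by (simp add: less_le_trans)
  obtain n0 :: nat where n0': "4 * ln (2 * C) < real n0" using reals_Archimedean2 by blast
  have n0: "C * exp (- (real n / 4)) < 1 / 2" if "n0 \<le> n" for n
  proof -
    have "ln (2 * C) < real n / 4" using n0' that by simp
    then have "exp (ln (2 * C)) < exp (real n / 4)" by (simp only: exp_less_cancel_iff)
    then have "2 * C < exp (real n / 4)" using C0 by simp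
    then show ?thesis by (simp add: exp_minus field_simps)
  qed
  \<comment> \<open>N has to be a power of 2 to be reached by k doublings, and 2^n0 > n0 guarantees
    the required smallness at N.\<close>
  define k where "k = n0"
  define N where "N = (2::nat) ^ k"
  have N: "C * exp (- (real N / 4)) < 1 / 2" using n0[of N] less_exp[of n0] by (simp add: N_def k_def)
  have N0: "0 < real N" by (simp add: N_def)
  define D1 where "D1 = exp 2 * C ^ k * 2"
  have big: "tail r \<le> D1 * tail ((1 + r) / 2)" if r: "1 / 2 \<le> r" "r < 1" for r
  proof -
    \<comment> \<open>With this x one has s - 1 = -1/(2x), hence s^(Nx/2) \<le> exp (-N/4), and x (1
      - 1/r) = -1/r \<ge> -2 for r \<ge> 1/2, hence r^x \<ge> exp (-2).\<close>
    define x where "x = 1 / (1 - r)"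
    define s where "s = (1 + r) / 2"
    have x: "0 < x" using r by (simp add: x_def)
    have s: "0 < s" "s < 1" using r by (auto simp: s_def)
    have y: "0 \<le> real N * x" "0 \<le> real N * x / 2" using x N0 by auto
    have "mom (N * x) \<le> (\<integral>t. s powr (N * x / 2) * (t powr (N * x / 2) * w t) + indicator {s..<1} t * w t \<partial>lborel)"
      unfolding mom_def
    proof (intro integral_mono mom_integrable y Bochner_Integration.integrable_add integrable_mult_right tail_integrable)
      fix t
      show "t powr (N * x) * w t \<le> s powr (N * x / 2) * (t powr (N * x / 2) * w t) + indicator {s..<1} t * w t"
      proof (cases "s \<le> t")
        case True
        then have "indicator {s..<1} t * w t = w t" using w_support[of t] by (auto simp: indicator_def)
        moreover have "0 \<le> s powr (N * x / 2) * (t powr (N * x / 2) * w t)" using w_nonneg by simp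
        ultimately show ?thesis using powr_w_le[OF y(1), of t] by linarith
      next
        case False
        show ?thesis
        proof (cases "0 \<le> t")
          case t: True
          have "t powr (N * x) = t powr (N * x / 2) * t powr (N * x / 2)" by (simp add: mult.commute flip: powr_add)
          also have "\<dots> \<le> s powr (N * x / 2) * t powr (N * x / 2)"
            using False y t by (intro mult_right_mono powr_mono2) auto
          finally have "t powr (N * x) * w t \<le> s powr (N * x / 2) * t powr (N * x / 2) * w t"
            using w_nonneg by (rule mult_right_mono)
          moreover have "0 \<le> indicator {s..<1} t * w t" using w_nonneg by simp
          ultimately show ?thesis by (simp add: mult.assoc)
        qed (use w_support[of t] in simp)
      qed
    qed
    also have "\<dots> = s powr (N * x / 2) * mom (N * x / 2) + tail s"
      using mom_integrable[OF y(2)] tail_integrable[of s] by (simp add: mom_def tail_indicator)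
    also have "s powr (N * x / 2) * mom (N * x / 2) \<le> exp (- (real N / 4)) * (C * mom (N * x))"
    proof (intro mult_mono)
      have "ln s \<le> s - 1" using s by (intro ln_le_minus_one)
      also have "s - 1 = - (1 / (2 * x))" using r by (simp add: s_def x_def field_simps)
      finally have "N * x / 2 * ln s \<le> N * x / 2 * (- (1 / (2 * x)))" using y by (intro mult_left_mono) auto
      also have "\<dots> = - (real N / 4)" using x by (simp add: field_simps)
      finally show "s powr (N * x / 2) \<le> exp (- (real N / 4))" using s by (simp add: powr_def)
      show "mom (N * x / 2) \<le> C * mom (N * x)" using d[of "N * x / 2"] x N0 by simp
      show "0 \<le> mom (N * x / 2)" using y by (intro less_imp_le[OF mom_pos])
    qed simp
    also have "exp (- (real N / 4)) * (C * mom (N * x)) = (C * exp (- (real N / 4))) * mom (N * x)" by simp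
    \<comment> \<open>Half of the left-hand side is absorbed.\<close>
    also have "\<dots> \<le> (1 / 2) * mom (N * x)" using N mom_pos[OF y(1)] by (intro mult_right_mono) auto
    finally have Nx: "mom (N * x) \<le> 2 * tail s" by simp
    have "1 - 1 / r \<le> ln r" using ln_le_minus_one[of "1 / r"] r by (simp add: ln_div)
    then have "x * (1 - 1 / r) \<le> x * ln r" using x by (intro mult_left_mono) auto
    moreover have "x * (1 - 1 / r) = - (1 / r)" using r by (simp add: x_def field_simps)
    moreover have "1 / r \<le> 2" using r by (simp add: field_simps)
    ultimately have "-2 \<le> x * ln r" by linarith
    then have "exp (- 2) \<le> r powr x" using r by (simp add: powr_def)
    then have "exp (- 2) * tail r \<le> r powr x * tail r" using tail_pos[of r] r by (intro mult_right_mono) auto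
    also have "\<dots> \<le> mom x" using x r by (intro mom_ge_tail) auto
    also have "\<dots> \<le> C ^ k * mom (2 ^ k * x)" using C0 x d by (intro mom_iterate) auto
    also have "mom (2 ^ k * x) \<le> 2 * tail s" using Nx by (simp add: N_def)
    finally have "exp 2 * (exp (- 2) * tail r) \<le> exp 2 * (C ^ k * (2 * tail s))" using C0 by simp
    then show ?thesis by (simp add: D1_def s_def exp_minus mult_ac)
  qed
  \<comment> \<open>For r < 1/2 the point (1+r)/2 is below 3/4, so a quotient of two fixed tails
    suffices.\<close>
  define D where "D = max 1 (max D1 (tail 0 / tail (3 / 4)))"
  show ?thesis
  proof (intro exI[of _ D] conjI ballI)
    show "1 \<le> D" by (simp add: D_def)
    fix r :: real assume r: "r \<in> {0..<1}"
    then have ts: "0 < tail ((1 + r) / 2)" by (intro tail_pos) auto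
    show "tail r \<le> D * tail ((1 + r) / 2)"
    proof (cases "1 / 2 \<le> r")
      case True
      then have "tail r \<le> D1 * tail ((1 + r) / 2)" using big r by auto
      also have "\<dots> \<le> D * tail ((1 + r) / 2)" using ts by (intro mult_right_mono) (auto simp: D_def)
      finally show ?thesis .
    next
      case False
      have t34: "0 < tail (3 / 4)" by (rule tail_pos) auto
      have "tail r \<le> tail 0" using r by (intro tail_antimono) auto
      also have "\<dots> = tail 0 / tail (3 / 4) * tail (3 / 4)" using t34 by simp
      also have "\<dots> \<le> tail 0 / tail (3 / 4) * tail ((1 + r) / 2)"
        using False t34 tail_pos[of 0] by (intro mult_left_mono tail_antimono) auto
      also have "\<dots> \<le> D * tail ((1 + r) / 2)" using ts by (intro mult_right_mono) (auto simp: D_def)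
      finally show ?thesis .
    qed
  qed
qed

text \<open>Chaining the two inequalities, the factor with p' cancels and leaves
  \<open>mom y\<close> \<le> C \<open>mom (l * y)\<close> with l = (p+e)/p. Since e > 0 gives l > 1,
  finitely many iterations exceed the factor 2.\<close>

lemma mom_doubling_of_moment_condition:
  assumes p: "1 < p" "1 / p + 1 / p' = 1" and e: "0 < e"
    and A: "\<And>x. 0 \<le> x \<Longrightarrow> mom (p * x) powr (1 / p) * mom (p' * x) powr (1 / p') \<le> C1 * mom (2 * x)"
    and B: "\<And>x. 0 \<le> x \<Longrightarrow> mom (2 * x) \<le> C2 * (mom ((p + e) * x) powr (1 / p) * mom (p' * x) powr (1 / p'))"
    and C: "0 < C1" "0 < C2"
  shows "\<exists>C. \<forall>x>0. mom x \<le> C * mom (2 * x)"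
proof -
  have p': "0 < p'" using p by (smt (verit) divide_le_0_1_iff divide_less_eq_1_pos)
  define l where "l = (p + e) / p"
  have l: "1 < l" using p e by (simp add: l_def)
  define C where "C = (C1 * C2) powr p"
  have step: "mom y \<le> C * mom (l * y)" if y: "0 < y" for y
  proof -
    define x where "x = y / p"
    have x: "0 \<le> x" "p * x = y" "(p + e) * x = l * y" using y p by (auto simp: x_def l_def)
    define b where "b = mom (p' * x) powr (1 / p')"
    have m: "0 < mom y" "0 < mom (l * y)" "0 < mom (p' * x)" using y l p' x by (auto intro!: mom_pos)
    have b: "0 < b" using m by (simp add: b_def)
    have "mom y powr (1 / p) * b \<le> C1 * mom (2 * x)" using A[OF x(1)] unfolding x b_def .
    also have "\<dots> \<le> C1 * (C2 * (mom (l * y) powr (1 / p) * b))"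
      using B[OF x(1)] C unfolding x b_def by (intro mult_left_mono) auto
    finally have "mom y powr (1 / p) * b \<le> (C1 * C2 * mom (l * y) powr (1 / p)) * b" by (simp add: mult_ac)
    then have "mom y powr (1 / p) \<le> C1 * C2 * mom (l * y) powr (1 / p)" using b by simp
    then have "(mom y powr (1 / p)) powr p \<le> (C1 * C2 * mom (l * y) powr (1 / p)) powr p"
      using p by (intro powr_mono2) auto
    then show ?thesis using m p C by (simp add: C_def powr_powr powr_mult)
  qed
  obtain k where k: "2 < l ^ k" using real_arch_pow[OF l] by blast
  have "mom x \<le> C ^ k * mom (2 * x)" if x: "0 < x" for x
  proof -
    have "mom x \<le> C ^ k * mom (l ^ k * x)" using l x step by (intro mom_iterate) (auto simp: C_def)
    also have "\<dots> \<le> C ^ k * mom (2 * x)" using x k by (intro mult_left_mono mom_antimono) (auto simp: C_def)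
    finally show ?thesis .
  qed
  then show ?thesis by blast
qed

section \<open>Derivatives and concavity of the logarithmic moment\<close>

definition lmom :: "nat \<Rightarrow> real \<Rightarrow> real" where
  "lmom k x = (\<integral>r. r powr x * ln r ^ k * w r \<partial>lborel)"

lemma lmom_0: "lmom 0 = mom"
  by (simp add: lmom_def mom_def fun_eq_iff)

text \<open>With a = -ln r, raise c a / m \<le> exp (c a / m) to the m-th power.\<close>

lemma ln_power_powr_bound:
  fixes r c :: real
  assumes "0 < r" "r < 1" "0 < c" "0 < m"
  shows "\<bar>ln r\<bar> ^ m * r powr c \<le> (m / c) ^ m"
proof -
  define a where "a = - ln r"
  have a: "0 < a" using assms by (simp add: a_def)
  have "(c * a / m) ^ m \<le> exp (c * a / m) ^ m"
  proof (intro power_mono)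
    show "c * a / m \<le> exp (c * a / m)" using exp_ge_add_one_self[of "c * a / m"] by linarith
  qed (use a assms in auto)
  also have "\<dots> = exp (c * a)" using assms by (simp flip: exp_of_nat_mult)
  finally have "(c / m) ^ m * a ^ m \<le> exp (c * a)" by (simp add: power_mult_distrib power_divide)
  then have "a ^ m * exp (- (c * a)) \<le> (m / c) ^ m"
    using assms by (simp add: exp_minus power_divide field_simps)
  moreover have "r powr c = exp (- (c * a))" "\<bar>ln r\<bar> = a" using assms a by (auto simp: powr_def a_def)
  ultimately show ?thesis by simp
qed

lemma lmom_integrand_bound:
  assumes "0 < c" "0 < m"
  shows "\<bar>r powr c * ln r ^ m * w r\<bar> \<le> (m / c) ^ m * w r"
proof (cases "r \<in> {0<..<1}")
  case True
  then have "\<bar>ln r\<bar> ^ m * r powr c * w r \<le> (m / c) ^ m * w r"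
    using assms w_nonneg by (intro mult_right_mono ln_power_powr_bound) auto
  then show ?thesis using w_nonneg[of r] by (simp add: abs_mult power_abs mult_ac)
next
  case False
  then show ?thesis using assms w_support[of r] w_nonneg[of r] by (cases "r = 0") auto
qed

lemma lmom_integrable:
  assumes "0 < x"
  shows "integrable lborel (\<lambda>r. r powr x * ln r ^ k * w r)"
proof (cases "k = 0")
  case True then show ?thesis using mom_integrable[of x] assms by simp
next
  case False
  show ?thesis
    by (rule Bochner_Integration.integrable_bound[OF integrable_mult_right[OF w_integrable, of "(k / x) ^ k"]])
      (use lmom_integrand_bound[OF assms, of k] False w_nonneg assms in \<open>auto simp: abs_mult\<close>)
qed

lemma exp_remainder: "\<bar>exp y - 1 - y\<bar> \<le> y\<^sup>2 * exp \<bar>y\<bar>" for y :: real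
proof -
  obtain t where t: "\<bar>t\<bar> \<le> \<bar>y\<bar>" "exp y = (\<Sum>m<2. y ^ m / fact m) + exp t / fact 2 * y\<^sup>2"
    using Maclaurin_exp_le[of y 2] by auto
  have "\<bar>exp y - 1 - y\<bar> = exp t / 2 * y\<^sup>2" using t by (simp add: numeral_2_eq_2)
  also have "\<dots> \<le> exp \<bar>y\<bar> * y\<^sup>2"
  proof (intro mult_right_mono)
    have "exp t \<le> exp \<bar>y\<bar>" using t(1) by simp
    then show "exp t / 2 \<le> exp \<bar>y\<bar>" using exp_gt_zero[of t] by linarith
  qed simp
  finally show ?thesis by (simp add: mult.commute)
qed

text \<open>The first order Taylor remainder of the integrand in the exponent is estimated pointwise
  by a multiple of h^2 \<open>w r\<close>, uniformly in r; dividing by h gives the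
  derivative.\<close>

lemma DERIV_lmom:
  assumes x: "0 < x"
  shows "(lmom k has_real_derivative lmom (Suc k) x) (at x)"
proof -
  define K where "K = (real (k + 2) / (x / 2)) ^ (k + 2) * (\<integral>r. w r \<partial>lborel)"
  have bd: "\<bar>lmom k (x + h) - lmom k x - h * lmom (Suc k) x\<bar> \<le> K * h\<^sup>2" if h: "\<bar>h\<bar> < x / 2" for h
  proof -
    have xh: "0 < x + h" using h by linarith
    let ?d = "\<lambda>r. r powr (x + h) * ln r ^ k * w r - r powr x * ln r ^ k * w r - h * (r powr x * ln r ^ Suc k * w r)"
    have eq: "lmom k (x + h) - lmom k x - h * lmom (Suc k) x = (\<integral>r. ?d r \<partial>lborel)"
      unfolding lmom_def using lmom_integrable[OF x] lmom_integrable[OF xh]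
      by (simp del: power_Suc)
    have "\<bar>\<integral>r. ?d r \<partial>lborel\<bar> \<le> (\<integral>r. h\<^sup>2 * ((real (k + 2) / (x / 2)) ^ (k + 2) * w r) \<partial>lborel)"
      unfolding real_norm_def[symmetric]
    proof (rule Bochner_Integration.integral_norm_bound_integral)
      fix r
      show "norm (?d r) \<le> h\<^sup>2 * ((real (k + 2) / (x / 2)) ^ (k + 2) * w r)"
      proof (cases "r \<in> {0<..<1}")
        case True
        define a where "a = ln r"
        have a: "a < 0" using True by (simp add: a_def)
        have e: "r powr y = exp (y * a)" for y using True by (simp add: powr_def a_def)
        have "?d r = exp (x * a) * a ^ k * w r * (exp (h * a) - 1 - h * a)"
          by (simp add: e algebra_simps exp_add flip: a_def)
        then have "norm (?d r) = exp (x * a) * \<bar>a\<bar> ^ k * w r * \<bar>exp (h * a) - 1 - h * a\<bar>"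
          using w_nonneg[of r] by (simp add: abs_mult power_abs)
        also have "\<dots> \<le> exp (x * a) * \<bar>a\<bar> ^ k * w r * ((h * a)\<^sup>2 * exp \<bar>h * a\<bar>)"
          using w_nonneg[of r] by (intro mult_left_mono exp_remainder) auto
        also have "\<dots> = h\<^sup>2 * (exp (x * a) * exp \<bar>h * a\<bar> * \<bar>a\<bar> ^ (k + 2) * w r)"
          by (simp add: power_mult_distrib power_add power2_eq_square mult_ac)
        also have "\<dots> \<le> h\<^sup>2 * ((real (k + 2) / (x / 2)) ^ (k + 2) * w r)"
        proof (intro mult_left_mono mult_right_mono w_nonneg)
          \<comment> \<open>Since |h| < x/2, half of the decay r^x pays for exp |h ln r|, and the
            other half r^(x/2) for the k + 2 logarithms.\<close>
          have "\<bar>h * a\<bar> \<le> x / 2 * \<bar>a\<bar>" unfolding abs_mult using h by (intro mult_right_mono) auto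
          also have "\<dots> = - (x / 2 * a)" using a by simp
          finally have "x * a + \<bar>h * a\<bar> \<le> x / 2 * a" by (simp add: field_simps)
          then have "exp (x * a) * exp \<bar>h * a\<bar> \<le> r powr (x / 2)" unfolding e by (simp flip: exp_add)
          then have "exp (x * a) * exp \<bar>h * a\<bar> * \<bar>a\<bar> ^ (k + 2) \<le> r powr (x / 2) * \<bar>a\<bar> ^ (k + 2)"
            by (intro mult_right_mono) auto
          also have "\<dots> \<le> (real (k + 2) / (x / 2)) ^ (k + 2)"
            using ln_power_powr_bound[of r "x / 2" "k + 2"] True x by (simp add: a_def mult.commute)
          finally show "exp (x * a) * exp \<bar>h * a\<bar> * \<bar>a\<bar> ^ (k + 2) \<le> (real (k + 2) / (x / 2)) ^ (k + 2)" .
        qed simp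
        finally show ?thesis .
      next
        case False
        then show ?thesis using x w_support[of r] w_nonneg[of r] by (cases "r = 0") auto
      qed
    next
      show "integrable lborel ?d"
        by (intro Bochner_Integration.integrable_diff integrable_mult_right lmom_integrable x xh)
    qed (intro integrable_mult_right w_integrable)
    also have "\<dots> = K * h\<^sup>2" unfolding K_def integral_mult_right_zero by (simp only: mult_ac)
    finally show ?thesis unfolding eq .
  qed
  have "((\<lambda>h. (lmom k (x + h) - lmom k x) / h - lmom (Suc k) x) \<longlongrightarrow> 0) (at 0)"
  proof (rule Lim_null_comparison)
    show "((\<lambda>h. K * \<bar>h\<bar>) \<longlongrightarrow> 0) (at 0)" by (auto intro!: tendsto_eq_intros)
    have "eventually (\<lambda>h. \<bar>h\<bar> < x / 2 \<and> h \<noteq> 0) (at 0)"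
      unfolding eventually_at using x by (intro exI[of _ "x / 2"]) (auto simp: dist_real_def)
    then show "eventually (\<lambda>h. norm ((lmom k (x + h) - lmom k x) / h - lmom (Suc k) x) \<le> K * \<bar>h\<bar>) (at 0)"
    proof eventually_elim
      fix h assume h: "\<bar>h\<bar> < x / 2 \<and> h \<noteq> 0"
      then have "norm ((lmom k (x + h) - lmom k x) / h - lmom (Suc k) x) = \<bar>lmom k (x + h) - lmom k x - h * lmom (Suc k) x\<bar> / \<bar>h\<bar>"
        by (simp add: diff_divide_distrib flip: abs_divide)
      also have "\<dots> \<le> K * h\<^sup>2 / \<bar>h\<bar>" using bd[of h] h by (intro divide_right_mono) auto
      also have "\<dots> = K * \<bar>h\<bar>" using h by (simp add: power2_eq_square field_simps abs_if)
      finally show "norm ((lmom k (x + h) - lmom k x) / h - lmom (Suc k) x) \<le> K * \<bar>h\<bar>" .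
    qed
  qed
  then show ?thesis unfolding DERIV_def by (rule LIM_zero_cancel)
qed

definition L :: "real \<Rightarrow> real" where "L x = - ln (mom x)"

definition L1 :: "real \<Rightarrow> real" where "L1 x = - (lmom 1 x / lmom 0 x)"

text \<open>Minus the variance of ln r for the probability density proportional to
  \<open>r powr x * w r\<close>; this explains its sign.\<close>

definition L2 :: "real \<Rightarrow> real" where
  "L2 x = - ((lmom 2 x * lmom 0 x - lmom 1 x * lmom 1 x) / (lmom 0 x * lmom 0 x))"

lemma lmom_0_pos: "0 < x \<Longrightarrow> 0 < lmom 0 x"
  by (simp add: lmom_0 mom_pos)

lemma DERIV_L: "0 < x \<Longrightarrow> (L has_real_derivative L1 x) (at x)"
  unfolding L_def[abs_def] L1_def
  using DERIV_lmom[of x 0] lmom_0_pos[of x]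
  by (auto intro!: derivative_eq_intros simp: lmom_0 divide_inverse)

lemma DERIV_L1: "0 < x \<Longrightarrow> (L1 has_real_derivative L2 x) (at x)"
  unfolding L1_def[abs_def] L2_def
  using DERIV_lmom[of x 0] DERIV_lmom[of x 1] lmom_0_pos[of x]
  by (auto intro!: derivative_eq_intros simp: numeral_2_eq_2)

text \<open>\<open>deriv L\<close> agrees with \<open>L1\<close> on the whole open half-line, which
  is what the outer derivative needs.\<close>

lemma deriv2_L:
  assumes "0 < x"
  shows "(deriv ^^ 2) L x = L2 x"
proof -
  have "(deriv L has_real_derivative L2 x) (at x)"
    by (rule has_field_derivative_transform_within_open[OF DERIV_L1[OF assms], of "{0<..}"])
      (use assms in \<open>auto intro!: DERIV_imp_deriv[symmetric] DERIV_L\<close>)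
  then show ?thesis by (simp add: numeral_2_eq_2 DERIV_imp_deriv)
qed

lemma continuous_on_L2: "S \<subseteq> {0<..} \<Longrightarrow> continuous_on S L2"
proof -
  have "continuous_on {0<..} (lmom k)" for k
    by (intro continuous_at_imp_continuous_on ballI DERIV_isCont[OF DERIV_lmom]) auto
  then have "continuous_on {0<..} L2"
    unfolding L2_def using lmom_0_pos by (intro continuous_intros) (auto simp: less_le)
  then show "S \<subseteq> {0<..} \<Longrightarrow> continuous_on S L2" by (rule continuous_on_subset)
qed

lemma lmom_cauchy_schwarz:
  assumes x: "0 < x"
  shows "lmom 1 x * lmom 1 x \<le> lmom 2 x * lmom 0 x"
proof -
  let ?a = "lmom 0 x" and ?b = "lmom 1 x"
  \<comment> \<open>Expanding this integral yields \<open>lmom 0 x\<close> times the difference of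
    the two sides of the claim.\<close>
  have "0 \<le> (\<integral>r. (?a * ln r - ?b)\<^sup>2 * (r powr x * w r) \<partial>lborel)"
    using w_nonneg by (intro integral_nonneg_AE) auto
  also have "\<dots> = (\<integral>r. ?a\<^sup>2 * (r powr x * ln r ^ 2 * w r) - 2 * ?a * ?b * (r powr x * ln r ^ 1 * w r) + ?b\<^sup>2 * (r powr x * ln r ^ 0 * w r) \<partial>lborel)"
    by (intro Bochner_Integration.integral_cong) (auto simp: power2_eq_square algebra_simps)
  also have "\<dots> = ?a\<^sup>2 * lmom 2 x - 2 * ?a * ?b * lmom 1 x + ?b\<^sup>2 * lmom 0 x"
    using lmom_integrable[OF x, of 0] lmom_integrable[OF x, of 1] lmom_integrable[OF x, of 2]
    unfolding lmom_def
    by (subst Bochner_Integration.integral_add Bochner_Integration.integral_diff; (intro Bochner_Integration.integrable_diff integrable_mult_right)?; simp)+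
  also have "\<dots> = ?a * (lmom 2 x * ?a - ?b * ?b)" by (simp add: power2_eq_square algebra_simps)
  finally show ?thesis using lmom_0_pos[OF x] by (simp add: zero_le_mult_iff)
qed

lemma L2_nonpos: "0 < x \<Longrightarrow> L2 x \<le> 0"
  using lmom_cauchy_schwarz[of x] lmom_0_pos[of x] by (simp add: L2_def)

lemma L1_antimono:
  assumes "0 < x" "x \<le> y"
  shows "L1 y \<le> L1 x"
proof (rule DERIV_nonpos_imp_nonincreasing[OF assms(2)])
  fix t assume "x \<le> t" "t \<le> y"
  then have "0 < t" using assms by simp
  then show "\<exists>e. (L1 has_real_derivative e) (at t) \<and> e \<le> 0" using DERIV_L1 L2_nonpos by blast
qed

lemma L_diff_bounds:
  assumes "0 < x" "x < y"
  shows "L1 y * (y - x) \<le> L y - L x" "L y - L x \<le> L1 x * (y - x)"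
proof -
  obtain z where z: "x < z" "z < y" "L y - L x = (y - x) * L1 z"
    using MVT2[OF assms(2), of L L1] DERIV_L assms(1) by force
  have "L1 y \<le> L1 z" "L1 z \<le> L1 x" using z assms by (auto intro!: L1_antimono)
  then show "L1 y * (y - x) \<le> L y - L x" "L y - L x \<le> L1 x * (y - x)"
    unfolding z(3) using assms by (auto simp: mult.commute intro!: mult_left_mono)
qed

lemma integral_deriv2_L:
  assumes "0 < a" "a \<le> b"
  shows "(LINT t:{a..b}|lebesgue. - (deriv ^^ 2) L t) = L1 a - L1 b"
proof -
  have c: "continuous_on {a..b} (\<lambda>t. - L2 t)"
    by (rule continuous_on_minus[OF continuous_on_L2]) (use assms in auto)
  have "(LINT t:{a..b}|lebesgue. - (deriv ^^ 2) L t) = (LINT t:{a..b}|lebesgue. - L2 t)"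
    using assms by (intro set_lebesgue_integral_cong) (auto simp: deriv2_L)
  also have "\<dots> = integral {a..b} (\<lambda>t. - L2 t)"
    by (rule set_lebesgue_integral_eq_integral(2)[OF absolutely_integrable_continuous_real[OF c]])
  also have "\<dots> = (- L1 b) - (- L1 a)"
  proof (rule integral_unique, rule fundamental_theorem_of_calculus[OF assms(2)])
    fix t assume "t \<in> {a..b}"
    then have "(L1 has_real_derivative L2 t) (at t within {a..b})"
      using assms by (intro has_field_derivative_at_within[OF DERIV_L1]) auto
    then show "((\<lambda>t. - L1 t) has_vector_derivative - L2 t) (at t within {a..b})"
      unfolding has_real_derivative_iff_has_vector_derivative[symmetric] by (rule DERIV_minus)
  qed
  finally show ?thesis by simp
qed

text \<open>The hypothesis makes L1(t) - K/t nondecreasing. If this were positive somewhere, L1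
  would stay above some d > 0 and L would grow with slope at least d; but \<open>mom_ge_tail\<close>
  at radius exp (-d/2) allows only slope d/2. So L1(x) \<le> K/x, and by concavity L increases by at
  most K from x to 2x.\<close>

lemma mom_doubling_of_L2_bound:
  assumes K: "0 \<le> K" and b: "\<And>y. 0 < y \<Longrightarrow> - L2 y * y\<^sup>2 \<le> K" and x: "0 < x"
  shows "mom x \<le> exp K * mom (2 * x)"
proof -
  have L1: "L1 y \<le> K / y" if y: "0 < y" for y
  proof (rule ccontr)
    assume "\<not> L1 y \<le> K / y"
    define d where "d = L1 y - K / y"
    have d: "0 < d" using \<open>\<not> L1 y \<le> K / y\<close> by (simp add: d_def)
    have ge: "d \<le> L1 z" if z: "y \<le> z" for z
    proof -
      have "L1 y - K / y \<le> L1 z - K / z"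
      proof (rule DERIV_nonneg_imp_nondecreasing[OF z])
        fix t assume t: "y \<le> t" "t \<le> z"
        then have t0: "0 < t" using y by simp
        have "((\<lambda>t. L1 t - K / t) has_real_derivative L2 t + K / t\<^sup>2) (at t)"
          using t0 by (auto intro!: derivative_eq_intros DERIV_L1 simp: power2_eq_square)
        moreover have "0 \<le> L2 t + K / t\<^sup>2"
          using b[OF t0] t0 by (simp add: field_simps)
        ultimately show "\<exists>e. ((\<lambda>t. L1 t - K / t) has_real_derivative e) (at t) \<and> 0 \<le> e" by blast
      qed
      moreover have "0 \<le> K / z" using K y z by simp
      ultimately show ?thesis by (simp add: d_def)
    qed
    \<comment> \<open>Then r^Y = exp (-d Y / 2), so that the upper bound for L grows at half the
      rate of the lower one.\<close>
    define r where "r = exp (- d / 2)"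
    have r: "0 < r" "r < 1" using d by (auto simp: r_def)
    define c where "c = - ln (tail r) - L y + d * y"
    have bound: "d * Y / 2 \<le> c" if Y: "y < Y" for Y
    proof -
      have "d * (Y - y) \<le> L1 Y * (Y - y)" using ge[of Y] Y by (intro mult_right_mono) auto
      also have "\<dots> \<le> L Y - L y" using y Y by (rule L_diff_bounds)
      finally have 1: "d * (Y - y) \<le> L Y - L y" .
      have "r powr Y * tail r \<le> mom Y" using Y y r by (intro mom_ge_tail) auto
      moreover have "0 < r powr Y * tail r" using r tail_pos[of r] by simp
      ultimately have "ln (r powr Y * tail r) \<le> ln (mom Y)" by (intro ln_mono)
      moreover have "ln (r powr Y * tail r) = - d / 2 * Y + ln (tail r)"
        using r tail_pos[of r] by (simp add: ln_mult ln_powr r_def)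
      ultimately have "L Y \<le> d / 2 * Y - ln (tail r)" by (simp add: L_def)
      with 1 show ?thesis by (simp add: c_def algebra_simps)
    qed
    \<comment> \<open>A value of Y beyond y for which d Y / 2 \<ge> c + 1.\<close>
    have "d * max (y + 1) (2 * (c + 1) / d) / 2 \<le> c" by (rule bound) simp
    moreover have "d * (2 * (c + 1) / d) / 2 \<le> d * max (y + 1) (2 * (c + 1) / d) / 2"
      using d by (intro divide_right_mono mult_left_mono) auto
    ultimately show False using d by simp
  qed
  have "L (2 * x) - L x \<le> L1 x * (2 * x - x)" using x by (intro L_diff_bounds) auto
  also have "\<dots> \<le> K / x * (2 * x - x)" using L1[OF x] x by (intro mult_right_mono) auto
  also have "\<dots> = K" using x by simp
  finally have "ln (mom x) \<le> K + ln (mom (2 * x))" by (simp add: L_def)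
  then have "exp (ln (mom x)) \<le> exp (K + ln (mom (2 * x)))" by simp
  then show ?thesis using x mom_pos[of x] mom_pos[of "2 * x"] by (simp add: exp_add)
qed

text \<open>Logarithms turn \<open>A\<close> into an upper bound for the Jensen gap L(2x) - L(px)/p
  - L(p'x)/p'. Concavity bounds this gap below by q x times the drop of L1 from m x to 2x, and the
  drop is the integral of -L'' in the hypothesis. Hence -L''(y) y^2 is bounded and
  \<open>mom_doubling_of_L2_bound\<close> applies.\<close>

lemma mom_doubling_of_convexity_condition:
  assumes p: "1 < p" "p < 2" "1 / p + 1 / p' = 1"
    and A: "\<And>x. 0 \<le> x \<Longrightarrow> mom (p * x) powr (1 / p) * mom (p' * x) powr (1 / p') \<le> C1 * mom (2 * x)"
    and C: "0 < C1" "0 < C2"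
    and B: "\<And>y. 0 \<le> y \<Longrightarrow> \<exists>x\<ge>0. - (deriv ^^ 2) L y * y\<^sup>2 \<le>
        C2 * x * (LINT t:{(2 + p) / 2 * x..2 * x}|lebesgue. - (deriv ^^ 2) L t)"
  shows "\<exists>C. \<forall>x>0. mom x \<le> C * mom (2 * x)"
proof -
  have p': "p' = p / (p - 1)" and p'2: "2 < p'"
  proof -
    have "1 / p' = (p - 1) / p" using p by (simp add: field_simps)
    moreover have "p' = 1 / (1 / p')" by simp
    ultimately show e: "p' = p / (p - 1)" by simp
    have "2 < p / (p - 1)" using p by (subst pos_less_divide_eq) auto
    then show "2 < p'" using e by simp
  qed
  \<comment> \<open>The midpoint m of p and 2 splits [px, 2x] into two intervals of length (2-p)x/2;
    dividing by p gives q x on each. The interval [2x, p'x] has length p' times (2-p)x/p, that is,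
    it contributes 2 q x after division by p'.\<close>
  define q where "q = (2 - p) / (2 * p)"
  have q: "0 < q" using p by (simp add: q_def)
  define m where "m = (2 + p) / 2"
  have gap: "q * (x * (L1 (m * x) - L1 (2 * x))) \<le> ln C1" if x: "0 < x" for x
  proof -
    have pos: "0 < mom (p * x)" "0 < mom (p' * x)" "0 < mom (2 * x)" using x p p'2 by (auto intro!: mom_pos)
    have "ln (mom (p * x) powr (1 / p) * mom (p' * x) powr (1 / p')) \<le> ln (C1 * mom (2 * x))"
      using A[of x] x pos by (intro ln_mono) auto
    then have 1: "L (2 * x) - L (p * x) / p - L (p' * x) / p' \<le> ln C1"
      using pos C by (simp add: L_def ln_mult ln_powr)
    \<comment> \<open>L1 is nonincreasing: to the right of 2x the slope is at most L1(2x), on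
      [mx, 2x] at least L1(2x), on [px, mx] at least L1(mx). In the combination one of the two terms
      q x L1(2x) on the right cancels the one from [mx, 2x].\<close>
    have a: "L (p' * x) - L (2 * x) \<le> L1 (2 * x) * (p' * x - 2 * x)"
      using x p'2 by (intro L_diff_bounds) auto
    have b: "L1 (2 * x) * (2 * x - m * x) \<le> L (2 * x) - L (m * x)"
      using x p by (intro L_diff_bounds) (auto simp: m_def)
    have c: "L1 (m * x) * (m * x - p * x) \<le> L (m * x) - L (p * x)"
      using x p by (intro L_diff_bounds) (auto simp: m_def)
    have e: "2 * x - m * x = (2 - p) / 2 * x" "m * x - p * x = (2 - p) / 2 * x" by (auto simp: m_def field_simps)
    have "(L1 (2 * x) + L1 (m * x)) * ((2 - p) / 2 * x) \<le> L (2 * x) - L (p * x)"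
      using b c unfolding e distrib_right by linarith
    then have b': "(L1 (2 * x) + L1 (m * x)) * ((2 - p) / 2 * x) / p \<le> (L (2 * x) - L (p * x)) / p"
      using p by (intro divide_right_mono) auto
    have a': "(L (p' * x) - L (2 * x)) / p' \<le> L1 (2 * x) * (p' * x - 2 * x) / p'"
      using a p'2 by (intro divide_right_mono) auto
    have f: "L1 (2 * x) * (p' * x - 2 * x) / p' = L1 (2 * x) * ((2 - p) / p * x)"
      using p by (simp add: p' field_simps)
    have "L (2 * x) - L (p * x) / p - L (p' * x) / p' = L (2 * x) * (1 / p + 1 / p') - L (p * x) / p - L (p' * x) / p'"
      using p by simp
    also have "\<dots> = (L (2 * x) - L (p * x)) / p - (L (p' * x) - L (2 * x)) / p'"
      by (simp add: algebra_simps diff_divide_distrib)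
    finally have "(L1 (2 * x) + L1 (m * x)) * ((2 - p) / 2 * x) / p - L1 (2 * x) * ((2 - p) / p * x) \<le> ln C1"
      using 1 a' b' unfolding f by linarith
    moreover have "(L1 (2 * x) + L1 (m * x)) * ((2 - p) / 2 * x) / p - L1 (2 * x) * ((2 - p) / p * x) = q * (x * (L1 (m * x) - L1 (2 * x)))"
      using p by (simp add: q_def field_simps)
    ultimately show ?thesis by simp
  qed
  \<comment> \<open>The maximum yields K \<ge> 0 without a lower bound for C1.\<close>
  define K where "K = C2 * max 0 (ln C1 / q)"
  have K: "0 \<le> K" using C by (simp add: K_def)
  have "- L2 y * y\<^sup>2 \<le> K" if y: "0 < y" for y
  proof -
    obtain x where x: "0 \<le> x" and h0: "- (deriv ^^ 2) L y * y\<^sup>2 \<le> C2 * x * (LINT t:{(2 + p) / 2 * x..2 * x}|lebesgue. - (deriv ^^ 2) L t)"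
      using B[of y] y by auto
    have h: "- L2 y * y\<^sup>2 \<le> C2 * x * (LINT t:{m * x..2 * x}|lebesgue. - (deriv ^^ 2) L t)"
      using h0 unfolding deriv2_L[OF y] m_def .
    show ?thesis
    \<comment> \<open>For x = 0 the factor x makes the right-hand side 0; otherwise the left end
      point is positive, as \<open>integral_deriv2_L\<close> requires.\<close>
    proof (cases "x = 0")
      case True
      with h K show ?thesis by simp
    next
      case False
      with x have x: "0 < x" by simp
      have "(LINT t:{m * x..2 * x}|lebesgue. - (deriv ^^ 2) L t) = L1 (m * x) - L1 (2 * x)"
        using x p by (intro integral_deriv2_L) (auto simp: m_def)
      with h have "- L2 y * y\<^sup>2 \<le> C2 * (x * (L1 (m * x) - L1 (2 * x)))" by (simp add: mult.assoc)
      also have "\<dots> \<le> C2 * max 0 (ln C1 / q)"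
      proof (intro mult_left_mono)
        have "x * (L1 (m * x) - L1 (2 * x)) \<le> ln C1 / q"
          using gap[OF x] q by (simp add: pos_le_divide_eq mult.commute)
        then show "x * (L1 (m * x) - L1 (2 * x)) \<le> max 0 (ln C1 / q)" by simp
      qed (use C in simp)
      finally show ?thesis by (simp add: K_def)
    qed
  qed
  then have "mom x \<le> exp K * mom (2 * x)" if "0 < x" for x
    using that by (intro mom_doubling_of_L2_bound K)
  then show ?thesis by blast
qed

section \<open>The Bergman kernel as a convolution operator\<close>

definition coef :: "nat \<Rightarrow> real" where "coef n = 1 / (2 * mom (2 * real n + 1))"

definition kern :: "complex \<Rightarrow> complex" where "kern x = (\<Sum>n. of_real (coef n) * x ^ n)"

definition incr :: "nat \<Rightarrow> real" where "incr n = (if n = 0 then coef 0 else coef n - coef (n - 1))"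

text \<open>By \<open>incr_sum_eq\<close> this is (1-r) times the kernel at r; it is also the total
  weight of the positive combination of Cauchy transforms.\<close>

definition incr_sum :: "real \<Rightarrow> real" where "incr_sum r = (\<Sum>n. incr n * r ^ n)"

lemma coef_pos: "0 < coef n"
  by (simp add: coef_def mom_pos)

lemma incr_nonneg: "0 \<le> incr n"
  using coef_pos[of 0] mom_pos[of "2 * real n + 1"]
  by (cases n) (auto simp: incr_def coef_def intro!: divide_left_mono mom_antimono mult_pos_pos mom_pos)

lemma incr_le: "incr n \<le> coef n"
  using coef_pos[of "n - 1"] by (simp add: incr_def)

text \<open>The parameter t is free: t close to 1 gives convergence of the kernel in the whole disc,
  and a choice depending on r gives the sharp growth in \<open>incr_sum_le_tail\<close>.\<close>

lemma coef_le:
  assumes "0 < t" "t < 1"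
  shows "coef n \<le> 1 / (2 * (t * tail t)) * (1 / t\<^sup>2) ^ n"
proof -
  have t: "0 < tail t" using assms by (intro tail_pos) auto
  have "t powr (2 * real n + 1) * tail t \<le> mom (2 * real n + 1)" using assms by (intro mom_ge_tail) auto
  moreover have "t powr (2 * real n + 1) = t * (t\<^sup>2) ^ n"
    using assms by (simp add: powr_add powr_realpow mult.commute flip: power_mult)
      (metis mult.commute of_nat_mult of_nat_numeral powr_realpow)
  ultimately have "t * (t\<^sup>2) ^ n * tail t \<le> mom (2 * real n + 1)" by simp
  then have "coef n \<le> 1 / (2 * (t * (t\<^sup>2) ^ n * tail t))"
    unfolding coef_def using assms t mom_pos[of "2 * real n + 1"] by (intro divide_left_mono) auto
  also have "\<dots> = 1 / (2 * (t * tail t)) * (1 / t\<^sup>2) ^ n"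
    by (simp add: power_one_over field_simps)
  finally show ?thesis .
qed

lemma coef_summable:
  assumes "0 \<le> r" "r < 1"
  shows "summable (\<lambda>n. coef n * r ^ n)"
proof -
  \<comment> \<open>Here t^2 lies strictly between r and 1, so \<open>coef_le\<close> leaves a
    convergent geometric series of ratio r/t^2.\<close>
  define t where "t = sqrt ((1 + r) / 2)"
  have t: "0 < t" "t < 1" "t\<^sup>2 = (1 + r) / 2" using assms by (auto simp: t_def)
  have "summable (\<lambda>n. 1 / (2 * (t * tail t)) * (r / t\<^sup>2) ^ n)"
    using assms t by (intro summable_mult summable_geometric) (auto simp: field_simps)
  moreover have "norm (coef n * r ^ n) \<le> 1 / (2 * (t * tail t)) * (r / t\<^sup>2) ^ n" for n
  proof -
    have "coef n * r ^ n \<le> 1 / (2 * (t * tail t)) * (1 / t\<^sup>2) ^ n * r ^ n"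
      using assms by (intro mult_right_mono coef_le t) auto
    then show ?thesis using coef_pos[of n] assms by (simp add: abs_mult power_divide)
  qed
  ultimately show ?thesis by (rule summable_comparison_test'[where N = 0])
qed

lemma incr_summable:
  assumes "0 \<le> r" "r < 1"
  shows "summable (\<lambda>n. incr n * r ^ n)"
  by (rule summable_comparison_test'[OF coef_summable[OF assms], where N = 0])
    (use incr_nonneg incr_le assms in \<open>auto simp: abs_mult intro!: mult_right_mono\<close>)

lemma coef_summable_complex:
  assumes "cmod x < 1"
  shows "summable (\<lambda>n. of_real (coef n) * x ^ n)" "summable (\<lambda>n. norm (of_real (coef n) * x ^ n))"
proof -
  show "summable (\<lambda>n. norm (of_real (coef n) * x ^ n))"
    using coef_summable[of "cmod x"] assms coef_pos by (simp add: norm_mult norm_power less_imp_le)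
  then show "summable (\<lambda>n. of_real (coef n) * x ^ n)" by (rule summable_norm_cancel)
qed

lemma incr_summable_complex:
  assumes "cmod x < 1"
  shows "summable (\<lambda>n. of_real (incr n) * x ^ n)" "summable (\<lambda>n. norm (of_real (incr n) * x ^ n))"
proof -
  show "summable (\<lambda>n. norm (of_real (incr n) * x ^ n))"
    using incr_summable[of "cmod x"] assms incr_nonneg by (simp add: norm_mult norm_power)
  then show "summable (\<lambda>n. of_real (incr n) * x ^ n)" by (rule summable_norm_cancel)
qed

text \<open>Stated for a general field because it serves both the complex kernel and its real
  majorant.\<close>

lemma abel_summation:
  fixes x :: "'a :: {real_normed_field, banach}"
  assumes "summable (\<lambda>n. of_real (coef n) * x ^ n)"
  shows "(\<lambda>n. of_real (incr n) * x ^ n) sums ((1 - x) * (\<Sum>n. of_real (coef n) * x ^ n))"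
proof -
  let ?s = "\<Sum>n. of_real (coef n) * x ^ n"
  have 1: "(\<lambda>n. of_real (coef n) * x ^ n) sums ?s" using assms by (rule summable_sums)
  have "(\<lambda>n. x * (of_real (coef n) * x ^ n)) sums (x * ?s)" by (rule sums_mult[OF 1])
  then have "(\<lambda>n. (if n = 0 then 0 else x * (of_real (coef (n - 1)) * x ^ (n - 1)))) sums (x * ?s)"
    using sums_Suc[of "\<lambda>n. (if n = 0 then 0 else x * (of_real (coef (n - 1)) * x ^ (n - 1)))" "x * ?s"] by simp
  from sums_diff[OF 1 this] have "(\<lambda>n. of_real (coef n) * x ^ n - (if n = 0 then 0 else x * (of_real (coef (n - 1)) * x ^ (n - 1)))) sums (?s - x * ?s)" .
  moreover have "of_real (coef n) * x ^ n - (if n = 0 then 0 else x * (of_real (coef (n - 1)) * x ^ (n - 1))) = of_real (incr n) * x ^ n" for n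
    by (cases n) (auto simp: incr_def algebra_simps)
  ultimately show ?thesis by (simp add: algebra_simps)
qed

lemma kern_eq:
  assumes "cmod x < 1"
  shows "kern x = (\<Sum>n. of_real (incr n) * x ^ n) / (1 - x)"
proof -
  have "1 - x \<noteq> 0" using assms by auto
  then show ?thesis
    unfolding kern_def sums_unique[OF abel_summation[OF coef_summable_complex(1)[OF assms]], symmetric] by simp
qed

lemma incr_sum_eq:
  assumes "0 \<le> r" "r < 1"
  shows "incr_sum r = (1 - r) * (\<Sum>n. coef n * r ^ n)"
  using sums_unique[OF abel_summation[of r]] coef_summable[OF assms] by (simp add: incr_sum_def)

lemma incr_sum_pos:
  assumes "0 \<le> r" "r < 1"
  shows "0 < incr_sum r"
proof -
  have "(\<Sum>n<1. incr n * r ^ n) \<le> incr_sum r"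
    unfolding incr_sum_def using assms incr_nonneg by (intro sum_le_suminf incr_summable) auto
  moreover have "(\<Sum>n<1. incr n * r ^ n) = coef 0" by (simp add: incr_def)
  ultimately show ?thesis using coef_pos[of 0] by linarith
qed

lemma incr_sum_mono:
  assumes "0 \<le> r" "r \<le> s" "s < 1"
  shows "incr_sum r \<le> incr_sum s"
  unfolding incr_sum_def using assms incr_nonneg
  by (intro suminf_le incr_summable mult_left_mono power_mono) auto

text \<open>With t the fourth root of r, \<open>coef_le\<close> gives a geometric series of ratio
  t^2, whose sum 1/(1-t^2) is cancelled by 1 - r = (1-t^2)(1+t^2). What remains is of order
  1/\<open>tail t\<close>. Passing from r to t takes two square roots, and each costs one doubling
  since sqrt r \<le> (1+r)/2.\<close>

lemma incr_sum_le_tail: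
  assumes D: "1 \<le> D" "\<And>r. 0 \<le> r \<Longrightarrow> r < 1 \<Longrightarrow> tail r \<le> D * tail ((1 + r) / 2)"
  shows "\<exists>C>0. \<forall>r. 0 \<le> r \<longrightarrow> r < 1 \<longrightarrow> incr_sum r \<le> C / tail r"
proof -
  have sq: "tail r \<le> D * tail (sqrt r)" if r: "0 \<le> r" "r < 1" for r
  proof -
    have "sqrt r \<le> (1 + r) / 2"
      using arith_geo_mean_sqrt[of 1 r] r by simp
    then have "D * tail ((1 + r) / 2) \<le> D * tail (sqrt r)" using D by (intro mult_left_mono tail_antimono) auto
    with D(2)[OF r] show ?thesis by linarith
  qed
  \<comment> \<open>The threshold is the fourth power of 1/2, so that t \<ge> 1/2.\<close>
  have big: "incr_sum r \<le> 2 * D\<^sup>2 / tail r" if r: "1 / 16 \<le> r" "r < 1" for r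
  proof -
    define t where "t = sqrt (sqrt r)"
    have r0: "0 < r" using r by simp
    have t: "0 < t" "t < 1" using r by (auto simp: t_def)
    have t4: "t\<^sup>2 * t\<^sup>2 = r" using r0 by (simp add: t_def)
    have "sqrt (sqrt (1 / 16)) \<le> t" unfolding t_def using r by (intro real_sqrt_le_mono)
    moreover have "sqrt (sqrt (1 / 16)) = 1 / (2::real)"
    proof -
      have 4: "sqrt (1 / 16) = (1 / 4 :: real)" by (rule real_sqrt_unique) (auto simp: power2_eq_square)
      have 2: "sqrt (1 / 4) = (1 / 2 :: real)" by (rule real_sqrt_unique) (auto simp: power2_eq_square)
      show ?thesis unfolding 4 2 ..
    qed
    ultimately have t2: "1 / 2 \<le> t" by simp
    have tt: "0 < tail t" "0 < tail r" using t r by (auto intro!: tail_pos)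
    have t1: "t\<^sup>2 < 1" using t by (simp add: power_less_one_iff)
    have "(\<Sum>n. coef n * r ^ n) \<le> (\<Sum>n. 1 / (2 * (t * tail t)) * (t\<^sup>2) ^ n)"
    proof (rule suminf_le)
      fix n
      have "coef n * r ^ n \<le> 1 / (2 * (t * tail t)) * (1 / t\<^sup>2) ^ n * r ^ n"
        using r0 by (intro mult_right_mono coef_le t) auto
      also have "\<dots> = 1 / (2 * (t * tail t)) * (t\<^sup>2) ^ n"
        unfolding t4[symmetric] power_mult_distrib using t by (simp add: power_one_over)
      finally show "coef n * r ^ n \<le> 1 / (2 * (t * tail t)) * (t\<^sup>2) ^ n" .
    next
      show "summable (\<lambda>n. coef n * r ^ n)" using r by (intro coef_summable) auto
      show "summable (\<lambda>n. 1 / (2 * (t * tail t)) * (t\<^sup>2) ^ n)" using t1 by (intro summable_mult summable_geometric) auto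
    qed
    also have "\<dots> = 1 / (2 * (t * tail t)) * (1 / (1 - t\<^sup>2))"
      using t1 by (subst suminf_mult) (auto simp: suminf_geometric intro!: summable_geometric)
    finally have sumle: "(\<Sum>n. coef n * r ^ n) \<le> 1 / (2 * (t * tail t)) * (1 / (1 - t\<^sup>2))" .
    have "incr_sum r = (1 - r) * (\<Sum>n. coef n * r ^ n)" using r by (intro incr_sum_eq) auto
    also have "\<dots> \<le> (1 - r) * (1 / (2 * (t * tail t)) * (1 / (1 - t\<^sup>2)))"
      using r by (intro mult_left_mono[OF sumle]) auto
    also have "1 - r = (1 - t\<^sup>2) * (1 + t\<^sup>2)" unfolding t4[symmetric] by (simp add: algebra_simps)
    also have "(1 - t\<^sup>2) * (1 + t\<^sup>2) * (1 / (2 * (t * tail t)) * (1 / (1 - t\<^sup>2))) = (1 + t\<^sup>2) / 2 * (1 / (t * tail t))"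
      using t1 by simp
    also have "\<dots> \<le> 1 * (1 / (t * tail t))" using t1 t tt by (intro mult_right_mono) auto
    also have "\<dots> \<le> 1 / (1 / 2 * (tail r / D\<^sup>2))"
    proof -
      have "tail r \<le> D * tail (sqrt r)" using sq r by auto
      also have "\<dots> \<le> D * (D * tail t)" unfolding t_def using D r by (intro mult_left_mono sq) auto
      finally have "tail r / D\<^sup>2 \<le> tail t" using D by (simp add: power2_eq_square divide_le_eq mult_ac)
      then have "1 / 2 * (tail r / D\<^sup>2) \<le> t * tail t" using t2 tt D by (intro mult_mono) auto
      then show ?thesis using tt t D by (simp only: mult_1) (intro divide_left_mono mult_pos_pos divide_pos_pos; simp)
    qed
    also have "\<dots> = 2 * D\<^sup>2 / tail r" using D by simp
    finally show ?thesis .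
  qed
  \<comment> \<open>Below 1/16 monotonicity of \<open>incr_sum\<close> reduces to the value at 1/16;
    the quotient of tails makes the bound fit under C / \<open>tail r\<close>.\<close>
  define C where "C = 2 * D\<^sup>2 * (tail 0 / tail (1 / 16))"
  have t0: "0 < tail 0" "0 < tail (1 / 16)" "tail (1 / 16) \<le> tail 0" by (auto intro: tail_pos tail_antimono)
  have C: "0 < C" using t0 D by (simp add: C_def)
  have "incr_sum r \<le> C / tail r" if r: "0 \<le> r" "r < 1" for r
  proof (cases "1 / 16 \<le> r")
    case True
    have "2 * D\<^sup>2 * 1 \<le> C" unfolding C_def using t0 D by (intro mult_left_mono) auto
    then have "2 * D\<^sup>2 / tail r \<le> C / tail r" using tail_pos[OF r] by (intro divide_right_mono) auto
    then show ?thesis using big[OF True r(2)] by linarith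
  next
    case False
    have "incr_sum r \<le> incr_sum (1 / 16)" using False r by (intro incr_sum_mono) auto
    also have "\<dots> \<le> 2 * D\<^sup>2 / tail (1 / 16)" by (rule big) auto
    also have "\<dots> = C / tail 0" using t0 by (simp add: C_def)
    also have "\<dots> \<le> C / tail r" using C t0 tail_pos[OF r] r tail_antimono[of 0 r] by (intro divide_left_mono) auto
    finally show ?thesis .
  qed
  with C show ?thesis by blast
qed

section \<open>Convolution with the kernel on circles\<close>

lemma measurable_kern [measurable]: "kern \<in> borel_measurable borel"
  unfolding kern_def by measurable

lemma kern_bound:
  assumes "cmod x \<le> r" "r < 1"
  shows "cmod (kern x) \<le> (\<Sum>n. coef n * r ^ n)"
proof -
  have r: "0 \<le> r" using assms(1) norm_ge_zero order_trans by blast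
  have x: "cmod x < 1" using assms by simp
  have "cmod (kern x) \<le> (\<Sum>n. norm (of_real (coef n) * x ^ n))"
    unfolding kern_def by (rule summable_norm[OF coef_summable_complex(2)[OF x]])
  also have "\<dots> \<le> (\<Sum>n. coef n * r ^ n)"
    using assms coef_pos r by (intro suminf_le coef_summable_complex(2) x coef_summable)
      (auto simp: norm_mult norm_power less_imp_le intro!: mult_left_mono power_mono)
  finally show ?thesis .
qed

definition conv :: "(real \<Rightarrow> complex) \<Rightarrow> complex \<Rightarrow> complex" where
  "conv f x = (\<integral>s. f s * kern (x * cnj (circ s)) \<partial>unif)"

text \<open>By \<open>kern_eq\<close>, the operator is the sum over \<open>n\<close> of \<open>incr n * x ^ n\<close> times the Cauchy transform of
  \<open>f\<close> multiplied by the \<open>n\<close>-th power of \<open>cnj circ\<close>, a unimodular factor.\<close>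
lemma conv_bound:
  assumes p: "1 < p" "p < 2"
  shows "\<exists>C>0. \<forall>f x. f \<in> borel_measurable borel \<longrightarrow> cmod x < 1 \<longrightarrow>
    (pow_int unif p (\<lambda>t. conv f (x * circ t)))
      \<le> ennreal (C * incr_sum (cmod x) powr p) * (pow_int unif p f)"
proof -
  obtain C where C: "0 < C" and R: "\<And>f x. f \<in> borel_measurable borel \<Longrightarrow> integrable unif f \<Longrightarrow> cmod x < 1 \<Longrightarrow>
    (pow_int unif p (\<lambda>t. cauchy f (x * circ t)))
      \<le> ennreal C * (pow_int unif p f)"
    using riesz_cauchy[OF p] by metis
  define D where "D = 2 powr p * C"
  have D: "0 < D" using C by (simp add: D_def)
  show ?thesis
  proof (rule exI[of _ D], intro conjI D allI impI)
    fix f :: "real \<Rightarrow> complex" and x :: complex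
    assume [measurable]: "f \<in> borel_measurable borel" and x: "cmod x < 1"
    interpret U: finite_measure unif by (rule finite_measure_unif)
    let ?X = "pow_int unif p f"
    let ?k = "incr_sum (cmod x)"
    have k: "0 < ?k" using x by (intro incr_sum_pos) auto
    show "(pow_int unif p (\<lambda>t. conv f (x * circ t))) \<le> ennreal (D * ?k powr p) * ?X"
    proof (cases "?X = \<infinity>")
      case True
      then show ?thesis using k D by (simp add: ennreal_mult_top)
    next
      case False
      have fi: "integrable unif f"
        using False p by (intro U.integrable_of_pow_int) auto
      \<comment> \<open>Modulation does not change |f|, so \<open>R\<close> bounds the Cauchy
        transforms of all g n by the same quantity.\<close>
      define g where "g n s = f s * cnj (circ s) ^ n" for n s
      let ?c = "\<lambda>n t. cauchy (g n) (x * circ t)"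
      let ?e = "\<lambda>z n. of_real (incr n) * z ^ n * cauchy (g n) z"
      have gm[measurable]: "g n \<in> borel_measurable borel" for n unfolding g_def by measurable
      have ng: "cmod (g n s) = cmod (f s)" for n s by (simp add: g_def norm_mult norm_power)
      have gi: "integrable unif (g n)" for n
        by (rule Bochner_Integration.integrable_bound[OF fi]) (auto simp: ng)
      have xc: "cmod (x * circ t) < 1" for t using x by (simp add: norm_mult)
      have expand: "(\<lambda>n. ?e z n) sums conv f z"
        and nsum: "summable (\<lambda>n. norm (?e z n))" if z: "cmod z < 1" for z
      proof -
        let ?u = "\<lambda>n s. of_real (incr n) * z ^ n * (g n s / (1 - z * cnj (circ s)))"
        have i: "integrable unif (?u n)" for n
          by (rule integrable_mult_right) (rule integrable_cauchy_kernel[OF gi z])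
        have nu: "norm (?u n s) = incr n * cmod z ^ n * cmod (f s / (1 - z * cnj (circ s)))" for n s
          using incr_nonneg by (simp add: norm_mult norm_power norm_divide ng)
        have s0: "summable (\<lambda>n. incr n * cmod z ^ n * c)" for c
          using z by (intro summable_mult2 incr_summable) auto
        have s1: "summable (\<lambda>n. \<integral>s. norm (?u n s) \<partial>unif)"
          unfolding nu integral_mult_right_zero by (rule s0)
        have "(\<lambda>n. \<integral>s. ?u n s \<partial>unif) sums (\<integral>s. (\<Sum>n. ?u n s) \<partial>unif)"
          by (rule sums_integral[OF i _ s1]) (unfold nu, intro AE_I2 s0)
        moreover have "(\<integral>s. ?u n s \<partial>unif) = ?e z n" for n
          unfolding cauchy_def by (rule integral_mult_right_zero)
        moreover have "(\<Sum>n. ?u n s) = f s * kern (z * cnj (circ s))" for s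
        proof -
          have zc: "cmod (z * cnj (circ s)) < 1" using z by (simp add: norm_mult)
          have "?u n s = of_real (incr n) * (z * cnj (circ s)) ^ n * (f s / (1 - z * cnj (circ s)))" for n
            by (simp add: g_def power_mult_distrib)
          then have "(\<Sum>n. ?u n s) = (\<Sum>n. of_real (incr n) * (z * cnj (circ s)) ^ n * (f s / (1 - z * cnj (circ s))))"
            by (simp only:)
          also have "\<dots> = (\<Sum>n. of_real (incr n) * (z * cnj (circ s)) ^ n) * (f s / (1 - z * cnj (circ s)))"
            by (rule suminf_mult2[symmetric, OF incr_summable_complex(1)[OF zc]])
          finally show ?thesis by (simp add: kern_eq[OF zc])
        qed
        ultimately show "(\<lambda>n. ?e z n) sums conv f z"
          unfolding conv_def by simp
        show "summable (\<lambda>n. norm (?e z n))"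
        proof (rule summable_comparison_test'[OF s1, where N = 0])
          fix n
          have "(\<integral>s. ?u n s \<partial>unif) = ?e z n"
            unfolding cauchy_def by (rule integral_mult_right_zero)
          then have "norm (?e z n) \<le> (\<integral>s. norm (?u n s) \<partial>unif)"
            using integral_norm_bound[of unif "?u n"] by (simp only:)
          then show "norm (norm (?e z n)) \<le> (\<integral>s. norm (?u n s) \<partial>unif)"
            by (simp only: real_norm_def abs_norm_cancel)
        qed
      qed
      let ?w = "\<lambda>n. incr n * cmod x ^ n"
      have w0: "0 \<le> ?w n" for n using incr_nonneg by simp
      have wsum: "(\<Sum>n. ennreal (?w n)) = ennreal ?k"
        unfolding incr_sum_def using x by (intro suminf_ennreal2 w0 incr_summable) auto
      have [measurable]: "(?c n) \<in> borel_measurable borel" for n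
        by (intro borel_measurable_continuous_onI mean_value_circle(2)[OF holomorphic_cauchy[OF gi] x])
      have "(pow_int unif p (\<lambda>t. conv f (x * circ t)))
        \<le> (\<integral>\<^sup>+t. ennreal (2 powr p * ?k powr (p - 1)) * (\<Sum>n. ennreal (?w n) * ennreal (cmod (?c n t) powr p)) \<partial>unif)"
      proof (rule nn_integral_mono)
        fix t
        let ?y = "\<lambda>n. of_real (incr n) * (x * circ t) ^ n * ?c n t"
        have yn: "cmod (?y n) = ?w n * cmod (?c n t)" for n
          using incr_nonneg by (simp add: norm_mult norm_power)
        \<comment> \<open>Writing the series as an integral for the counting measure makes
          \<open>crude_hoelder\<close> available, with the weights
          \<open>incr n * cmod x ^ n\<close> of total mass \<open>incr_sum (cmod x)\<close>. Hoelder
          contributes the power p - 1 of this mass and the final sum one more factor.\<close>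
        have "conv f (x * circ t) = (\<integral>n. ?y n \<partial>count_space UNIV)"
          using sums_unique[OF expand[OF xc]] nsum[OF xc]
          by (simp add: integral_count_space_nat integrable_count_space_nat_iff)
        then have "ennreal (cmod (conv f (x * circ t)) powr p) = ennreal (cmod (\<integral>n. ?y n \<partial>count_space UNIV) powr p)" by simp
        also have "\<dots> \<le> ennreal (2 powr p * ?k powr (p - 1)) * (\<integral>\<^sup>+n. ennreal (cmod (?y n) powr p * ?w n powr (1 - p)) \<partial>count_space UNIV)"
        proof (rule crude_hoelder)
          \<comment> \<open>Weights may vanish, for instance for n > 0 at x = 0; the corresponding
            terms vanish too, which is the second alternative allowed by
            \<open>crude_hoelder\<close>.\<close>
          show "AE n in count_space UNIV. 0 < ?w n \<or> (0 \<le> ?w n \<and> ?y n = 0)"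
          proof (intro AE_I2)
            fix n
            show "0 < ?w n \<or> (0 \<le> ?w n \<and> ?y n = 0)"
            proof (cases "?w n = 0")
              case True
              then have "cmod (?y n) = 0" unfolding yn by simp
              then show ?thesis using True by (simp only: norm_eq_zero) simp
            next
              case False
              then have "0 < ?w n" using w0[of n] by linarith
              then show ?thesis by simp
            qed
          qed
        qed (use k p wsum in \<open>auto simp: nn_integral_count_space_nat\<close>)
        also have "(\<lambda>n. cmod (?y n) powr p * ?w n powr (1 - p)) = (\<lambda>n. ?w n * cmod (?c n t) powr p)"
        proof
          fix n
          show "cmod (?y n) powr p * ?w n powr (1 - p) = ?w n * cmod (?c n t) powr p"
          proof (cases "?w n = 0")
            case True show ?thesis unfolding yn True by simp
          next
            case False
            then have "0 < ?w n" using w0[of n] by linarith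
            then have "?w n powr p * ?w n powr (1 - p) = ?w n" by (simp flip: powr_add)
            then show ?thesis unfolding yn using w0[of n] by (simp add: powr_mult mult_ac)
          qed
        qed
        also have "(\<integral>\<^sup>+n. ennreal (?w n * cmod (?c n t) powr p) \<partial>count_space UNIV)
          = (\<Sum>n. ennreal (?w n) * ennreal (cmod (?c n t) powr p))"
          unfolding nn_integral_count_space_nat by (intro suminf_cong ennreal_mult w0) simp
        finally show "ennreal (cmod (conv f (x * circ t)) powr p) \<le> ennreal (2 powr p * ?k powr (p - 1)) * (\<Sum>n. ennreal (?w n) * ennreal (cmod (?c n t) powr p))" .
      qed
      also have "\<dots> = ennreal (2 powr p * ?k powr (p - 1)) * (\<Sum>n. ennreal (?w n) * (pow_int unif p (?c n)))"
        by (simp add: nn_integral_cmult nn_integral_suminf)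
      also have "\<dots> \<le> ennreal (2 powr p * ?k powr (p - 1)) * (\<Sum>n. ennreal (?w n) * (ennreal C * ?X))"
      proof (intro mult_left_mono suminf_le)
        fix n
        have "(pow_int unif p (?c n)) \<le> ennreal C * ?X"
          using R[OF gm gi x, of n] by (simp add: ng)
        then show "(pow_int unif p (?c n)) \<le> ennreal C * ?X" .
      qed auto
      also have "\<dots> = ennreal (2 powr p * ?k powr (p - 1)) * (ennreal ?k * (ennreal C * ?X))"
        by (simp only: ennreal_suminf_multc wsum)
      also have "\<dots> = ennreal (2 powr p * ?k powr (p - 1) * ?k * C) * ?X"
        using k C by (simp add: ennreal_mult mult_ac)
      also have "2 powr p * ?k powr (p - 1) * ?k * C = D * ?k powr p"
      proof -
        have "?k powr (p - 1) * ?k = ?k powr (p - 1) * ?k powr 1" using k by simp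
        also have "\<dots> = ?k powr p" unfolding powr_add[symmetric] by simp
        finally show ?thesis by (simp add: D_def mult_ac)
      qed
      finally show ?thesis .
    qed
  qed
qed

end

lemma ex_dyadic:
  fixes x :: real
  assumes "1 \<le> x"
  shows "\<exists>k. 2 ^ k \<le> x \<and> x < 2 ^ Suc k"
proof -
  obtain n where n: "x < 2 ^ n" using real_arch_pow[of 2 x] by auto
  define m where "m = (LEAST n. x < 2 ^ n)"
  have m: "x < 2 ^ m" unfolding m_def using n by (rule LeastI)
  then have "m \<noteq> 0" using assms by (cases m) auto
  then obtain k where k: "m = Suc k" by (cases m) auto
  then have "\<not> x < 2 ^ k" using not_less_Least[of k "\<lambda>n. x < 2 ^ n"] by (simp add: m_def)
  with m k show ?thesis by (auto simp: not_less)
qed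

context radial_profile begin

section \<open>Schur test and boundedness\<close>

lemma measurable_tail [measurable]: "tail \<in> borel_measurable borel"
proof -
  have "(\<lambda>r. - tail r) \<in> borel_measurable borel"
    by (rule borel_measurable_mono) (simp add: mono_def tail_antimono)
  then have "(\<lambda>r. - (- tail r)) \<in> borel_measurable borel" by measurable
  then show ?thesis by simp
qed

text \<open>The set of radii is, up to its left end point r0, the interval from r0 to 1, whose mass
  under w is the limit of \<open>tail\<close> at points decreasing to r0. The factor 2 comes from 2
  r w \<le> 2 w.\<close>

lemma emeasure_mu_tail_le:
  assumes u: "0 \<le> u"
  shows "emeasure mu {z. cmod z < 1 \<and> tail (cmod z) \<le> u} \<le> ennreal (2 * u)"
proof -
  define S where "S = {r. 0 \<le> r \<and> r < 1 \<and> tail r \<le> u}"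
  have [measurable]: "S \<in> sets borel" unfolding S_def by measurable
  have "emeasure mu {z. cmod z < 1 \<and> tail (cmod z) \<le> u} = (\<integral>\<^sup>+z. indicator {z. cmod z < 1 \<and> tail (cmod z) \<le> u} z \<partial>mu)"
    by (subst nn_integral_indicator) auto
  also have "\<dots> = (\<integral>\<^sup>+z. indicator S (cmod z) \<partial>mu)"
    by (intro nn_integral_cong) (auto simp: S_def indicator_def)
  also have "\<dots> = (\<integral>\<^sup>+r. ennreal (2 * r * w r) * indicator S r \<partial>lborel)"
    by (rule nn_integral_mu_cmod) measurable
  also have "\<dots> \<le> ennreal (2 * u)"
  proof (cases "S = {}")
    case True then show ?thesis by simp
  next
    case False
    define r0 where "r0 = Inf S"
    have bdd: "bdd_below S" by (auto simp: S_def bdd_below_def)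
    have r0: "0 \<le> r0" "r0 < 1"
    proof -
      show "0 \<le> r0" unfolding r0_def using False by (intro cInf_greatest) (auto simp: S_def)
      obtain r where "r \<in> S" using False by auto
      then have "r0 \<le> r" "r < 1" unfolding r0_def by (auto intro: cInf_lower bdd simp: S_def)
      then show "r0 < 1" by simp
    qed
    \<comment> \<open>Points decreasing to r0 inside (r0,1). Each lies to the right of a point of S,
      so its tail is at most u, and continuity of measures from below carries the bound over to the
      open interval.\<close>
    define R where "R n = r0 + (1 - r0) / (real n + 2)" for n
    have R1: "r0 < R n" "R n < 1" for n
    proof -
      show "r0 < R n" using r0 by (simp add: R_def)
      have "(1 - r0) / (real n + 2) < (1 - r0) / 1" using r0 by (intro divide_strict_left_mono) auto
      then show "R n < 1" by (simp add: R_def)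
    qed
    have RS: "tail (R n) \<le> u" for n
    proof -
      obtain r where "r \<in> S" "r < R n" using cInf_lessD[OF False, of "R n"] R1(1)[of n] by (auto simp: r0_def)
      then show ?thesis using tail_antimono[of r "R n"] by (auto simp: S_def)
    qed
    let ?W = "density lborel (\<lambda>r. ennreal (w r))"
    have W: "emeasure ?W {R n..<1} \<le> ennreal u" for n
    proof -
      have "emeasure ?W {R n..<1} = (\<integral>\<^sup>+r. ennreal (indicator {R n..<1} r * w r) \<partial>lborel)"
        by (subst emeasure_density) (auto intro!: nn_integral_cong simp: indicator_def)
      also have "\<dots> = ennreal (tail (R n))"
        unfolding tail_indicator using w_nonneg by (intro nn_integral_eq_integral tail_integrable) auto
      finally show ?thesis using RS by (simp add: ennreal_leI)
    qed
    have inc: "incseq (\<lambda>n. {R n..<1})"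
    proof (rule incseq_SucI)
      fix n
      have "(1 - r0) / (real (Suc n) + 2) \<le> (1 - r0) / (real n + 2)" using r0 by (intro divide_left_mono) auto
      then show "{R n..<1} \<subseteq> {R (Suc n)..<1}" by (auto simp: R_def)
    qed
    have un: "(\<Union>n. {R n..<1}) = {r0<..<1}"
    proof (intro equalityI subsetI)
      fix x assume "x \<in> (\<Union>n. {R n..<1})"
      then show "x \<in> {r0<..<1}" using R1 by (auto intro: less_le_trans)
    next
      fix x assume x: "x \<in> {r0<..<1}"
      obtain n :: nat where n: "(1 - r0) / (x - r0) < real n" using reals_Archimedean2 by blast
      then have "1 - r0 < real n * (x - r0)" using x by (simp add: pos_divide_less_eq)
      also have "\<dots> \<le> (real n + 2) * (x - r0)" using x by (intro mult_right_mono) auto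
      finally have "(1 - r0) / (real n + 2) < x - r0" by (simp add: pos_divide_less_eq mult.commute)
      then show "x \<in> (\<Union>n. {R n..<1})" using x by (auto simp: R_def intro!: exI[of _ n])
    qed
    have "emeasure ?W {r0<..<1} = (SUP n. emeasure ?W {R n..<1})"
      unfolding un[symmetric] by (rule SUP_emeasure_incseq[symmetric, OF _ inc]) auto
    also have "\<dots> \<le> ennreal u" by (intro SUP_least W)
    finally have W0: "emeasure ?W {r0<..<1} \<le> ennreal u" .
    have "(\<integral>\<^sup>+r. ennreal (2 * r * w r) * indicator S r \<partial>lborel) \<le> (\<integral>\<^sup>+r. 2 * (ennreal (w r) * indicator {r0<..<1} r) \<partial>lborel)"
    proof (intro nn_integral_mono_AE, use AE_lborel_singleton[of r0] in eventually_elim)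
      fix r assume r: "r \<noteq> r0"
      show "ennreal (2 * r * w r) * indicator S r \<le> 2 * (ennreal (w r) * indicator {r0<..<1} r)"
      proof (cases "r \<in> S")
        case True
        then have "r0 \<le> r" unfolding r0_def by (intro cInf_lower bdd)
        then have "r \<in> {r0<..<1}" using r True by (auto simp: S_def)
        moreover have "2 * r * w r \<le> 2 * w r" using True w_nonneg[of r] by (simp add: S_def mult_left_le_one_le)
        then have "ennreal (2 * r * w r) \<le> ennreal (2 * w r)" by (rule ennreal_leI)
        then have "ennreal (2 * r * w r) \<le> 2 * ennreal (w r)" by (simp add: ennreal_mult w_nonneg)
        ultimately show ?thesis using True by simp
      qed simp
    qed
    also have "\<dots> = 2 * emeasure ?W {r0<..<1}"
      by (simp add: nn_integral_cmult emeasure_density)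
    also have "\<dots> \<le> 2 * ennreal u" using W0 by (intro mult_left_mono) auto
    also have "\<dots> = ennreal (2 * u)" using u by (simp add: ennreal_mult)
    finally show ?thesis .
  qed
  finally show ?thesis .
qed

text \<open>Decompose into the dyadic level sets of the tail, whose measures are controlled by
  \<open>emeasure_mu_tail_le\<close>.\<close>
lemma schur_integral:
  assumes s: "0 < s" "s < 1"
  shows "\<exists>C>0. \<forall>V>0. (\<integral>\<^sup>+z. ennreal (tail (cmod z) powr (- s) / max V (tail (cmod z))) \<partial>mu) \<le> ennreal (C * V powr (- s))"
proof -
  \<comment> \<open>The ratios of the two geometric series, over the levels above and below V. The
    first converges because s > 0, the second because s < 1.\<close>
  define q1 where "q1 = (2::real) powr (- s)"
  define q2 where "q2 = (2::real) powr (s - 1)"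
  have q1: "0 < q1" "q1 < 1" unfolding q1_def using s powr_less_mono[of "-s" 0 "2::real"] by auto
  have q2: "0 < q2" "q2 < 1" unfolding q2_def using s powr_less_mono[of "s-1" 0 "2::real"] by auto
  define c where "c k = 4 * q1 ^ k + 2 * 2 powr s * q2 ^ k" for k
  have csum: "summable c" unfolding c_def using q1 q2 by (intro summable_add summable_mult summable_geometric) auto
  have c0: "0 < c k" for k unfolding c_def using q1 q2 by (intro add_pos_pos mult_pos_pos) auto
  define C where "C = (\<Sum>k. c k)"
  have C: "0 < C" unfolding C_def by (rule suminf_pos[OF csum c0])
  have "(\<integral>\<^sup>+z. ennreal (tail (cmod z) powr (- s) / max V (tail (cmod z))) \<partial>mu) \<le> ennreal (C * V powr (- s))" if V: "0 < V" for V
  proof -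
    \<comment> \<open>\<open>A k\<close> majorises the integrand where the tail v is between 2^k V
      and 2^(k+1) V, and \<open>B k\<close> where it is between V/2^(k+1) and V/2^k. The shells are
      enlarged to sublevel sets, since only these have a known measure bound; the geometric decay
      absorbs the loss.\<close>
    define A where "A k = (2 ^ k * V) powr (- s - 1)" for k :: nat
    define B where "B k = (V / 2 ^ Suc k) powr (- s) / V" for k :: nat
    let ?E = "\<lambda>u. {z::complex. cmod z < 1 \<and> tail (cmod z) \<le> u}"
    let ?g = "\<lambda>k z. ennreal (A k) * indicator (?E (2 ^ Suc k * V)) z + ennreal (B k) * indicator (?E (V / 2 ^ k)) z"
    let ?m = "\<lambda>k. ennreal (A k) * emeasure mu (?E (2 ^ Suc k * V)) + ennreal (B k) * emeasure mu (?E (V / 2 ^ k))"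
    let ?t = "\<lambda>z. ennreal (tail (cmod z) powr (- s) / max V (tail (cmod z)))"
    have A0: "0 \<le> A k" and B0: "0 \<le> B k" for k using V by (auto simp: A_def B_def)
    have pt: "ennreal (v powr (- s) / max V v) \<le> (\<Sum>k. ennreal (A k) * indicator {..2 ^ Suc k * V} v + ennreal (B k) * indicator {..V / 2 ^ k} v)" (is "_ \<le> suminf ?f")
      if v: "0 < v" for v
    proof -
      have le: "?f k \<le> suminf ?f" for k
        using sum_le_suminf[of ?f "{k}"] by simp
      show ?thesis
      proof (cases "V \<le> v")
        case True
        then have "1 \<le> v / V" using V by simp
        then obtain k where k: "2 ^ k \<le> v / V" "v / V < 2 ^ Suc k" using ex_dyadic by blast
        have k1: "2 ^ k * V \<le> v" "v \<le> 2 ^ Suc k * V"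
          using k V by (simp_all add: pos_le_divide_eq pos_divide_less_eq)
        have "v powr (- s) / max V v = v powr (- s - 1)" using True v by (simp add: powr_diff max_def)
        also have "\<dots> \<le> A k" unfolding A_def using k1 V s by (intro powr_mono2') auto
        finally have "ennreal (v powr (- s) / max V v) \<le> ennreal (A k)" by (rule ennreal_leI)
        also have "\<dots> \<le> ?f k" using k1 by simp
        finally show ?thesis using le order_trans by blast
      next
        case False
        then have "1 \<le> V / v" using v by simp
        then obtain k where k: "2 ^ k \<le> V / v" "V / v < 2 ^ Suc k" using ex_dyadic by blast
        have k1: "v \<le> V / 2 ^ k" "V / 2 ^ Suc k \<le> v"
          using k v by (simp_all add: pos_le_divide_eq pos_divide_less_eq field_simps)
        have "v powr (- s) / max V v = v powr (- s) / V" using False by (simp add: max_def)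
        also have "\<dots> \<le> B k" unfolding B_def using k1 V s by (intro divide_right_mono powr_mono2') auto
        finally have "ennreal (v powr (- s) / max V v) \<le> ennreal (B k)" by (rule ennreal_leI)
        also have "\<dots> \<le> ?f k" using k1 by (simp add: add_increasing)
        finally show ?thesis using le order_trans by blast
      qed
    qed
    have "(\<integral>\<^sup>+z. ?t z \<partial>mu)
      \<le> (\<integral>\<^sup>+z. (\<Sum>k. ?g k z) \<partial>mu)"
    proof (rule nn_integral_mono_AE, use AE_mu_ball in eventually_elim)
      fix z :: complex assume "z \<in> ball 0 1"
      then have z: "cmod z < 1" by simp
      have i: "indicator (?E u) z = (indicator {..u} (tail (cmod z)) :: ennreal)" for u
        using z by (simp add: indicator_def)
      show "?t z \<le> (\<Sum>k. ?g k z)"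
        unfolding i by (rule pt[OF tail_pos]) (use z in auto)
    qed
    also have "\<dots> = (\<Sum>k. \<integral>\<^sup>+z. ?g k z \<partial>mu)"
      by (rule nn_integral_suminf) measurable
    also have "\<dots> = (\<Sum>k. ?m k)"
    proof (rule suminf_cong)
      fix k
      have m: "?E u \<in> sets mu" for u by simp
      show "(\<integral>\<^sup>+z. ?g k z \<partial>mu)
        = ?m k"
        by (subst nn_integral_add) (use m in \<open>auto simp: nn_integral_cmult_indicator\<close>)
    qed
    also have "\<dots> \<le> (\<Sum>k. ennreal (V powr (- s) * c k))"
    proof (rule suminf_le)
      fix k
      have "?m k
        \<le> ennreal (A k) * ennreal (2 * (2 ^ Suc k * V)) + ennreal (B k) * ennreal (2 * (V / 2 ^ k))"
        using V by (intro add_mono mult_left_mono emeasure_mu_tail_le) auto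
      also have "\<dots> = ennreal (A k * (2 * (2 ^ Suc k * V)) + B k * (2 * (V / 2 ^ k)))"
      proof -
        have n: "0 \<le> 2 * (2 ^ Suc k * V)" "0 \<le> 2 * (V / 2 ^ k)" using V by auto
        show ?thesis
          unfolding ennreal_mult[OF A0 n(1), symmetric] ennreal_mult[OF B0 n(2), symmetric]
          by (rule ennreal_plus[symmetric]) (intro mult_nonneg_nonneg A0 B0 n)+
      qed
      also have "A k * (2 * (2 ^ Suc k * V)) = V powr (- s) * (4 * q1 ^ k)"
      proof -
        have "A k * (2 ^ k * V) = (2 ^ k * V) powr (- s - 1) * (2 ^ k * V) powr 1" using V by (simp add: A_def)
        also have "\<dots> = (2 ^ k * V) powr (- s)" unfolding powr_add[symmetric] by simp
        also have "\<dots> = (2 powr real k) powr (- s) * V powr (- s)" using V by (simp add: powr_mult powr_realpow)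
        also have "(2 powr real k) powr (- s) = q1 ^ k"
          using q1 by (simp add: q1_def powr_powr mult.commute flip: powr_realpow)
        finally show ?thesis by simp
      qed
      also have "B k * (2 * (V / 2 ^ k)) = V powr (- s) * (2 * 2 powr s * q2 ^ k)"
      proof -
        have "(V / 2 ^ Suc k) powr (- s) = V powr (- s) * (2 powr real (Suc k)) powr s"
          using V by (simp add: powr_divide powr_minus_divide powr_realpow del: power_Suc of_nat_Suc)
        also have "(2 powr real (Suc k)) powr s = 2 powr s * 2 powr (s * real k)"
          by (simp add: powr_powr algebra_simps flip: powr_add)
        finally have "B k * (2 * (V / 2 ^ k)) = V powr (- s) * (2 * 2 powr s * (2 powr (s * real k) / 2 ^ k))"
          using V by (simp add: B_def)
        also have "2 powr (s * real k) / 2 ^ k = q2 ^ k"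
        proof -
          have "(2::real) ^ k = 2 powr real k" by (simp add: powr_realpow)
          then have "2 powr (s * real k) / 2 ^ k = 2 powr (s * real k - real k)" by (simp add: powr_diff)
          also have "\<dots> = (2 powr (s - 1)) powr real k" by (simp add: powr_powr algebra_simps)
          finally show ?thesis using q2 by (simp add: q2_def powr_realpow)
        qed
        finally show ?thesis .
      qed
      finally show "?m k \<le> ennreal (V powr (- s) * c k)"
        by (simp add: c_def distrib_left)
    qed auto
    also have "\<dots> = ennreal (V powr (- s) * C)"
      unfolding C_def using c0 csum by (subst suminf_ennreal2) (auto simp: less_imp_le summable_mult suminf_mult)
    finally show ?thesis by (simp add: mult.commute)
  qed
  with C show ?thesis by blast
qed

section \<open>The projection and its averages over rotations\<close>

definition proj :: "(complex \<Rightarrow> complex) \<Rightarrow> complex \<Rightarrow> complex" where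
  "proj f z = (\<integral>y. f y * kern (z * cnj y) \<partial>mu)"

lemma measurable_cnj [measurable]: "cnj \<in> borel_measurable borel"
  by (intro borel_measurable_continuous_onI continuous_intros)

lemma measurable_proj [measurable]:
  assumes [measurable]: "f \<in> borel_measurable borel"
  shows "proj f \<in> borel_measurable borel"
  unfolding proj_def by measurable

lemma integrable_mu_rotate:
  fixes g :: "complex \<Rightarrow> complex"
  assumes u: "cmod u = 1" and g: "integrable mu g"
  shows "integrable mu (\<lambda>z. g (u * z))"
proof -
  have [measurable]: "g \<in> borel_measurable borel" using borel_measurable_integrable[OF g] by simp
  have "integrable (distr mu borel (\<lambda>z. u * z)) g" unfolding distr_mu_rotate[OF u] by (rule g)
  then show ?thesis by (subst (asm) integrable_distr_eq) auto
qed

lemma integrable_proj_integrand: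
  assumes f: "integrable mu f" and z: "cmod z < 1"
  shows "integrable mu (\<lambda>y. f y * kern (z * cnj y))"
proof -
  have [measurable]: "f \<in> borel_measurable borel" using borel_measurable_integrable[OF f] by simp
  let ?M = "\<Sum>n. coef n * cmod z ^ n"
  have M: "0 \<le> ?M"
    by (intro suminf_nonneg coef_summable) (use z coef_pos in \<open>auto simp: less_imp_le\<close>)
  show ?thesis
  proof (rule Bochner_Integration.integrable_bound[OF integrable_mult_right[OF f, of "of_real ?M"]])
    show "AE y in mu. cmod (f y * kern (z * cnj y)) \<le> cmod (of_real ?M * f y)"
    proof (use AE_mu_ball in eventually_elim)
      fix y :: complex assume "y \<in> ball 0 1"
      then have "cmod z * cmod y \<le> cmod z * 1" by (intro mult_left_mono) auto
      then have "cmod (kern (z * cnj y)) \<le> ?M" using z by (intro kern_bound) (auto simp: norm_mult)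
      then have "cmod (f y) * cmod (kern (z * cnj y)) \<le> cmod (f y) * ?M" by (intro mult_left_mono) auto
      then show "cmod (f y * kern (z * cnj y)) \<le> cmod (of_real ?M * f y)"
        unfolding norm_mult norm_of_real using M by (simp add: mult.commute)
    qed
  qed measurable
qed

text \<open>Replacing y by \<open>circ s * y\<close> does not change the integral over
  \<open>mu\<close>, so one may average over s. After Fubini the inner integral is a convolution on
  a circle with parameter \<open>z * cnj y\<close>, to which \<open>conv_bound\<close>
  applies.\<close>

lemma proj_rotated:
  assumes f: "integrable mu f" and z: "cmod z < 1"
  shows "proj f (z * circ t) = (\<integral>y. conv (\<lambda>s. f (circ s * y)) (z * cnj y * circ t) \<partial>mu)"
proof -
  have [measurable]: "f \<in> borel_measurable borel" using borel_measurable_integrable[OF f] by simp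
  interpret U: finite_measure unif by (rule finite_measure_unif)
  interpret pair_sigma_finite unif mu ..
  define g where "g y = f y * kern (z * circ t * cnj y)" for y
  have zt: "cmod (z * circ t) < 1" using z by (simp add: norm_mult)
  have [measurable]: "g \<in> borel_measurable borel" unfolding g_def by measurable
  have gi: "integrable mu g" unfolding g_def by (rule integrable_proj_integrand[OF f zt])
  have gr: "(\<integral>y. g (circ s * y) \<partial>mu) = proj f (z * circ t)" for s
    unfolding proj_def g_def[symmetric] by (rule integral_mu_rotate) auto
  have gnr: "(\<integral>y. norm (g (circ s * y)) \<partial>mu) = (\<integral>y. norm (g y) \<partial>mu)" for s
    by (rule integral_mu_rotate) auto
  \<comment> \<open>By rotation invariance the integral of the norm over y is the same for all s,
    and \<open>unif\<close> is finite.\<close>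
  have int: "integrable (unif \<Otimes>\<^sub>M mu) (\<lambda>(s, y). g (circ s * y))"
  proof (rule Fubini_integrable)
    show "integrable unif (\<lambda>s. \<integral>y. norm (case (s, y) of (s, y) \<Rightarrow> g (circ s * y)) \<partial>mu)"
      by (simp add: gnr)
    show "AE s in unif. integrable mu (\<lambda>y. case (s, y) of (s, y) \<Rightarrow> g (circ s * y))"
      using integrable_mu_rotate[OF _ gi] by simp
  qed measurable
  have U1: "measure unif UNIV = 1" by (simp add: measure_def)
  have "proj f (z * circ t) = (\<integral>s. proj f (z * circ t) \<partial>unif)" by (simp add: U1)
  also have "\<dots> = (\<integral>s. (\<integral>y. g (circ s * y) \<partial>mu) \<partial>unif)" by (simp only: gr)
  also have "\<dots> = (\<integral>y. (\<integral>s. g (circ s * y) \<partial>unif) \<partial>mu)"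
    by (rule Fubini_integral[OF int, symmetric])
  also have "(\<lambda>y. \<integral>s. g (circ s * y) \<partial>unif) = (\<lambda>y. conv (\<lambda>s. f (circ s * y)) (z * cnj y * circ t))"
    unfolding g_def conv_def by (simp add: mult_ac)
  finally show ?thesis .
qed

text \<open>Hoelder in y with weight \<open>k z y\<close> costs the first Schur integral to the
  power p - 1, which is a multiple of tail(|z|)^(-q). The circle bound supplies H^p, and k^(1-p) H^p
  = H tail(|y|)^q, so one factor H survives for the second Schur integral, now in z.\<close>

lemma proj_bounded:
  assumes p: "1 < p" "p < 2"
    and D: "1 \<le> D" "\<And>r. 0 \<le> r \<Longrightarrow> r < 1 \<Longrightarrow> tail r \<le> D * tail ((1 + r) / 2)"
  shows "\<exists>C>0. \<forall>f. f \<in> borel_measurable borel \<longrightarrow>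
    (pow_int mu p (proj f)) \<le> ennreal C * (pow_int mu p f)"
proof -
  interpret U: finite_measure unif by (rule finite_measure_unif)
  \<comment> \<open>The test function tail^(-1/2) raised to the power p - 1 is tail^(-q), so the
    Schur integral is needed for both exponents 1/2 and q.\<close>
  define q where "q = (p - 1) / 2"
  obtain C1 where C1: "0 < C1" "\<And>V. 0 < V \<Longrightarrow> (\<integral>\<^sup>+z. ennreal (tail (cmod z) powr (- (1/2)) / max V (tail (cmod z))) \<partial>mu) \<le> ennreal (C1 * V powr (- (1/2)))"
    using schur_integral[of "1/2"] by auto
  obtain C4 where C4: "0 < C4" "\<And>V. 0 < V \<Longrightarrow> (\<integral>\<^sup>+z. ennreal (tail (cmod z) powr (- q) / max V (tail (cmod z))) \<partial>mu) \<le> ennreal (C4 * V powr (- q))"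
    using schur_integral[of q] p by (auto simp: q_def)
  obtain C2 where C2: "0 < C2" "\<And>f x. f \<in> borel_measurable borel \<Longrightarrow> cmod x < 1 \<Longrightarrow>
      (pow_int unif p (\<lambda>t. conv f (x * circ t))) \<le> ennreal (C2 * incr_sum (cmod x) powr p) * (pow_int unif p f)"
    using conv_bound[OF p] by metis
  obtain C3 where C3: "0 < C3" "\<And>r. 0 \<le> r \<Longrightarrow> r < 1 \<Longrightarrow> incr_sum r \<le> C3 / tail r"
    using incr_sum_le_tail[OF D] by metis
  define E where "E = 2 powr p * C1 powr (p - 1) * (C2 * C3 powr p)"
  have E: "0 < E" using C1 C2 C3 by (simp add: E_def)
  show ?thesis
  proof (rule exI[of _ "E * C4"], intro conjI allI impI)
    show "0 < E * C4" using E C4 by simp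
    fix f :: "complex \<Rightarrow> complex" assume [measurable]: "f \<in> borel_measurable borel"
    let ?X = "pow_int mu p f"
    show "(pow_int mu p (proj f)) \<le> ennreal (E * C4) * ?X"
    proof (cases "?X = \<infinity>")
      case True
      then show ?thesis using E C4 by (simp add: ennreal_mult_top)
    next
      case False
      have fi: "integrable mu f"
        using False p by (intro mu.integrable_of_pow_int) auto
      let ?v = "\<lambda>z::complex. tail (cmod z)"
      define H where "H z y = 1 / max (?v z) (?v y)" for z y :: complex
      define k where "k z y = ?v y powr (- (1/2)) / max (?v z) (?v y)" for z y :: complex
      define F where "F y = (pow_int unif p (\<lambda>s. f (circ s * y)))" for y
      define T where "T z t y = conv (\<lambda>s. f (circ s * y)) (z * cnj y * circ t)" for z t y
      let ?T = "\<lambda>z t y. ennreal (cmod (T z t y) powr p * k z y powr (1 - p))"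
      let ?h = "\<lambda>z y. ennreal (H z y * ?v y powr q) * F y"
      have [measurable]: "(\<lambda>(t, y). T z t y) \<in> borel_measurable (borel \<Otimes>\<^sub>M borel)" for z
        unfolding T_def conv_def split_beta' by measurable
      have [measurable]: "F \<in> borel_measurable borel" unfolding F_def by measurable
      have [measurable]: "(\<lambda>(z, y). H z y) \<in> borel_measurable (borel \<Otimes>\<^sub>M borel)"
        unfolding H_def split_beta' by measurable
      have [measurable]: "k z \<in> borel_measurable borel" for z unfolding k_def by measurable
      have vpos: "0 < ?v z" if "cmod z < 1" for z :: complex using that by (intro tail_pos) auto
      have circle: "(pow_int unif p (\<lambda>t. proj f (z * circ t)))
          \<le> ennreal (E * ?v z powr (- q)) * (\<integral>\<^sup>+y. ?h z y \<partial>mu)"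
        if z: "cmod z < 1" for z
      proof -
        let ?c = "2 powr p * (C1 * ?v z powr (- (1/2))) powr (p - 1)"
        have "(pow_int unif p (\<lambda>t. proj f (z * circ t)))
          \<le> (\<integral>\<^sup>+t. ennreal ?c * (\<integral>\<^sup>+y. ?T z t y \<partial>mu) \<partial>unif)"
        proof (rule nn_integral_mono)
          fix t
          show "ennreal (cmod (proj f (z * circ t)) powr p)
            \<le> ennreal ?c * (\<integral>\<^sup>+y. ?T z t y \<partial>mu)"
            unfolding proj_rotated[OF fi z] T_def[symmetric]
          proof (rule crude_hoelder)
            show "AE y in mu. 0 < k z y \<or> 0 \<le> k z y \<and> T z t y = 0"
            proof (use AE_mu_ball in eventually_elim)
              fix y :: complex assume "y \<in> ball 0 1"
              then have v: "0 < ?v y" by (intro vpos) simp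
              then have "0 < k z y" unfolding k_def by (intro divide_pos_pos) (auto simp: less_max_iff_disj)
              then show "0 < k z y \<or> 0 \<le> k z y \<and> T z t y = 0" by simp
            qed
            show "(\<integral>\<^sup>+y. ennreal (k z y) \<partial>mu) \<le> ennreal (C1 * ?v z powr (- (1/2)))"
              unfolding k_def by (rule C1(2)[OF vpos[OF z]])
          qed (use vpos[OF z] C1 p in auto)
        qed
        also have "\<dots> = ennreal ?c * (\<integral>\<^sup>+t. (\<integral>\<^sup>+y. ?T z t y \<partial>mu) \<partial>unif)"
          by (rule nn_integral_cmult) measurable
        also have "(\<integral>\<^sup>+t. (\<integral>\<^sup>+y. ?T z t y \<partial>mu) \<partial>unif)
          = (\<integral>\<^sup>+y. (\<integral>\<^sup>+t. ?T z t y \<partial>unif) \<partial>mu)"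
        proof -
          interpret pair_sigma_finite mu unif ..
          show ?thesis by (rule Fubini') measurable
        qed
        also have "\<dots> \<le> (\<integral>\<^sup>+y. ennreal (C2 * C3 powr p) * (?h z y) \<partial>mu)"
        proof (rule nn_integral_mono_AE, use AE_mu_ball in eventually_elim)
          fix y :: complex assume "y \<in> ball 0 1"
          then have b: "cmod y < 1" by simp
          have le: "cmod (z * cnj y) \<le> cmod z" "cmod (z * cnj y) \<le> cmod y"
            using z b by (auto simp: norm_mult intro: mult_left_le mult_left_le_one_le)
          then have zb: "cmod (z * cnj y) < 1" using z by linarith
          have H: "0 < H z y" using vpos[OF z] by (simp add: H_def less_max_iff_disj)
          have kH: "k z y = H z y * ?v y powr (- (1/2))" by (simp add: k_def H_def)
          have "incr_sum (cmod (z * cnj y)) \<le> C3 / tail (cmod (z * cnj y))" using zb by (intro C3) auto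
          \<comment> \<open>As |z y| is at most |z| and at most |y|, its tail is at least the larger
            of the two tails. This is where the kernel with the maximum arises.\<close>
          also have "\<dots> \<le> C3 / max (?v z) (?v y)"
            using le C3 vpos[OF z] vpos[OF zb] by (intro divide_left_mono) (auto intro: tail_antimono simp: less_max_iff_disj)
          finally have "incr_sum (cmod (z * cnj y)) \<le> C3 * H z y" by (simp add: H_def)
          then have "incr_sum (cmod (z * cnj y)) powr p \<le> (C3 * H z y) powr p"
            using p incr_sum_pos[of "cmod (z * cnj y)"] zb by (intro powr_mono2) auto
          then have i: "incr_sum (cmod (z * cnj y)) powr p \<le> C3 powr p * H z y powr p"
            using C3 H by (simp add: powr_mult)
          have "(\<integral>\<^sup>+t. ?T z t y \<partial>unif)
            = ennreal (k z y powr (1 - p)) * (pow_int unif p (\<lambda>t. T z t y))"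
            by (subst nn_integral_cmult[symmetric]) (auto simp: mult.commute simp flip: ennreal_mult)
          also have "(pow_int unif p (\<lambda>t. T z t y)) \<le> ennreal (C2 * incr_sum (cmod (z * cnj y)) powr p) * F y"
            unfolding T_def F_def by (rule C2(2)[OF _ zb]) measurable
          also have "\<dots> \<le> ennreal (C2 * (C3 powr p * H z y powr p)) * F y"
            using C2 i by (intro mult_right_mono ennreal_leI mult_left_mono) auto
          also have "ennreal (k z y powr (1 - p)) * (ennreal (C2 * (C3 powr p * H z y powr p)) * F y)
            = ennreal (k z y powr (1 - p) * (C2 * (C3 powr p * H z y powr p))) * F y"
            using C2 C3 by (subst ennreal_mult) (auto simp: mult.assoc)
          also have "k z y powr (1 - p) * (C2 * (C3 powr p * H z y powr p)) = C2 * C3 powr p * (H z y * ?v y powr q)"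
          proof -
            have "H z y powr (1 - p) * H z y powr p = H z y" using H by (simp flip: powr_add)
            moreover have "(?v y powr (- (1/2))) powr (1 - p) = ?v y powr q"
            proof -
              have "(- (1/2)) * (1 - p) = q" by (simp add: q_def field_simps)
              then show ?thesis by (simp only: powr_powr)
            qed
            ultimately show ?thesis unfolding kH powr_mult by (simp add: mult_ac)
          qed
          also have "ennreal (C2 * C3 powr p * (H z y * ?v y powr q)) * F y = ennreal (C2 * C3 powr p) * (?h z y)"
            using C2 C3 H by (subst ennreal_mult) (auto simp: mult.assoc)
          finally show "(\<integral>\<^sup>+t. ?T z t y \<partial>unif) \<le> ennreal (C2 * C3 powr p) * (?h z y)"
            by (simp add: mult_left_mono)
        qed
        also have "\<dots> = ennreal (C2 * C3 powr p) * (\<integral>\<^sup>+y. ?h z y \<partial>mu)"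
          by (rule nn_integral_cmult) measurable
        finally have "(pow_int unif p (\<lambda>t. proj f (z * circ t)))
          \<le> ennreal ?c * (ennreal (C2 * C3 powr p) * (\<integral>\<^sup>+y. ?h z y \<partial>mu))"
          by (simp add: mult_left_mono)
        also have "\<dots> = ennreal (?c * (C2 * C3 powr p)) * (\<integral>\<^sup>+y. ?h z y \<partial>mu)"
          using C2 by (subst ennreal_mult) (auto simp: mult.assoc)
        also have "?c * (C2 * C3 powr p) = E * ?v z powr (- q)"
        proof -
          have "(- (1/2)) * (p - 1) = - q" by (simp add: q_def field_simps)
          then have "(?v z powr (- (1/2))) powr (p - 1) = ?v z powr (- q)" by (simp only: powr_powr)
          then show ?thesis unfolding E_def powr_mult by simp
        qed
        finally show ?thesis .
      qed
      \<comment> \<open>The norm is averaged over rotations of z, so that \<open>circle\<close> can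
        be applied on each circle separately.\<close>
      have "(pow_int mu p (proj f)) = (\<integral>\<^sup>+t. (pow_int mu p (proj f)) \<partial>unif)"
        by (simp add: nn_integral_const)
      also have "\<dots> = (\<integral>\<^sup>+t. (pow_int mu p (\<lambda>z. proj f (z * circ t))) \<partial>unif)"
      proof (rule nn_integral_cong)
        fix t
        show "(pow_int mu p (proj f)) = (pow_int mu p (\<lambda>z. proj f (z * circ t)))"
          using nn_integral_mu_rotate[of "circ t" "\<lambda>z. ennreal (cmod (proj f z) powr p)"] by (simp add: mult.commute)
      qed
      also have "\<dots> = (\<integral>\<^sup>+z. (pow_int unif p (\<lambda>t. proj f (z * circ t))) \<partial>mu)"
      proof -
        interpret pair_sigma_finite mu unif ..
        show ?thesis by (rule Fubini') measurable
      qed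
      also have "\<dots> \<le> (\<integral>\<^sup>+z. ennreal (E * ?v z powr (- q)) * (\<integral>\<^sup>+y. ?h z y \<partial>mu) \<partial>mu)"
        by (rule nn_integral_mono_AE, use AE_mu_ball in eventually_elim) (rule circle, simp)
      also have "\<dots> = (\<integral>\<^sup>+z. (\<integral>\<^sup>+y. ennreal (E * ?v z powr (- q)) * (?h z y) \<partial>mu) \<partial>mu)"
        by (rule nn_integral_cong, rule nn_integral_cmult[symmetric]) measurable
      also have "\<dots> = (\<integral>\<^sup>+y. (\<integral>\<^sup>+z. ennreal (E * ?v z powr (- q)) * (?h z y) \<partial>mu) \<partial>mu)"
      proof -
        interpret pair_sigma_finite mu mu ..
        show ?thesis by (rule Fubini') measurable
      qed
      also have "\<dots> \<le> (\<integral>\<^sup>+y. ennreal (E * C4) * F y \<partial>mu)"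
      proof (rule nn_integral_mono_AE, use AE_mu_ball in eventually_elim)
        \<comment> \<open>By symmetry of the maximum, the z-integral is a Schur integral with V =
          tail(|y|) and exponent q; the power tail(|y|)^(-q) it yields cancels tail(|y|)^q.\<close>
        fix y :: complex assume "y \<in> ball 0 1"
        then have b: "cmod y < 1" by simp
        have "(\<integral>\<^sup>+z. ennreal (E * ?v z powr (- q)) * (?h z y) \<partial>mu)
          = (\<integral>\<^sup>+z. ennreal (?v z powr (- q) / max (?v y) (?v z)) * (ennreal (E * ?v y powr q) * F y) \<partial>mu)"
        proof (rule nn_integral_cong_AE, use AE_mu_ball in eventually_elim)
          fix z :: complex assume "z \<in> ball 0 1"
          then have H: "0 < H z y" using vpos[of z] by (simp add: H_def less_max_iff_disj)
          have "(E * ?v z powr (- q)) * (H z y * ?v y powr q) = (?v z powr (- q) / max (?v y) (?v z)) * (E * ?v y powr q)"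
            by (simp add: H_def max.commute)
          then have "ennreal (E * ?v z powr (- q)) * ennreal (H z y * ?v y powr q) = ennreal (?v z powr (- q) / max (?v y) (?v z)) * ennreal (E * ?v y powr q)"
            using E H vpos[OF b] by (subst (1 2) ennreal_mult[symmetric]) (auto simp: le_max_iff_disj)
          then show "ennreal (E * ?v z powr (- q)) * (?h z y)
            = ennreal (?v z powr (- q) / max (?v y) (?v z)) * (ennreal (E * ?v y powr q) * F y)"
            by (simp only: mult.assoc[symmetric])
        qed
        also have "\<dots> = (\<integral>\<^sup>+z. ennreal (?v z powr (- q) / max (?v y) (?v z)) \<partial>mu) * (ennreal (E * ?v y powr q) * F y)"
          by (rule nn_integral_multc) measurable
        also have "\<dots> \<le> ennreal (C4 * ?v y powr (- q)) * (ennreal (E * ?v y powr q) * F y)"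
          by (intro mult_right_mono C4(2) vpos b) simp
        also have "\<dots> = ennreal (C4 * ?v y powr (- q) * (E * ?v y powr q)) * F y"
          using C4 E by (subst ennreal_mult) (auto simp: mult.assoc)
        also have "C4 * ?v y powr (- q) * (E * ?v y powr q) = E * C4 * (?v y powr (- q) * ?v y powr q)" by simp
        also have "?v y powr (- q) * ?v y powr q = 1" using vpos[OF b] by (simp flip: powr_add)
        finally show "(\<integral>\<^sup>+z. ennreal (E * ?v z powr (- q)) * (?h z y) \<partial>mu) \<le> ennreal (E * C4) * F y"
          by simp
      qed
      also have "\<dots> = ennreal (E * C4) * (\<integral>\<^sup>+y. F y \<partial>mu)" by (rule nn_integral_cmult) measurable
      also have "(\<integral>\<^sup>+y. F y \<partial>mu) = (\<integral>\<^sup>+s. (pow_int mu p (\<lambda>y. f (circ s * y))) \<partial>unif)"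
      proof -
        interpret pair_sigma_finite unif mu ..
        show ?thesis unfolding F_def by (rule Fubini') measurable
      qed
      also have "\<dots> = (\<integral>\<^sup>+s. ?X \<partial>unif)"
        using nn_integral_mu_rotate[of _ "\<lambda>z. ennreal (cmod (f z) powr p)"] by simp
      also have "\<dots> = ?X" by (simp add: nn_integral_const)
      finally show ?thesis .
    qed
  qed
qed

section \<open>Test functions\<close>

text \<open>Since \<open>0 powr 0\<close> is 0, the identities for powers of \<open>cmod z\<close>
  hold off the origin only; this lemma discards that point.\<close>

lemma AE_mu_nonzero: "AE z in mu. z \<noteq> 0"
  unfolding mu_def by (subst AE_density) (use AE_lborel_singleton[of 0] in auto)

text \<open>Rotation by the angle pi/(n-m) preserves the integral but changes the sign of the
  integrand.\<close>

lemma monomials_orthogonal: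
  fixes g :: "real \<Rightarrow> real"
  assumes [measurable]: "g \<in> borel_measurable borel" and mn: "m \<noteq> n"
  shows "(\<integral>z. z ^ n * cnj z ^ m * of_real (g (cmod z)) \<partial>mu) = 0"
proof -
  let ?I = "\<integral>z. z ^ n * cnj z ^ m * of_real (g (cmod z)) \<partial>mu"
  define u where "u = circ (1 / (2 * (real n - real m)))"
  define a where "a = 2 * pi * (1 / (2 * (real n - real m)))"
  have ua: "u = cis a" "cnj u = cis (- a)" by (simp_all add: u_def circ_def a_def cis_cnj)
  have "u ^ n * cnj u ^ m = cis (real n * a + real m * (- a))"
    unfolding ua(2) unfolding ua(1) by (simp only: Complex.DeMoivre cis_mult)
  also have "real n * a + real m * (- a) = pi"
  proof -
    have "real n - real m \<noteq> 0" using mn by simp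
    moreover have "d * (2 * pi * (1 / (2 * d))) = pi" if "d \<noteq> 0" for d :: real using that by simp
    ultimately have "(real n - real m) * a = pi" unfolding a_def by blast
    then show ?thesis by (simp add: algebra_simps)
  qed
  finally have u: "u ^ n * cnj u ^ m = -1" by simp
  have "?I = (\<integral>z. (u * z) ^ n * cnj (u * z) ^ m * of_real (g (cmod (u * z))) \<partial>mu)"
    by (rule integral_mu_rotate[symmetric]) (auto simp: u_def)
  also have "\<dots> = (\<integral>z. - (z ^ n * cnj z ^ m * of_real (g (cmod z))) \<partial>mu)"
  proof (rule Bochner_Integration.integral_cong)
    fix z
    have "(u * z) ^ n * cnj (u * z) ^ m * of_real (g (cmod (u * z))) = (u ^ n * cnj u ^ m) * (z ^ n * cnj z ^ m * of_real (g (cmod z)))"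
      by (simp add: power_mult_distrib norm_mult u_def mult_ac)
    then show "(u * z) ^ n * cnj (u * z) ^ m * of_real (g (cmod (u * z))) = - (z ^ n * cnj z ^ m * of_real (g (cmod z)))"
      unfolding u by simp
  qed simp
  also have "\<dots> = - ?I" by simp
  finally show ?thesis by simp
qed

text \<open>Off the origin this is g |g|^(q-2) for the monomial g = z^n. For q = p' it is the
  function for which Hoelder's inequality against g is an equality.\<close>

definition test :: "real \<Rightarrow> nat \<Rightarrow> complex \<Rightarrow> complex" where
  "test q n z = z ^ n * of_real (cmod z powr (real n * (q - 2)))"

lemma measurable_test [measurable]: "test q n \<in> borel_measurable borel"
  unfolding test_def by measurable

lemma norm_test:
  assumes "z \<noteq> 0"
  shows "cmod (test q n z) = cmod z powr (real n * (q - 1))"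
proof -
  have "cmod (test q n z) = cmod z powr real n * cmod z powr (real n * (q - 2))"
    using assms by (simp add: test_def norm_mult norm_power powr_realpow)
  then show ?thesis by (simp add: algebra_simps flip: powr_add)
qed

text \<open>In the power series of the kernel, orthogonality leaves only the term of degree
  n.\<close>

lemma proj_test:
  assumes q: "2 \<le> q" and z: "cmod z < 1"
  shows "proj (test q n) z = of_real (coef n * (2 * mom (real n * q + 1))) * z ^ n"
proof -
  let ?u = "\<lambda>m y. test q n y * (of_real (coef m) * (z * cnj y) ^ m)"
  have tm: "(\<lambda>y. ?u m y) \<in> borel_measurable mu" for m by measurable
  have bound: "AE y in mu. norm (?u m y) \<le> coef m * cmod z ^ m" for m
  proof (use AE_mu_ball AE_mu_nonzero in eventually_elim)
    fix y :: complex assume b: "y \<in> ball 0 1" "y \<noteq> 0"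
    have 1: "cmod (test q n y) \<le> 1" unfolding norm_test[OF b(2)] using b q by (intro powr_le1) auto
    have "cmod z * cmod y \<le> cmod z * 1" using b by (intro mult_left_mono) auto
    then have 2: "(cmod z * cmod y) ^ m \<le> cmod z ^ m" by (intro power_mono) auto
    have "cmod (test q n y) * (coef m * (cmod z * cmod y) ^ m) \<le> 1 * (coef m * cmod z ^ m)"
      using 1 2 coef_pos[of m] by (intro mult_mono mult_left_mono) auto
    then show "norm (?u m y) \<le> coef m * cmod z ^ m"
      using coef_pos[of m] by (simp add: norm_mult norm_power)
  qed
  have i: "integrable mu (\<lambda>y. ?u m y)" for m
    by (rule mu.integrable_const_bound[OF bound tm])
  have cs: "summable (\<lambda>m. coef m * cmod z ^ m)" using z by (intro coef_summable) auto
  have s: "(\<lambda>m. \<integral>y. ?u m y \<partial>mu) sums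
      (\<integral>y. (\<Sum>m. ?u m y) \<partial>mu)"
  proof (rule sums_integral[OF i])
    have "AE y in mu. \<forall>m. norm (?u m y) \<le> coef m * cmod z ^ m"
      using bound by (simp add: AE_all_countable)
    then show "AE y in mu. summable (\<lambda>m. norm (?u m y))"
    proof eventually_elim
      fix y assume "\<forall>m. norm (?u m y) \<le> coef m * cmod z ^ m"
      then show "summable (\<lambda>m. norm (?u m y))"
        by (intro summable_comparison_test'[OF cs, where N = 0]) auto
    qed
    show "summable (\<lambda>m. \<integral>y. norm (?u m y) \<partial>mu)"
    proof (rule summable_comparison_test'[OF summable_mult2[OF cs, of "measure mu UNIV"], where N = 0])
      fix m
      have "(\<integral>y. norm (?u m y) \<partial>mu) \<le> (\<integral>y. coef m * cmod z ^ m \<partial>mu)"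
        by (rule integral_mono_AE[OF integrable_norm[OF i] _ bound]) simp
      then show "norm (\<integral>y. norm (?u m y) \<partial>mu) \<le> coef m * cmod z ^ m * measure mu UNIV"
        by (simp add: mult_ac)
    qed
  qed
  have lim: "(\<integral>y. (\<Sum>m. ?u m y) \<partial>mu) = proj (test q n) z"
    unfolding proj_def
  proof (rule integral_cong_AE)
    show "AE y in mu. (\<Sum>m. ?u m y) = test q n y * kern (z * cnj y)"
    proof (use AE_mu_ball in eventually_elim)
      fix y :: complex assume "y \<in> ball 0 1"
      then have "cmod z * cmod y \<le> cmod z * 1" by (intro mult_left_mono) auto
      then have "cmod (z * cnj y) < 1" using z by (simp add: norm_mult)
      then show "(\<Sum>m. ?u m y) = test q n y * kern (z * cnj y)"
        unfolding kern_def by (intro suminf_mult coef_summable_complex)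
    qed
  qed measurable
  let ?c = "of_real (coef n * (2 * mom (real n * q + 1))) * z ^ n"
  have val: "(\<integral>y. ?u m y \<partial>mu) = (if m = n then ?c else 0)" for m
  proof -
    have "(\<integral>y. ?u m y \<partial>mu)
      = (\<integral>y. of_real (coef m) * z ^ m * (y ^ n * cnj y ^ m * of_real (cmod y powr (real n * (q - 2)))) \<partial>mu)"
      by (rule Bochner_Integration.integral_cong) (auto simp: test_def power_mult_distrib)
    also have "\<dots> = of_real (coef m) * z ^ m * (\<integral>y. y ^ n * cnj y ^ m * of_real (cmod y powr (real n * (q - 2))) \<partial>mu)"
      by (rule integral_mult_right_zero)
    also have "\<dots> = (if m = n then ?c else 0)"
    proof (cases "m = n")
      case True
      have "(\<integral>y. y ^ n * cnj y ^ n * of_real (cmod y powr (real n * (q - 2))) \<partial>mu) = (\<integral>y. complex_of_real (cmod y powr (real n * q)) \<partial>mu)"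
      proof (rule integral_cong_AE)
        show "AE y in mu. y ^ n * cnj y ^ n * of_real (cmod y powr (real n * (q - 2))) = complex_of_real (cmod y powr (real n * q))"
        proof (use AE_mu_nonzero in eventually_elim)
          fix y :: complex assume nz: "y \<noteq> 0"
          have "y ^ n * cnj y ^ n = of_real ((cmod y)\<^sup>2 ^ n)"
            unfolding power_mult_distrib[symmetric] complex_norm_square[symmetric] of_real_power ..
          also have "(cmod y)\<^sup>2 ^ n = cmod y powr (real n * 2)"
            using powr_realpow[of "cmod y" "2 * n"] nz by (simp add: mult.commute flip: power_mult)
          finally show "y ^ n * cnj y ^ n * of_real (cmod y powr (real n * (q - 2))) = complex_of_real (cmod y powr (real n * q))"
            by (simp add: algebra_simps flip: of_real_mult powr_add)
        qed
      qed measurable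
      also have "\<dots> = of_real (2 * mom (real n * q + 1))"
        unfolding integral_complex_of_real mom_int ..
      finally show ?thesis using True by (simp add: mult_ac)
    next
      case False
      then show ?thesis using monomials_orthogonal[of "\<lambda>r. r powr (real n * (q - 2))" m n] by simp
    qed
    finally show ?thesis .
  qed
  have "(\<lambda>m. if m = n then ?c else 0) sums (?c)"
    by (rule sums_single)
  with s show ?thesis unfolding val lim by (rule sums_unique2)
qed

text \<open>For the function \<open>test p' n\<close> both sides of the norm bound are explicit:
  (p'-1)p = p' makes its norm a moment of order p'n + 1, and its projection is a multiple of z^n, of
  norm given by the moment of order pn + 1. The coefficient brings in the reciprocal of the moment
  of order 2n + 1.\<close>

lemma moment_inequality_nat:
  assumes p: "1 < p" "p < 2" "1 / p + 1 / p' = 1"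
    and C: "\<And>f. f \<in> borel_measurable borel \<Longrightarrow> integrable mu (\<lambda>z. cmod (f z) powr p) \<Longrightarrow>
      (\<integral>z. cmod (proj f z) powr p \<partial>mu) powr (1 / p) \<le> C * (\<integral>z. cmod (f z) powr p \<partial>mu) powr (1 / p)"
  shows "mom (p * real n + 1) powr (1 / p) * mom (p' * real n + 1) powr (1 / p') \<le> C * mom (2 * real n + 1)"
proof -
  have p'0: "p' \<noteq> 0" using p by auto
  have pp: "p + p' = p * p'" using p p'0 by (simp add: field_simps)
  have p'2: "2 \<le> p'"
  proof (rule ccontr)
    assume "\<not> 2 \<le> p'"
    have "1 / p' = 1 - 1 / p" using p by simp
    moreover have "0 < 1 - 1 / p" "1 - 1 / p < 1 / 2" using p by (auto simp: field_simps)
    ultimately have "0 < 1 / p'" "1 / p' < 1 / 2" by auto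
    then have "0 < p'" "2 < p'" by (auto simp: field_simps split: if_splits)
    with \<open>\<not> 2 \<le> p'\<close> show False by simp
  qed
  have n0: "0 \<le> p * real n + 1" "0 \<le> p' * real n + 1" "0 \<le> 2 * real n + 1" using p p'2 by auto
  define A where "A = mom (p' * real n + 1)"
  define B where "B = mom (p * real n + 1)"
  define M where "M = mom (2 * real n + 1)"
  have pos: "0 < A" "0 < B" "0 < M" unfolding A_def B_def M_def by (intro mom_pos n0)+
  let ?f = "test p' n"
  have AEf: "AE z in mu. cmod (?f z) powr p = cmod z powr (p' * real n)"
  proof (use AE_mu_nonzero in eventually_elim)
    fix z :: complex assume z: "z \<noteq> 0"
    have "(p' - 1) * p = p'" using pp by (simp add: algebra_simps)
    then have "real n * (p' - 1) * p = p' * real n" by simp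
    then show "cmod (?f z) powr p = cmod z powr (p' * real n)" by (simp only: norm_test[OF z] powr_powr)
  qed
  have If: "(\<integral>z. cmod (?f z) powr p \<partial>mu) = 2 * A"
  proof -
    have "(\<integral>z. cmod (?f z) powr p \<partial>mu) = (\<integral>z. cmod z powr (p' * real n) \<partial>mu)"
      by (rule integral_cong_AE[OF _ _ AEf]) measurable
    then show ?thesis by (simp add: mom_int A_def)
  qed
  have intf: "integrable mu (\<lambda>z. cmod (?f z) powr p)"
  proof (rule mu.integrable_const_bound[of _ 1])
    show "AE z in mu. norm (cmod (?f z) powr p) \<le> 1"
      using AEf AE_mu_ball by eventually_elim (use p'2 in \<open>auto intro!: powr_le1\<close>)
  qed measurable
  define c where "c = coef n * (2 * A)"
  have c: "0 < c" using coef_pos pos by (simp add: c_def)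
  have Ip: "(\<integral>z. cmod (proj ?f z) powr p \<partial>mu) = c powr p * (2 * B)"
  proof -
    have "(\<integral>z. cmod (proj ?f z) powr p \<partial>mu) = (\<integral>z. c powr p * cmod z powr (p * real n) \<partial>mu)"
    proof (rule integral_cong_AE)
      show "AE z in mu. cmod (proj ?f z) powr p = c powr p * cmod z powr (p * real n)"
      proof (use AE_mu_ball AE_mu_nonzero in eventually_elim)
        fix z :: complex assume z: "z \<in> ball 0 1" "z \<noteq> 0"
        have "proj ?f z = of_real c * z ^ n"
          using proj_test[OF p'2, of z n] z by (simp add: c_def A_def mult.commute)
        then have "cmod (proj ?f z) = c * cmod z powr real n"
          using c z by (simp add: norm_mult norm_power powr_realpow)
        then show "cmod (proj ?f z) powr p = c powr p * cmod z powr (p * real n)"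
          using c by (simp add: powr_mult powr_powr mult.commute)
      qed
    qed measurable
    then show ?thesis by (simp add: mom_int B_def)
  qed
  have h1: "(c powr p * (2 * B)) powr (1 / p) \<le> C * (2 * A) powr (1 / p)"
    using C[OF _ intf] by (simp add: Ip If)
  have h2: "(c powr p * (2 * B)) powr (1 / p) = 2 powr (1 / p) * (c * B powr (1 / p))"
    using c pos p by (simp add: powr_mult powr_powr)
  have h3: "C * (2 * A) powr (1 / p) = 2 powr (1 / p) * (C * A powr (1 / p))"
    using pos by (simp add: powr_mult)
  have "c * B powr (1 / p) \<le> C * A powr (1 / p)"
    using h1 unfolding h2 h3 by (rule mult_left_le_imp_le) simp
  then have "c * B powr (1 / p) * M \<le> C * A powr (1 / p) * M" using pos by (intro mult_right_mono) auto
  \<comment> \<open>The factors 2 in \<open>c\<close> cancel, so c M = A; writing A as a product of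
    its powers 1/p and 1/p' prepares the cancellation of A^(1/p).\<close>
  moreover have "c * M = A powr (1 / p) * A powr (1 / p')"
    using pos p by (simp add: c_def coef_def M_def flip: powr_add)
  then have "c * B powr (1 / p) * M = A powr (1 / p) * (B powr (1 / p) * A powr (1 / p'))"
    by (metis mult.assoc mult.commute)
  moreover have "C * A powr (1 / p) * M = A powr (1 / p) * (C * M)" by simp
  ultimately have "A powr (1 / p) * (B powr (1 / p) * A powr (1 / p')) \<le> A powr (1 / p) * (C * M)" by (simp only:)
  then have "B powr (1 / p) * A powr (1 / p') \<le> C * M" by (rule mult_left_le_imp_le) (use pos in simp)
  then show ?thesis by (simp only: A_def B_def M_def)
qed

text \<open>For real x take the integer n just above. On the left, q n + 1 \<le> q x + (q + 1) for q
  = p and q = p', so a shift by q + 1 compensates for both the rounding and the Jacobian; on the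
  right monotonicity suffices.\<close>

lemma moment_inequality_real:
  assumes p: "0 < p" "0 < p'"
    and C: "\<And>n. mom (p * real n + 1) powr (1 / p) * mom (p' * real n + 1) powr (1 / p') \<le> C * mom (2 * real n + 1)"
  shows "\<exists>C>0. \<forall>x\<ge>0. mom (p * x) powr (1 / p) * mom (p' * x) powr (1 / p') \<le> C * mom (2 * x)"
proof -
  obtain C1 where C1: "0 < C1" "\<And>u. 0 \<le> u \<Longrightarrow> mom u \<le> C1 * mom (u + (p + 1))" using mom_shift[of "p + 1"] p by auto
  obtain C2 where C2: "0 < C2" "\<And>u. 0 \<le> u \<Longrightarrow> mom u \<le> C2 * mom (u + (p' + 1))" using mom_shift[of "p' + 1"] p by auto
  have step: "mom (q * x) \<le> D * mom (q * real n + 1)"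
    if "0 < q" "0 < D" "\<And>u. 0 \<le> u \<Longrightarrow> mom u \<le> D * mom (u + (q + 1))" "0 \<le> x" "real n \<le> x + 1" for q D x n
  proof -
    have "mom (q * x) \<le> D * mom (q * x + (q + 1))" using that by auto
    also have "q * real n \<le> q * (x + 1)" using that by (intro mult_left_mono) auto
    then have "D * mom (q * x + (q + 1)) \<le> D * mom (q * real n + 1)"
      using that by (intro mult_left_mono mom_antimono) (auto simp: algebra_simps)
    finally show ?thesis .
  qed
  \<comment> \<open>The given C comes without a sign; the maximum makes it positive.\<close>
  define E where "E = C1 powr (1 / p) * C2 powr (1 / p') * max C 1"
  have E: "0 < E" using C1 C2 by (simp add: E_def)
  have "mom (p * x) powr (1 / p) * mom (p' * x) powr (1 / p') \<le> E * mom (2 * x)" if x: "0 \<le> x" for x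
  proof -
    obtain n :: nat where n: "x \<le> real n" "real n \<le> x + 1"
    proof
      show "x \<le> real (nat \<lceil>x\<rceil>)" by (rule real_nat_ceiling_ge)
      show "real (nat \<lceil>x\<rceil>) \<le> x + 1" using x by linarith
    qed
    have "mom (p * x) powr (1 / p) * mom (p' * x) powr (1 / p')
      \<le> (C1 * mom (p * real n + 1)) powr (1 / p) * (C2 * mom (p' * real n + 1)) powr (1 / p')"
      using p x n C1 C2 mom_pos[of "p * x"] mom_pos[of "p' * x"] by (intro mult_mono powr_mono2 step) auto
    also have "\<dots> = C1 powr (1 / p) * C2 powr (1 / p') * (mom (p * real n + 1) powr (1 / p) * mom (p' * real n + 1) powr (1 / p'))"
      by (simp add: powr_mult mult_ac)
    also have "\<dots> \<le> C1 powr (1 / p) * C2 powr (1 / p') * (max C 1 * mom (2 * x))"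
    proof (intro mult_left_mono)
      have "C * mom (2 * real n + 1) \<le> max C 1 * mom (2 * real n + 1)"
        using mom_pos[of "2 * real n + 1"] by (intro mult_right_mono) auto
      also have "\<dots> \<le> max C 1 * mom (2 * x)" using x n by (intro mult_left_mono mom_antimono) auto
      finally show "mom (p * real n + 1) powr (1 / p) * mom (p' * real n + 1) powr (1 / p') \<le> max C 1 * mom (2 * x)"
        using C[of n] by linarith
    qed simp
    finally show ?thesis by (simp add: E_def mult.assoc)
  qed
  with E show ?thesis by blast
qed

end

section \<open>Passage to Borel weights and functions\<close>

text \<open>Completeness of \<open>lebesgue\<close>: the two preimages differ by a null set.\<close>

lemma measurable_lebesgue_AE:
  fixes f g :: "'a :: euclidean_space \<Rightarrow> 'b :: topological_space"
  assumes f: "f \<in> borel_measurable lebesgue" and ae: "AE x in lebesgue. f x = g x"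
  shows "g \<in> borel_measurable lebesgue"
proof (rule measurableI)
  fix A :: "'b set" assume A: "A \<in> sets borel"
  show "g -` A \<inter> space lebesgue \<in> sets lebesgue"
  proof (rule completion.in_sets_AE)
    show "AE x in lebesgue. (x \<in> f -` A \<inter> space lebesgue) = (x \<in> g -` A \<inter> space lebesgue)"
      using ae by eventually_elim simp
    show "f -` A \<inter> space lebesgue \<in> sets lebesgue" using f A by (rule measurable_sets)
  qed simp
qed simp

lemma borel_version_complex:
  fixes f :: "'a :: euclidean_space \<Rightarrow> complex"
  assumes [measurable]: "f \<in> borel_measurable lebesgue"
  shows "\<exists>g\<in>borel_measurable borel. AE x in lborel. f x = g x"
proof -
  have r: "(\<lambda>x. Re (f x)) \<in> borel_measurable lebesgue" and i: "(\<lambda>x. Im (f x)) \<in> borel_measurable lebesgue"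
    by measurable
  obtain a where [measurable]: "a \<in> borel_measurable lborel" and a: "AE x in lborel. Re (f x) = a x"
    using completion_ex_borel_measurable_real[OF r] by blast
  obtain b where [measurable]: "b \<in> borel_measurable lborel" and b: "AE x in lborel. Im (f x) = b x"
    using completion_ex_borel_measurable_real[OF i] by blast
  have ae: "AE x in lborel. f x = Complex (a x) (b x)" using a b by eventually_elim (simp add: complex_eq_iff)
  have "(\<lambda>x. Complex (a x) (b x)) \<in> borel_measurable borel"
    by (rule borel_measurable_complex_iff[THEN iffD2]) simp
  with ae show ?thesis by (rule bexI)
qed

text \<open>The weight is changed on a null set of radii; by \<open>distr_cmod_disc\<close> the
  circles with these radii form a null set in the disc.\<close>

lemma AE_cmod_disc:
  assumes "AE r in lborel. P r"
  shows "AE z in lborel. cmod z < 1 \<longrightarrow> P (cmod z)"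
proof -
  obtain N where N: "N \<in> null_sets lborel" "{r. \<not> P r} \<subseteq> N"
    using assms unfolding eventually_ae_filter by auto
  have [measurable]: "N \<in> sets borel" using N by auto
  have "emeasure (density lborel (\<lambda>r. ennreal (2 * r * indicator {0..1} r))) N = 0"
    using N by (subst emeasure_density) (auto intro!: nn_integral_null_set)
  then have "(\<integral>\<^sup>+z. ennreal (indicator (ball 0 1) z / pi) * indicator N (cmod z) \<partial>lborel) = 0"
    by (subst emeasure_distr_density[symmetric, where N = borel]) (auto simp: distr_cmod_disc)
  then have "AE z in lborel. ennreal (indicator (ball 0 1) z / pi) * indicator N (cmod z) = 0"
    by (subst (asm) nn_integral_0_iff_AE) auto
  then show ?thesis
  proof eventually_elim
    fix z :: complex assume "ennreal (indicator (ball 0 1) z / pi) * indicator N (cmod z) = 0"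
    then show "cmod z < 1 \<longrightarrow> P (cmod z)" using N(2) by (auto simp: indicator_def split: if_splits)
  qed
qed

lemma integral_borel_version:
  fixes h w \<omega> :: "real \<Rightarrow> real"
  assumes [measurable]: "h \<in> borel_measurable borel" "w \<in> borel_measurable borel"
    and supp: "\<And>r. r \<notin> {0..<1} \<Longrightarrow> w r = 0" and ae: "AE r in lborel. r \<in> {0..<1} \<longrightarrow> \<omega> r = w r"
  shows "(LINT r:{0..<1}|lebesgue. h r * \<omega> r) = (\<integral>r. h r * w r \<partial>lborel)"
proof -
  have m: "(\<lambda>r. h r * w r) \<in> borel_measurable lborel" by measurable
  have ae': "AE r in lebesgue. h r * w r = indicator {0..<1} r *\<^sub>R (h r * \<omega> r)"
    using AE_completion[OF ae] by eventually_elim (use supp in \<open>auto simp: indicator_def\<close>)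
  have m': "(\<lambda>r. h r * w r) \<in> borel_measurable lebesgue" by (rule measurable_completion[OF m])
  have "(LINT r:{0..<1}|lebesgue. h r * \<omega> r) = (\<integral>r. h r * w r \<partial>lebesgue)"
    unfolding set_lebesgue_integral_def
    by (rule integral_cong_AE[OF _ m', symmetric, THEN sym])
      (use measurable_lebesgue_AE[OF m' ae'] ae' in auto)
  then show ?thesis by (simp add: integral_completion[OF m])
qed

lemma tail_integral_borel_version:
  assumes [measurable]: "w \<in> borel_measurable borel"
    and supp: "\<And>r. r \<notin> {0..<1} \<Longrightarrow> w r = 0" and ae: "AE r in lborel. r \<in> {0..<1} \<longrightarrow> \<omega> r = w r" and r: "0 \<le> r"
  shows "tail_integral \<omega> r = (LINT s:{r..<1}|lborel. w s)"
proof -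
  have "tail_integral \<omega> r = (LINT s:{0..<1}|lebesgue. indicator {r..} s * \<omega> s)"
    unfolding tail_integral_def set_lebesgue_integral_def using r
    by (intro Bochner_Integration.integral_cong) (auto simp: indicator_def)
  also have "\<dots> = (\<integral>s. indicator {r..} s * w s \<partial>lborel)"
    by (rule integral_borel_version[OF _ _ supp ae]) auto
  also have "\<dots> = (LINT s:{r..<1}|lborel. w s)"
    unfolding set_lebesgue_integral_def using supp
    by (intro Bochner_Integration.integral_cong) (auto simp: indicator_def)
  finally show ?thesis .
qed

text \<open>The rotation argument needs \<open>\<lambda>(s, z). f (circ s * z)\<close> to be jointly measurable, which can fail for a
  Lebesgue measurable \<open>f\<close>; weights and functions are therefore replaced by Borel versions.\<close>
locale borel_version = radial_profile w for w :: "real \<Rightarrow> real" +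
  fixes \<omega> :: "real \<Rightarrow> real"
  assumes ae_version: "AE r in lborel. r \<in> {0..<1} \<longrightarrow> \<omega> r = w r"

lemma borel_version_exists:
  assumes rw: "radial_weight \<omega>"
  shows "\<exists>w. borel_version w \<omega>"
proof -
  have int: "integrable lebesgue (\<lambda>r. indicator {0..<1} r *\<^sub>R \<omega> r)"
    using rw by (simp add: radial_weight_def set_integrable_def)
  obtain g where [measurable]: "g \<in> borel_measurable lborel" and g: "AE r in lborel. indicator {0..<1} r *\<^sub>R \<omega> r = g r"
    using completion_ex_borel_measurable_real[OF borel_measurable_integrable[OF int]] by auto
  \<comment> \<open>The Borel version g may be negative on a null set and nonzero off [0,1); both
    defects are removed so that the locale assumptions hold at every point.\<close>
  define w where "w r = indicator {0..<1} r * max 0 (g r)" for r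
  have [measurable]: "w \<in> borel_measurable borel" unfolding w_def by measurable
  have supp: "w r = 0" if "r \<notin> {0..<1}" for r using that by (simp add: w_def)
  have ae0: "AE r in lborel. indicator {0..<1} r *\<^sub>R \<omega> r = w r"
    using g
  proof eventually_elim
    fix r assume r: "indicator {0..<1} r *\<^sub>R \<omega> r = g r"
    show "indicator {0..<1} r *\<^sub>R \<omega> r = w r"
    proof (cases "r \<in> {0..<1}")
      case True
      then have "0 \<le> \<omega> r" using rw by (simp add: radial_weight_def)
      then show ?thesis using r True by (simp add: w_def)
    qed (simp add: w_def)
  qed
  have ae: "AE r in lborel. r \<in> {0..<1} \<longrightarrow> \<omega> r = w r"
    using ae0 by eventually_elim auto
  have wm: "w \<in> borel_measurable lborel" by simp
  have "integrable lebesgue w"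
    using int by (rule integrable_cong_AE_imp) (use measurable_completion[OF wm] AE_completion[OF ae0] in auto)
  then have wi: "integrable lborel w" by (simp add: integrable_completion[OF wm])
  have "radial_profile w"
  proof
    fix r :: real assume r: "0 \<le> r" "r < 1"
    have "complex_of_real r \<in> ball 0 1" using r by simp
    then have "0 < tail_integral \<omega> (cmod (of_real r))" using rw unfolding radial_weight_def by blast
    then show "0 < (LINT s:{r..<1}|lborel. w s)" using r tail_integral_borel_version[OF _ supp ae] by simp
  qed (use supp wi in \<open>auto simp: w_def\<close>)
  then show ?thesis using ae by (auto simp: borel_version_def borel_version_axioms_def)
qed

section \<open>Norms and projection expressed by the Borel weight\<close>

context borel_version begin

lemma tail_integral_eq: "0 \<le> r \<Longrightarrow> tail_integral \<omega> r = tail r"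
  unfolding tail_def by (rule tail_integral_borel_version[OF w_measurable w_support ae_version])

lemma moment_eq: "moment \<omega> x = mom x"
  unfolding moment_def mom_def by (rule integral_borel_version[OF _ _ w_support ae_version]) auto

lemma log_moment_eq: "log_moment \<omega> = L"
  by (simp add: fun_eq_iff log_moment_def L_def moment_eq)

lemma space_dA [simp]: "space dA = ball 0 1" and sets_dA [simp]: "sets dA = sets (lebesgue_on (ball 0 1))"
  by (simp_all add: dA_def)

lemma borel_measurable_dA: "f \<in> borel_measurable dA \<longleftrightarrow> f \<in> borel_measurable (lebesgue_on (ball 0 1))"
  by (simp add: dA_def)

text \<open>\<open>F\<close> is an integrand on the disc that still contains the weight,
  \<open>F'\<close> the same integrand without it. Lebesgue measure on the ball and Borel measure on
  the plane are linked by extension by zero and completion.\<close>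

lemma dA_transfer:
  fixes F F' :: "complex \<Rightarrow> 'b :: {banach, second_countable_topology}"
  assumes [measurable]: "F' \<in> borel_measurable borel"
    and ae: "AE z in lborel. cmod z < 1 \<longrightarrow> F z = w (cmod z) *\<^sub>R F' z"
  shows "F \<in> borel_measurable dA" "integral\<^sup>L dA F = integral\<^sup>L mu F'" "integrable dA F \<longleftrightarrow> integrable mu F'"
proof -
  define G where "G z = w (cmod z) *\<^sub>R F' z" for z
  have Gm: "G \<in> borel_measurable lborel" unfolding G_def by measurable
  have Gl: "G \<in> borel_measurable lebesgue" by (rule measurable_completion[OF Gm])
  have aeG: "AE z in lebesgue. G z = indicator (ball 0 1) z *\<^sub>R F z"
    using AE_completion[OF ae] by eventually_elim (use w_support in \<open>auto simp: G_def indicator_def\<close>)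
  have Fl: "(\<lambda>z. indicator (ball 0 1) z *\<^sub>R F z) \<in> borel_measurable lebesgue"
    by (rule measurable_lebesgue_AE[OF Gl aeG])
  then have Fm: "F \<in> borel_measurable (lebesgue_on (ball 0 1))"
    by (subst borel_measurable_restrict_space_iff) auto
  then show "F \<in> borel_measurable dA" by (simp add: borel_measurable_dA)
  have ae2: "AE z in lebesgue. indicator (ball 0 1) z *\<^sub>R ((1 / pi) *\<^sub>R F z) = (1 / pi) *\<^sub>R G z"
    using aeG by eventually_elim simp
  have m1: "(\<lambda>z. indicator (ball 0 1) z *\<^sub>R ((1 / pi) *\<^sub>R F z)) \<in> borel_measurable lebesgue"
    using borel_measurable_scaleR[OF borel_measurable_const Fl, of "1 / pi"] by (simp add: mult.commute)
  have m2: "(\<lambda>z. (1 / pi) *\<^sub>R G z) \<in> borel_measurable lborel" using Gm by measurable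
  have m3: "(\<lambda>z. (1 / pi) *\<^sub>R G z) \<in> borel_measurable lebesgue" by (rule measurable_completion[OF m2])
  have mu: "(\<lambda>z. (1 / pi) *\<^sub>R G z) = (\<lambda>z. (w (cmod z) / pi) *\<^sub>R F' z)" by (simp add: G_def)
  have "integral\<^sup>L dA F = integral\<^sup>L (lebesgue_on (ball 0 1)) (\<lambda>z. (1 / pi) *\<^sub>R F z)"
    unfolding dA_def by (rule integral_density[OF Fm]) auto
  also have "\<dots> = integral\<^sup>L lebesgue (\<lambda>z. indicator (ball 0 1) z *\<^sub>R ((1 / pi) *\<^sub>R F z))"
    by (rule integral_restrict_space) simp
  also have "\<dots> = integral\<^sup>L lebesgue (\<lambda>z. (1 / pi) *\<^sub>R G z)"
    by (rule integral_cong_AE[OF m1 m3 ae2])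
  also have "\<dots> = integral\<^sup>L lborel (\<lambda>z. (1 / pi) *\<^sub>R G z)" by (rule integral_completion[OF m2])
  also have "\<dots> = integral\<^sup>L mu F'"
    unfolding mu_def mu by (rule integral_density[symmetric]) (auto simp: w_nonneg)
  finally show "integral\<^sup>L dA F = integral\<^sup>L mu F'" .
  have "integrable dA F \<longleftrightarrow> integrable (lebesgue_on (ball 0 1)) (\<lambda>z. (1 / pi) *\<^sub>R F z)"
    unfolding dA_def by (rule integrable_density[OF Fm]) auto
  also have "\<dots> \<longleftrightarrow> integrable lebesgue (\<lambda>z. indicator (ball 0 1) z *\<^sub>R ((1 / pi) *\<^sub>R F z))"
    by (rule integrable_restrict_space) simp
  also have "\<dots> \<longleftrightarrow> integrable lebesgue (\<lambda>z. (1 / pi) *\<^sub>R G z)"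
    by (rule integrable_cong_AE[OF m1 m3 ae2])
  also have "\<dots> \<longleftrightarrow> integrable lborel (\<lambda>z. (1 / pi) *\<^sub>R G z)" by (rule integrable_completion[OF m2])
  also have "\<dots> \<longleftrightarrow> integrable mu F'"
    unfolding mu_def mu by (rule integrable_density[symmetric]) (auto simp: w_nonneg)
  finally show "integrable dA F \<longleftrightarrow> integrable mu F'" .
qed

lemma ae_weight: "AE z in lborel. cmod z < 1 \<longrightarrow> \<omega> (cmod z) = w (cmod z)"
  using AE_cmod_disc[OF ae_version] by eventually_elim simp

lemma Lp_transfer:
  assumes [measurable]: "f' \<in> borel_measurable borel" and ae: "AE z in lborel. cmod z < 1 \<longrightarrow> f z = f' z"
  shows "Lp_norm p \<omega> f = (\<integral>z. cmod (f' z) powr p \<partial>mu) powr (1 / p)"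
    and "integrable dA (\<lambda>z. cmod (f z) powr p * \<omega> (cmod z)) \<longleftrightarrow> integrable mu (\<lambda>z. cmod (f' z) powr p)"
proof -
  have m: "(\<lambda>z. cmod (f' z) powr p) \<in> borel_measurable borel" by measurable
  have a: "AE z in lborel. cmod z < 1 \<longrightarrow> cmod (f z) powr p * \<omega> (cmod z) = w (cmod z) *\<^sub>R (cmod (f' z) powr p)"
    using ae ae_weight by eventually_elim simp
  show "Lp_norm p \<omega> f = (\<integral>z. cmod (f' z) powr p \<partial>mu) powr (1 / p)"
    unfolding Lp_norm_def dA_transfer(2)[OF m a] ..
  show "integrable dA (\<lambda>z. cmod (f z) powr p * \<omega> (cmod z)) \<longleftrightarrow> integrable mu (\<lambda>z. cmod (f' z) powr p)"
    by (rule dA_transfer(3)[OF m a])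
qed

lemma Lp_space_borel_version:
  assumes "f \<in> Lp_space p \<omega>"
  shows "\<exists>f'\<in>borel_measurable borel. AE z in lborel. cmod z < 1 \<longrightarrow> f z = f' z"
proof -
  have "f \<in> borel_measurable (lebesgue_on (ball 0 1))"
    using assms by (simp add: Lp_space_def borel_measurable_dA)
  then have "(\<lambda>z. indicator (ball 0 1) z *\<^sub>R f z) \<in> borel_measurable lebesgue"
    by (subst (asm) borel_measurable_restrict_space_iff) auto
  then obtain f' where f': "f' \<in> borel_measurable borel" "AE z in lborel. indicator (ball 0 1) z *\<^sub>R f z = f' z"
    using borel_version_complex by blast
  have "AE z in lborel. cmod z < 1 \<longrightarrow> f z = f' z"
    using f'(2) by eventually_elim auto
  with f'(1) show ?thesis by blast
qed

lemma bergman_kernel_eq: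
  assumes "cmod z < 1" "cmod y < 1"
  shows "cnj (bergman_kernel \<omega> z y) = kern (z * cnj y)"
proof -
  have "cmod z * cmod y \<le> cmod z * 1" using assms by (intro mult_left_mono) auto
  then have x: "cmod (cnj z * y) < 1" using assms by (simp add: norm_mult)
  have e: "(cnj z * y) ^ n / of_real (2 * moment \<omega> (2 * real n + 1)) = of_real (coef n) * (cnj z * y) ^ n" for n
    by (simp add: moment_eq coef_def)
  have "cnj (bergman_kernel \<omega> z y) = (\<Sum>n. cnj (of_real (coef n) * (cnj z * y) ^ n))"
    unfolding bergman_kernel_def e
    by (rule bounded_linear.suminf[OF bounded_linear_cnj coef_summable_complex(1)[OF x]])
  then show ?thesis by (simp add: kern_def)
qed

text \<open>Although f and f' agree only almost everywhere, their projections agree at every point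
  of the disc, since f enters only under the integral.\<close>

lemma bergman_projection_eq:
  assumes [measurable]: "f' \<in> borel_measurable borel" and ae: "AE z in lborel. cmod z < 1 \<longrightarrow> f z = f' z"
    and z: "cmod z < 1"
  shows "bergman_projection \<omega> f z = proj f' z"
  unfolding bergman_projection_def proj_def
proof (rule dA_transfer(2))
  show "AE y in lborel. cmod y < 1 \<longrightarrow> f y * cnj (bergman_kernel \<omega> z y) * of_real (\<omega> (cmod y)) = w (cmod y) *\<^sub>R (f' y * kern (z * cnj y))"
    using ae ae_weight by eventually_elim (simp add: bergman_kernel_eq[OF z] scaleR_conv_of_real mult_ac)
qed measurable

lemma bounded_imp_proj_bound:
  assumes "bounded_on_Lp p \<omega> (bergman_projection \<omega>)"
  shows "\<exists>C. \<forall>f\<in>borel_measurable borel. integrable mu (\<lambda>z. cmod (f z) powr p) \<longrightarrow>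
    (\<integral>z. cmod (proj f z) powr p \<partial>mu) powr (1 / p) \<le> C * (\<integral>z. cmod (f z) powr p \<partial>mu) powr (1 / p)"
proof -
  obtain C where C: "\<And>f. f \<in> Lp_space p \<omega> \<Longrightarrow> Lp_norm p \<omega> (bergman_projection \<omega> f) \<le> C * Lp_norm p \<omega> f"
    using assms unfolding bounded_on_Lp_def by blast
  show ?thesis
  proof (intro exI[of _ C] ballI impI)
    fix f :: "complex \<Rightarrow> complex"
    assume f[measurable]: "f \<in> borel_measurable borel" and i: "integrable mu (\<lambda>z. cmod (f z) powr p)"
    have ae: "AE z in lborel. cmod z < 1 \<longrightarrow> f z = f z" by simp
    have "f \<in> borel_measurable lborel" by simp
    then have "f \<in> borel_measurable lebesgue" by (rule measurable_completion)
    then have "f \<in> borel_measurable dA" unfolding borel_measurable_dA by (rule measurable_restrict_space1)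
    then have "f \<in> Lp_space p \<omega>" using i Lp_transfer(2)[OF f ae, of p] by (simp add: Lp_space_def)
    from C[OF this] have le: "Lp_norm p \<omega> (bergman_projection \<omega> f) \<le> C * Lp_norm p \<omega> f" .
    have ae': "AE z in lborel. cmod z < 1 \<longrightarrow> bergman_projection \<omega> f z = proj f z"
      using bergman_projection_eq[OF f ae] by (intro AE_I2) simp
    show "(\<integral>z. cmod (proj f z) powr p \<partial>mu) powr (1 / p) \<le> C * (\<integral>z. cmod (f z) powr p \<partial>mu) powr (1 / p)"
      using le unfolding Lp_transfer(1)[OF measurable_proj[OF f] ae'] Lp_transfer(1)[OF f ae] .
  qed
qed

lemma proj_bound_imp_bounded:
  assumes p: "0 < p" and C: "0 < C" and bound: "\<And>f. f \<in> borel_measurable borel \<Longrightarrow>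
    (pow_int mu p (proj f)) \<le> ennreal C * (pow_int mu p f)"
  shows "bounded_on_Lp p \<omega> (bergman_projection \<omega>)"
  unfolding bounded_on_Lp_def
proof (intro exI[of _ "C powr (1 / p)"] ballI)
  fix f assume f: "f \<in> Lp_space p \<omega>"
  obtain f' where f'[measurable]: "f' \<in> borel_measurable borel" and ae: "AE z in lborel. cmod z < 1 \<longrightarrow> f z = f' z"
    using Lp_space_borel_version[OF f] by blast
  have fi: "integrable mu (\<lambda>z. cmod (f' z) powr p)"
    using f Lp_transfer(2)[OF f' ae, of p] by (simp add: Lp_space_def)
  have ae': "AE z in lborel. cmod z < 1 \<longrightarrow> bergman_projection \<omega> f z = proj f' z"
    using bergman_projection_eq[OF f' ae] by (intro AE_I2) simp
  have n: "(pow_int mu p f') = ennreal (\<integral>z. cmod (f' z) powr p \<partial>mu)"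
    using fi by (intro nn_integral_eq_integral) auto
  have b: "(pow_int mu p (proj f')) \<le> ennreal (C * (\<integral>z. cmod (f' z) powr p \<partial>mu))"
    using bound[OF f'] C unfolding n by (simp add: ennreal_mult)
  have i: "integrable mu (\<lambda>z. cmod (proj f' z) powr p)"
  proof (rule integrableI_bounded)
    show "(\<integral>\<^sup>+z. ennreal (norm (cmod (proj f' z) powr p)) \<partial>mu) < \<infinity>"
      using le_less_trans[OF b ennreal_less_top] by simp
  qed measurable
  have le: "(\<integral>z. cmod (proj f' z) powr p \<partial>mu) \<le> C * (\<integral>z. cmod (f' z) powr p \<partial>mu)"
  proof -
    have "ennreal (\<integral>z. cmod (proj f' z) powr p \<partial>mu) = (pow_int mu p (proj f'))"
      using i by (intro nn_integral_eq_integral[symmetric]) auto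
    then have "ennreal (\<integral>z. cmod (proj f' z) powr p \<partial>mu) \<le> ennreal (C * (\<integral>z. cmod (f' z) powr p \<partial>mu))" using b by simp
    then show ?thesis using C by (subst (asm) ennreal_le_iff) auto
  qed
  have "proj f' \<in> borel_measurable lborel" by simp
  then have "proj f' \<in> borel_measurable lebesgue" by (rule measurable_completion)
  then have "proj f' \<in> borel_measurable dA" unfolding borel_measurable_dA by (rule measurable_restrict_space1)
  \<comment> \<open>The two functions agree on the whole space of \<open>dA\<close>, so
    measurability passes from one to the other without any completeness argument.\<close>
  also have "proj f' \<in> borel_measurable dA \<longleftrightarrow> bergman_projection \<omega> f \<in> borel_measurable dA"
    using bergman_projection_eq[OF f' ae] by (intro measurable_cong) simp
  finally have "bergman_projection \<omega> f \<in> Lp_space p \<omega>"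
    using i Lp_transfer(2)[OF measurable_proj[OF f'] ae', of p] by (simp add: Lp_space_def)
  moreover have "Lp_norm p \<omega> (bergman_projection \<omega> f) \<le> C powr (1 / p) * Lp_norm p \<omega> f"
  proof -
    have "(\<integral>z. cmod (proj f' z) powr p \<partial>mu) powr (1 / p) \<le> (C * (\<integral>z. cmod (f' z) powr p \<partial>mu)) powr (1 / p)"
      using le p by (intro powr_mono2) auto
    also have "\<dots> = C powr (1 / p) * (\<integral>z. cmod (f' z) powr p \<partial>mu) powr (1 / p)"
      using C by (simp add: powr_mult)
    finally show ?thesis
      unfolding Lp_transfer(1)[OF measurable_proj[OF f'] ae'] Lp_transfer(1)[OF f' ae] .
  qed
  ultimately show "bergman_projection \<omega> f \<in> Lp_space p \<omega> \<and> Lp_norm p \<omega> (bergman_projection \<omega> f) \<le> C powr (1 / p) * Lp_norm p \<omega> f"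
    by blast
qed

end

section \<open>Equivalence of boundedness and doubling\<close>

theorem corollary8:
  fixes \<omega> :: "real \<Rightarrow> real" and p p' :: real
  assumes "radial_weight \<omega>"
    and "1 < p" and "p < 2"
    and "1 / p + 1 / p' = 1"
    and "moment_condition p p' \<omega> \<or> convexity_condition p \<omega>"
  shows "bounded_on_Lp p \<omega> (bergman_projection \<omega>) \<longleftrightarrow> \<omega> \<in> D_hat"
proof -
  obtain w where "borel_version w \<omega>" using borel_version_exists[OF assms(1)] by blast
  then interpret borel_version w \<omega> .
  have D: "\<omega> \<in> D_hat \<longleftrightarrow> (\<exists>C\<ge>1. \<forall>r\<in>{0..<1}. tail r \<le> C * tail ((1 + r) / 2))"
    using assms(1) by (simp add: D_hat_def tail_integral_eq)
  show ?thesis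
  proof
    assume "\<omega> \<in> D_hat"
    then obtain C where C: "1 \<le> C" "\<And>r. 0 \<le> r \<Longrightarrow> r < 1 \<Longrightarrow> tail r \<le> C * tail ((1 + r) / 2)"
      unfolding D by auto
    obtain K where "0 < K" "\<And>f. f \<in> borel_measurable borel \<Longrightarrow>
        (pow_int mu p (proj f)) \<le> ennreal K * (pow_int mu p f)"
      using proj_bounded[OF assms(2,3) C] by metis
    then show "bounded_on_Lp p \<omega> (bergman_projection \<omega>)"
      using assms(2) by (intro proj_bound_imp_bounded) auto
  next
    assume "bounded_on_Lp p \<omega> (bergman_projection \<omega>)"
    then obtain C where C: "\<And>f. f \<in> borel_measurable borel \<Longrightarrow> integrable mu (\<lambda>z. cmod (f z) powr p) \<Longrightarrow>
        (\<integral>z. cmod (proj f z) powr p \<partial>mu) powr (1 / p) \<le> C * (\<integral>z. cmod (f z) powr p \<partial>mu) powr (1 / p)"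
      using bounded_imp_proj_bound by metis
    have "1 / p < 1" using assms(2) by simp
    then have "0 < 1 / p'" using assms(4) by linarith
    then have p': "0 < p'" by (simp add: zero_less_divide_iff)
    obtain E where E: "0 < E" "\<And>x. 0 \<le> x \<Longrightarrow> mom (p * x) powr (1 / p) * mom (p' * x) powr (1 / p') \<le> E * mom (2 * x)"
      using moment_inequality_real[OF _ p' moment_inequality_nat[OF assms(2,3,4) C]] assms(2) by force
    have "\<exists>C. \<forall>x>0. mom x \<le> C * mom (2 * x)"
      using assms(5)
    proof
      assume "moment_condition p p' \<omega>"
      then obtain e K where "0 < e" "0 < K"
        "\<And>x. 0 \<le> x \<Longrightarrow> mom (2 * x) \<le> K * (mom ((p + e) * x) powr (1 / p) * mom (p' * x) powr (1 / p'))"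
        unfolding moment_condition_def moment_eq by blast
      then show ?thesis
        using mom_doubling_of_moment_condition[OF assms(2,4) _ E(2) _ E(1)] by blast
    next
      assume "convexity_condition p \<omega>"
      then obtain K where "0 < K" "\<And>y. 0 \<le> y \<Longrightarrow> \<exists>x\<ge>0. - (deriv ^^ 2) L y * y\<^sup>2 \<le>
          K * x * (LINT t:{(2 + p) / 2 * x..2 * x}|lebesgue. - (deriv ^^ 2) L t)"
        unfolding convexity_condition_def log_moment_eq by blast
      then show ?thesis
        using mom_doubling_of_convexity_condition[OF assms(2,3,4) E(2,1)] by blast
    qed
    then show "\<omega> \<in> D_hat"
      unfolding D using tail_doubling_of_mom_doubling by blast
  qed
qed

end
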